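(* Let $\psi:\mathbb{Z}_{>0}\to\mathbb{R}_{>0}$ be a decreasing function such that $\psi(q)<e^{-q^4}$. Let $x_1,\dots,x_n$ be real numbers. Assume that there exists a sequence $(q_k)_{k\geqslant 1}$ of positive integers such that $$0<k^{n-1}\Vert q_kx_n\Vert\leqslant k^{n-2}\Vert q_kx_{n-1}\Vert\leqslant\cdots\leqslant k\Vert q_kx_2\Vert\leqslant\Vert q_kx_1\Vert\leqslant\psi(q_k)$$ for all $k\geqslant 1$. Then the $n$-tuple $(x_1,\dots,x_n)$ satisfies the Strong Schanuel Property.
   Context: $\Vert x\Vert$ denotes the distance of the real number $x$ to the nearest integer. The inequality $\psi(q)<e^{-q^4}$ is for all $q\in\mathbb{Z}_{>0}$. An $n$-tuple $(x_1,\dots,x_n)$ of complex numbers satisfies the Strong Schanuel Property if the $2n$ numbers $x_1,\dots,x_n,e^{x_1},\dots,e^{x_n}$ are algebraically independent over $\mathbb{Q}$.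
   Formalization: For n=1 the formal theorem also assumes that the q_k take infinitely many values; without this the claim fails there (q_k=1, x_1=1/100, ψ(q)=e^{-q^4}/2); for n≥2 nothing is added. *)

theory Defs
  imports "HOL-Analysis.Analysis" "HOL-Library.Poly_Mapping"
begin

abbreviation nearest_int_dist :: "real \<Rightarrow> real"
  where "nearest_int_dist x \<equiv> infdist x \<int>"

(* Polynomials over the rationals in indeterminates X_i, i :: 'i, are finitely supported maps
   from monomials (finitely supported exponent vectors) to coefficients. *)

type_synonym 'i rat_mpoly = "('i \<Rightarrow>\<^sub>0 nat) \<Rightarrow>\<^sub>0 rat"

definition indeterminates :: "'i rat_mpoly \<Rightarrow> 'i set"
  where "indeterminates p = (\<Union>m\<in>Poly_Mapping.keys p. Poly_Mapping.keys m)"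

definition eval_mpoly :: "('i \<Rightarrow> complex) \<Rightarrow> 'i rat_mpoly \<Rightarrow> complex"
  where "eval_mpoly z p =
    (\<Sum>m\<in>Poly_Mapping.keys p. of_rat (Poly_Mapping.lookup p m) *
      (\<Prod>i\<in>Poly_Mapping.keys m. z i ^ Poly_Mapping.lookup m i))"

(* Independence of the family (z i), i in I, rather than of the set z ` I: a family with a
   repeated value is dependent. *)

definition algebraically_independent_over_rat :: "'i set \<Rightarrow> ('i \<Rightarrow> complex) \<Rightarrow> bool"
  where "algebraically_independent_over_rat I z \<longleftrightarrow>
    (\<forall>p. p \<noteq> 0 \<and> indeterminates p \<subseteq> I \<longrightarrow> eval_mpoly z p \<noteq> 0)"

(* The tuple is x 1, ..., x n; the 2n numbers are indexed by the disjoint sum of two copies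
   of {1..n}. *)

definition strong_schanuel_property :: "nat \<Rightarrow> (nat \<Rightarrow> complex) \<Rightarrow> bool"
  where "strong_schanuel_property n x \<longleftrightarrow>
    algebraically_independent_over_rat ({1..n} <+> {1..n}) (case_sum x (\<lambda>i. exp (x i)))"

end

theory Submission
  imports Defs "HOL-Complex_Analysis.Complex_Analysis" "HOL-Real_Asymp.Real_Asymp"
    "Berlekamp_Zassenhaus.Factor_Bound" "Subresultants.Subresultant_Gcd"
begin

text \<open>
  Let \<open>F t = P (t, exp t)\<close> with an integer polynomial \<open>P\<close> and \<open>F x = 0\<close>, and let \<open>p / q\<close> be a rational
  approximation of \<open>x\<close>. Up to a power of \<open>q\<close>, \<open>F (p / q)\<close> is a Laurent polynomial in \<open>exp (1 / q)\<close>
  of degree \<open>O(q)\<close> with integer coefficients of size \<open>q ^ O(1)\<close>, so it is either zero or at least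
  \<open>exp (- q ^ 4 / 2)\<close> in absolute value. Since \<open>F (p / q)\<close> is \<open>O(exp (- q ^ 4))\<close>, it vanishes.
  The error of \<open>p / q\<close> is dominated by its first coordinate, so the difference quotient of \<open>F\<close> in the first
  direction tends to zero and \<open>\<partial>\<^sub>1 F x = 0\<close>. The function \<open>\<partial>\<^sub>1 F\<close> has the same form, hence all its iterates
  vanish at \<open>x\<close>; this forces every coefficient of \<open>P\<close>, read as a polynomial in \<open>t\<^sub>1\<close> and \<open>exp t\<^sub>1\<close>, to vanish
  at the remaining coordinates, and one concludes by induction on their number.

  The lower bound at \<open>Y = exp (1 / q)\<close> is a transcendence measure proved by Gelfond's argument. For an
  irreducible \<open>R\<close> of degree \<open>d\<close>, the pigeonhole principle yields an exponential polynomial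
  \<open>G w = (\<Sum>i j k. c i j k * Y ^ k * w ^ i * exp (j * w))\<close> with \<open>k < d\<close>, small integers \<open>c i j k\<close> and tiny
  Taylor coefficients at \<open>0\<close>. Its derivatives at the points \<open>s / q\<close> are tiny values of integer polynomials
  \<open>V\<close> at \<open>Y\<close>. By a zero estimate (a Wronskian determinant, as in Siegel and Shidlovsky), one of these \<open>V\<close>
  does not vanish at a root of \<open>R\<close>; then \<open>R\<close> and \<open>V\<close> have a nonzero integer resultant and cannot both
  be small at \<open>Y\<close>.
\<close>

hide_const (open) module.smult up_ring.coeff up_ring.monom


subsection \<open>Zero estimate for exponential polynomials\<close>

text \<open>The number \<open>exp (1 / q)\<close> changes with \<open>q\<close>, so its measure must
  be uniform in \<open>q\<close>, for degrees that themselves grow like \<open>q\<close>. The bound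
  obtained has the form \<open>exp (- O(q ^ 3 * log q ^ 4))\<close>, and this is why an error of
  \<open>exp (- q ^ 4)\<close> suffices. The points \<open>s / q\<close> are chosen because
  \<open>exp (s / q) = Y ^ s\<close>. The obstacle is nonvanishing. Small values \<open>V\<close> at
  \<open>Y\<close> say nothing unless some \<open>V\<close> is coprime to \<open>R\<close>, and this
  is decided at a root \<theta> of \<open>R\<close>, where the exponential function is no longer
  available. The zero estimate is therefore purely algebraic: values of exponentials become
  arbitrary nonzero constants, and only the differential equation of \<open>exp (c * w)\<close> is
  used. Irreducibility of \<open>R\<close> turns a nonroot into coprimality and forbids integer
  relations of degree below \<open>d\<close> at \<theta>, hence the range \<open>k < d\<close>.
  Other polynomials are reached by multiplying the bounds of their factors, so the exponent in the
  bound is kept linear in the degree.\<close>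

text \<open>The derivative of \<open>p * exp (c * w)\<close> is
  \<open>twisted_pderiv c p * exp (c * w)\<close>. Leaving out the exponential factor keeps
  everything polynomial.\<close>

definition twisted_pderiv :: "'a::idom \<Rightarrow> 'a poly \<Rightarrow> 'a poly"
  where "twisted_pderiv c p = pderiv p + smult c p"

lemma degree_twisted_pderiv_le: "degree (twisted_pderiv c p) \<le> degree p"
proof -
  have "degree (pderiv p) \<le> degree p"
    using degree_pderiv_le[of p] by simp
  then show ?thesis
    unfolding twisted_pderiv_def
    by (meson degree_add_le degree_smult_le)
qed

lemma degree_twisted_pderiv_funpow_le: "degree ((twisted_pderiv c ^^ k) p) \<le> degree p"
  by (induction k) (auto intro: order_trans[OF degree_twisted_pderiv_le])

lemma twisted_pderiv_funpow_Suc: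
  "(twisted_pderiv c ^^ Suc k) p = pderiv ((twisted_pderiv c ^^ k) p) + smult c ((twisted_pderiv c ^^ k) p)"
  by (simp add: twisted_pderiv_def)

lemma coeff_twisted_pderiv_funpow_degree:
  "coeff ((twisted_pderiv c ^^ k) p) (degree p) = c ^ k * lead_coeff p"
proof (induction k)
  case (Suc k)
  let ?r = "(twisted_pderiv c ^^ k) p"
  have "coeff ?r (Suc (degree p)) = 0"
    using degree_twisted_pderiv_funpow_le[of k c p] by (intro coeff_eq_0) simp
  then show ?case using Suc unfolding twisted_pderiv_funpow_Suc by (simp add: coeff_pderiv)
qed simp

text \<open>The bounds on the degrees need not be attained. The Wronskian needs this: for
  \<open>c = 0\<close> and \<open>k > 0\<close> the coefficient \<open>c ^ k * lead_coeff p\<close>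
  is zero.\<close>

lemma coeff_mult_at_bounds:
  fixes p r :: "'a::comm_semiring_1 poly"
  assumes "degree p \<le> m" "degree r \<le> n"
  shows "coeff (p * r) (m + n) = coeff p m * coeff r n"
proof -
  have "coeff (p * r) (m + n) = (\<Sum>i\<le>m + n. coeff p i * coeff r (m + n - i))"
    by (rule coeff_mult)
  also have "\<dots> = (\<Sum>i\<in>{m}. coeff p i * coeff r (m + n - i))"
  proof (rule sum.mono_neutral_right)
    show "\<forall>i\<in>{..m + n} - {m}. coeff p i * coeff r (m + n - i) = 0"
    proof
      fix i assume "i \<in> {..m + n} - {m}"
      then consider "i > m" | "i < m" by fastforce
      then show "coeff p i * coeff r (m + n - i) = 0"
        using assms by cases (auto simp: coeff_eq_0)
    qed
  qed auto
  finally show ?thesis by simp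
qed

lemma coeff_prod_at_bounds:
  fixes f :: "'b \<Rightarrow> 'a::comm_semiring_1 poly"
  assumes "finite I" "\<And>i. i \<in> I \<Longrightarrow> degree (f i) \<le> d i"
  shows "coeff (\<Prod>i\<in>I. f i) (\<Sum>i\<in>I. d i) = (\<Prod>i\<in>I. coeff (f i) (d i))"
  using assms
proof (induction I rule: finite_induct)
  case (insert i I)
  have "degree (\<Prod>i\<in>I. f i) \<le> (\<Sum>i\<in>I. degree (f i))"
    using degree_prod_sum_le[OF insert.hyps(1), of f] by (simp add: o_def)
  also have "\<dots> \<le> (\<Sum>i\<in>I. d i)"
    using insert by (intro sum_mono) auto
  finally show ?case using insert by (simp add: coeff_mult_at_bounds)
qed simp

text \<open>A kernel vector of the transpose, read as the coefficients of a polynomial of degree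
  below \<open>r\<close>, would give that polynomial the \<open>r\<close> distinct roots
  \<open>lam i\<close>.\<close>

lemma det_scaled_vandermonde_neq_0:
  fixes lam b :: "nat \<Rightarrow> 'a::field"
  assumes inj: "inj_on lam {..<r}" and b: "\<And>i. i < r \<Longrightarrow> b i \<noteq> 0"
  shows "Determinant.det (mat r r (\<lambda>(k, i). lam i ^ k * b i)) \<noteq> 0"
proof
  let ?A = "mat r r (\<lambda>(k, i). lam i ^ k * b i)"
  let ?B = "mat r r (\<lambda>(i, k). lam i ^ k * b i)"
  assume "Determinant.det ?A = 0"
  moreover have "?B = transpose_mat ?A" by (intro eq_matI) auto
  moreover have "Determinant.det (transpose_mat ?A) = Determinant.det ?A"
    by (rule det_transpose[of _ r]) simp
  ultimately have "Determinant.det ?B = 0" by simp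
  then obtain v where v: "v \<in> carrier_vec r" "v \<noteq> 0\<^sub>v r" "?B *\<^sub>v v = 0\<^sub>v r"
    using det_0_iff_vec_prod_zero_field[of ?B r] by auto
  define P where "P = (\<Sum>k<r. monom (vec_index v k) k)"
  have coeffP: "coeff P k = (if k < r then vec_index v k else 0)" for k
    unfolding P_def by (simp add: coeff_sum)
  have "poly P (lam i) = 0" if i: "i < r" for i
  proof -
    have "0 = vec_index (?B *\<^sub>v v) i" unfolding v(3) using i by simp
    also have "\<dots> = (\<Sum>k<r. lam i ^ k * b i * vec_index v k)"
      using v(1) i by (simp add: scalar_prod_def atLeast0LessThan)
    also have "\<dots> = b i * poly P (lam i)"
      by (simp add: P_def poly_sum poly_monom sum_distrib_left mult_ac)
    finally show ?thesis using b[OF i] by simp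
  qed
  then have sub: "lam ` {..<r} \<subseteq> {x. poly P x = 0}" by auto
  have "P = 0"
  proof (rule ccontr)
    assume P: "P \<noteq> 0"
    have "r = card (lam ` {..<r})" using inj by (simp add: card_image)
    also have "\<dots> \<le> card {x. poly P x = 0}"
      using sub poly_roots_finite[OF P] by (rule card_mono[rotated])
    also have "\<dots> \<le> degree P" by (rule card_poly_roots_bound[OF P])
    finally have "coeff P (degree P) = 0" using coeffP by simp
    then show False using P by simp
  qed
  then have "vec_index v k = 0" if "k < r" for k
    using coeffP[of k] that by simp
  then have "v = 0\<^sub>v r" using v(1) by (intro eq_vecI) auto
  then show False using v(2) by simp
qed

text \<open>This is the Wronskian of the functions \<open>a i * exp (lam i * w)\<close> with the
  exponential factor divided out of each column, which makes it a polynomial.\<close>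

definition wronskian :: "nat \<Rightarrow> (nat \<Rightarrow> 'a::idom) \<Rightarrow> (nat \<Rightarrow> 'a poly) \<Rightarrow> 'a poly"
  where "wronskian r lam a = Determinant.det (mat r r (\<lambda>(k, i). (twisted_pderiv (lam i) ^^ k) (a i)))"

lemma degree_wronskian_le:
  assumes "\<And>i. i < r \<Longrightarrow> degree (a i) \<le> D"
  shows "degree (wronskian r lam a) \<le> D * r"
  unfolding wronskian_def
  by (rule degree_det_le) (use assms in \<open>auto intro: order_trans[OF degree_twisted_pderiv_funpow_le]\<close>)

text \<open>Differentiation lowers degrees, so in the highest possible degree each twisted
  derivative acts as multiplication by \<open>lam i\<close>. The coefficient there is a scaled
  Vandermonde determinant.\<close>

lemma wronskian_neq_0:
  fixes lam :: "nat \<Rightarrow> 'a::field"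
  assumes inj: "inj_on lam {..<r}" and a: "\<And>i. i < r \<Longrightarrow> a i \<noteq> 0"
  shows "wronskian r lam a \<noteq> 0"
proof
  let ?M = "mat r r (\<lambda>(k, i). (twisted_pderiv (lam i) ^^ k) (a i))"
  let ?N = "mat r r (\<lambda>(k, i). lam i ^ k * lead_coeff (a i))"
  let ?D = "\<Sum>i = 0..<r. degree (a i)"
  assume "wronskian r lam a = 0"
  have "coeff (wronskian r lam a) ?D =
      (\<Sum>p | p permutes {0..<r}. coeff (signof p * (\<Prod>i = 0..<r. ?M $$ (i, p i))) ?D)"
    unfolding wronskian_def by (subst det_def'[of _ r]) (auto simp: coeff_sum)
  also have "\<dots> = (\<Sum>p | p permutes {0..<r}. signof p * (\<Prod>i = 0..<r. ?N $$ (i, p i)))"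
  proof (rule sum.cong)
    fix p assume "p \<in> {p. p permutes {0..<r}}"
    then have p: "p permutes {0..<r}" by simp
    have pi: "p i < r" if "i < r" for i
      using permutes_in_image[OF p, of i] that by simp
    \<comment> \<open>The degree bounds depend on the column only, so every permutation yields the
      same total degree \<open>?D\<close>.\<close>
    have "?D = (\<Sum>i = 0..<r. degree (a (p i)))"
      using sum.permute[OF p, of "\<lambda>i. degree (a i)"] by (simp add: o_def)
    then have "coeff (\<Prod>i = 0..<r. ?M $$ (i, p i)) ?D
        = (\<Prod>i = 0..<r. coeff (?M $$ (i, p i)) (degree (a (p i))))"
      by (simp only:) (rule coeff_prod_at_bounds, use pi in \<open>auto intro: degree_twisted_pderiv_funpow_le\<close>)
    also have "\<dots> = (\<Prod>i = 0..<r. ?N $$ (i, p i))"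
      by (rule prod.cong) (use pi in \<open>auto simp: coeff_twisted_pderiv_funpow_degree\<close>)
    finally have *: "coeff (\<Prod>i = 0..<r. ?M $$ (i, p i)) ?D = (\<Prod>i = 0..<r. ?N $$ (i, p i))" .
    show "coeff (signof p * (\<Prod>i = 0..<r. ?M $$ (i, p i))) ?D =
        signof p * (\<Prod>i = 0..<r. ?N $$ (i, p i))"
      unfolding *[symmetric] by (auto simp: sign_def)
  qed simp
  also have "\<dots> = Determinant.det ?N"
    by (subst det_def'[of _ r]) auto
  finally have "Determinant.det ?N = 0" using \<open>wronskian r lam a = 0\<close> by simp
  moreover have "Determinant.det ?N \<noteq> 0"
    by (rule det_scaled_vandermonde_neq_0[OF inj]) (use a in auto)
  ultimately show False by simp
qed

section \<open>Orders of vanishing through formal power series\<close>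

lemma fps_nth_eq_deriv_0:
  fixes f :: "'a::field_char_0 fps"
  shows "fps_nth f m = fps_nth ((fps_deriv ^^ m) f) 0 / fact m"
proof (induction m arbitrary: f)
  case (Suc m)
  have "fps_nth f (Suc m) = fps_nth (fps_deriv f) m / of_nat (Suc m)"
    by (simp add: field_simps del: of_nat_Suc)
  also have "\<dots> = fps_nth ((fps_deriv ^^ Suc m) f) 0 / fact (Suc m)"
    by (subst Suc) (simp add: funpow_swap1 field_simps)
  finally show ?case .
qed simp

text \<open>Taylor expansion at \<open>w\<close> as a formal series: orders of vanishing can then be
  counted over any field of characteristic 0, without convergence.\<close>

definition fps_at :: "'a \<Rightarrow> 'a::comm_ring_1 poly \<Rightarrow> 'a fps"
  where "fps_at w p = fps_of_poly (p \<circ>\<^sub>p [:w, 1:])"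

lemma fps_at_hom: "comm_ring_hom (fps_at w)"
  by unfold_locales (simp_all add: fps_at_def pcompose_add pcompose_mult fps_of_poly_add fps_of_poly_mult)

lemma fps_deriv_at: "fps_deriv (fps_at w p) = fps_at w (pderiv p)"
  for w :: "'a::idom"
  by (simp add: fps_at_def fps_of_poly_pderiv[symmetric] pderiv_pcompose pderiv_pCons)

lemma fps_at_nth_0: "fps_nth (fps_at w p) 0 = poly p w"
  by (simp add: fps_at_def poly_0_coeff_0[symmetric] poly_pcompose)

text \<open>The constant \<open>z\<close> stands where the value of \<open>exp (c * w)\<close> at
  the point would stand; the differential equation leaves it free. Powers of an algebraic number can
  thus be inserted later.\<close>

lemma fps_deriv_at_times_exp:
  fixes c :: "'a::field_char_0"
  shows "(fps_deriv ^^ k) (fps_at w p * (fps_const z * fps_exp c))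
    = fps_at w ((twisted_pderiv c ^^ k) p) * (fps_const z * fps_exp c)"
proof (induction k)
  case (Suc k)
  interpret comm_ring_hom "fps_at w" by (rule fps_at_hom)
  have smult: "fps_at w (smult c p) = fps_const c * fps_at w p" for p
    by (simp add: fps_at_def pcompose_smult fps_of_poly_smult)
  show ?case
    unfolding funpow.simps(2)[of k fps_deriv] o_apply Suc twisted_pderiv_funpow_Suc
    by (simp add: hom_add smult fps_deriv_at algebra_simps)
qed simp

lemma linear_power_dvd_if_fps_at:
  fixes p :: "'a::field poly"
  assumes "\<And>i. i < m \<Longrightarrow> fps_nth (fps_at w p) i = 0"
  shows "[:- w, 1:] ^ m dvd p"
proof -
  have "monom 1 m dvd p \<circ>\<^sub>p [:w, 1:]"
    using assms by (simp add: monom_1_dvd_iff' fps_at_def)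
  then obtain h where h: "p \<circ>\<^sub>p [:w, 1:] = monom 1 m * h" by (elim dvdE)
  have id: "p \<circ>\<^sub>p pCons 0 1 = p"
    by (induction p) (simp_all add: pcompose_pCons)
  have "p = (p \<circ>\<^sub>p [:w, 1:]) \<circ>\<^sub>p [:- w, 1:]"
    by (simp add: pcompose_assoc[symmetric] pcompose_pCons id)
  also have "\<dots> = [:- w, 1:] ^ m * (h \<circ>\<^sub>p [:- w, 1:])"
    unfolding h by (simp add: pcompose_mult monom_altdef pcompose_hom.hom_power pcompose_pCons)
  finally show ?thesis by (metis dvd_triv_left)
qed

text \<open>The combination \<phi> vanishes to order \<open>m + r\<close>, so its derivatives of
  order below \<open>r\<close> still vanish to order \<open>m + 1\<close>. By Cramer's rule these
  derivatives generate the determinant up to a unit.\<close>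

lemma wronskian_vanishing_order:
  fixes lam z :: "nat \<Rightarrow> 'a::field_char_0"
  assumes r: "r > 0" and z: "z 0 \<noteq> 0"
    and van: "\<And>t. t < m + r \<Longrightarrow> (\<Sum>i<r. poly ((twisted_pderiv (lam i) ^^ t) (a i)) w * z i) = 0"
  shows "[:- w, 1:] ^ Suc m dvd wronskian r lam a"
proof (rule linear_power_dvd_if_fps_at)
  fix l assume l: "l < Suc m"
  interpret H: comm_ring_hom "fps_at w" by (rule fps_at_hom)
  let ?E = "\<lambda>i. fps_const (z i) * fps_exp (lam i)"
  let ?M = "mat r r (\<lambda>(k, i). (twisted_pderiv (lam i) ^^ k) (a i))"
  let ?A = "map_mat (fps_at w) ?M"
  have detA: "Determinant.det ?A = fps_at w (wronskian r lam a)"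
    unfolding wronskian_def by (rule H.hom_det)
  have A: "?A \<in> carrier_mat r r" by simp
  define \<phi> where "\<phi> = (\<Sum>i<r. fps_at w (a i) * ?E i)"
  have dphi: "(fps_deriv ^^ k) \<phi> = (\<Sum>i<r. fps_at w ((twisted_pderiv (lam i) ^^ k) (a i)) * ?E i)" for k
  proof -
    have "(fps_deriv ^^ k) (\<Sum>i<r. f i) = (\<Sum>i<r. (fps_deriv ^^ k) (f i))" for f :: "nat \<Rightarrow> 'a fps"
      by (induction k) (simp_all add: fps_deriv_sum)
    then show ?thesis unfolding \<phi>_def by (simp add: fps_deriv_at_times_exp)
  qed
  have dphi0: "fps_nth ((fps_deriv ^^ t) \<phi>) 0 = 0" if "t < m + r" for t
    using van[OF that] by (simp add: dphi fps_sum_nth fps_mult_nth_0 fps_at_nth_0)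
  have phi_nth: "fps_nth ((fps_deriv ^^ k) \<phi>) i = 0" if "k < r" "i \<le> m" for k i
    using dphi0[of "i + k"] that
    by (subst fps_nth_eq_deriv_0) (simp add: funpow_add)
  \<comment> \<open>The matrix \<open>?A\<close> maps the vector of the \<open>?E i\<close> to the
    vector of the derivatives of \<phi>; row 0 of the adjugate isolates \<open>?E 0\<close>.\<close>
  have "Determinant.det ?A * ?E 0 = (\<Sum>k<r. adj_mat ?A $$ (0, k) * (fps_deriv ^^ k) \<phi>)"
  proof -
    have ent: "(\<Sum>k<r. adj_mat ?A $$ (0, k) * ?A $$ (k, i)) = (if i = 0 then Determinant.det ?A else 0)"
      if i: "i < r" for i
    proof -
      have "(adj_mat ?A * ?A) $$ (0, i) = (Determinant.det ?A \<cdot>\<^sub>m 1\<^sub>m r) $$ (0, i)"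
        using adj_mat(3)[OF A] by simp
      moreover have "(adj_mat ?A * ?A) $$ (0, i) = (\<Sum>k<r. adj_mat ?A $$ (0, k) * ?A $$ (k, i))"
        using adj_mat(1)[OF A] r i by (simp add: scalar_prod_def atLeast0LessThan)
      ultimately show ?thesis using r i by auto
    qed
    have "(\<Sum>k<r. adj_mat ?A $$ (0, k) * (fps_deriv ^^ k) \<phi>)
        = (\<Sum>k<r. \<Sum>i<r. adj_mat ?A $$ (0, k) * ?A $$ (k, i) * ?E i)"
      unfolding dphi by (rule sum.cong) (simp_all add: sum_distrib_left mult.assoc)
    also have "\<dots> = (\<Sum>i<r. (\<Sum>k<r. adj_mat ?A $$ (0, k) * ?A $$ (k, i)) * ?E i)"
      by (subst sum.swap) (simp add: sum_distrib_right)
    also have "\<dots> = (\<Sum>i<r. if i = 0 then Determinant.det ?A * ?E 0 else 0)"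
      by (rule sum.cong) (use ent in auto)
    also have "\<dots> = Determinant.det ?A * ?E 0" using r by simp
    finally show ?thesis by simp
  qed
  moreover have "fps_nth (\<Sum>k<r. adj_mat ?A $$ (0, k) * (fps_deriv ^^ k) \<phi>) i = 0" if "i \<le> m" for i
    using that by (simp add: fps_sum_nth fps_mult_nth phi_nth)
  ultimately have van': "fps_nth (Determinant.det ?A * ?E 0) i = 0" if "i \<le> m" for i
    using that by simp
  \<comment> \<open>\<open>?E 0\<close> is invertible as a series because \<open>z 0\<close> is
    nonzero, so it does not change the order of vanishing.\<close>
  have "Determinant.det ?A = (Determinant.det ?A * ?E 0) * (fps_const (inverse (z 0)) * fps_exp (- lam 0))"
  proof -
    have "?E 0 * (fps_const (inverse (z 0)) * fps_exp (- lam 0)) =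
        fps_const (z 0 * inverse (z 0)) * (fps_exp (lam 0) * fps_exp (- lam 0))"
      by (simp only: fps_const_mult[symmetric] mult_ac)
    also have "\<dots> = 1" using z by (simp add: fps_exp_add_mult[symmetric])
    finally show ?thesis by (simp only: mult.assoc mult_1_right)
  qed
  also have "fps_nth \<dots> l = 0"
    unfolding fps_mult_nth[of "Determinant.det ?A * ?E 0"]
    by (rule sum.neutral) (use van' l in auto)
  finally show "fps_nth (fps_at w (wronskian r lam a)) l = 0" by (simp only: detA)
qed

lemma prod_linear_powers_dvd:
  fixes w :: "nat \<Rightarrow> 'a::field_gcd"
  assumes "inj_on w {..<S}" "\<And>s. s < S \<Longrightarrow> [:- w s, 1:] ^ m dvd p"
  shows "(\<Prod>s<S. [:- w s, 1:] ^ m) dvd p"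
  using assms
proof (induction S)
  case (Suc S)
  have "algebraic_semidom_class.coprime [:- w i, 1:] [:- w S, 1:]" if "i < S" for i
  proof (rule algebraic_semidom_class.coprimeI)
    fix c assume "c dvd [:- w i, 1:]" "c dvd [:- w S, 1:]"
    then have "c dvd [:- w i, 1:] - [:- w S, 1:]" by (rule dvd_diff)
    then have "c dvd [:w S - w i:]" by simp
    moreover have "w S - w i \<noteq> 0"
      using Suc.prems(1) that by (auto dest!: inj_onD[where x = S and y = i])
    then have "is_unit [:w S - w i:]" by (simp add: is_unit_const_poly_iff)
    ultimately show "is_unit c" using dvd_trans by blast
  qed
  then have "algebraic_semidom_class.coprime (\<Prod>s<S. [:- w s, 1:] ^ m) ([:- w S, 1:] ^ m)"
    by (intro prod_coprime_left) simp
  moreover have "(\<Prod>s<S. [:- w s, 1:] ^ m) dvd p"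
    using Suc by (auto simp: inj_on_def)
  ultimately show ?case using Suc.prems(2)[of S] by (simp only: prod.lessThan_Suc semiring_gcd_class.divides_mult)
qed simp

text \<open>The Wronskian is nonzero of degree at most \<open>D * r\<close>, yet it is divisible by
  \<open>Suc m\<close> factors for each of the \<open>S\<close> points.\<close>

lemma exp_poly_zero_estimate_aux:
  fixes lam w :: "nat \<Rightarrow> 'a::{field_char_0, field_gcd}"
  assumes r: "r > 0" and inj: "inj_on lam {..<r}"
    and a: "\<And>i. i < r \<Longrightarrow> a i \<noteq> 0" "\<And>i. i < r \<Longrightarrow> degree (a i) \<le> D"
    and w: "inj_on w {..<S}" and z: "\<And>s i. s < S \<Longrightarrow> z s i \<noteq> 0"
    and van: "\<And>s t. s < S \<Longrightarrow> t < m + r \<Longrightarrow>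
      (\<Sum>i<r. poly ((twisted_pderiv (lam i) ^^ t) (a i)) (w s) * z s i) = 0"
  shows "S * Suc m \<le> D * r"
proof -
  have "(\<Prod>s<S. [:- w s, 1:] ^ Suc m) dvd wronskian r lam a"
    by (rule prod_linear_powers_dvd[OF w], rule wronskian_vanishing_order[OF r z van])
  then have "degree (\<Prod>s<S. [:- w s, 1:] ^ Suc m) \<le> degree (wronskian r lam a)"
    by (rule dvd_imp_degree_le) (rule wronskian_neq_0[OF inj a(1)])
  also have "\<dots> \<le> D * r" by (rule degree_wronskian_le[OF a(2)])
  finally show ?thesis
    by (simp add: degree_prod_eq_sum_degree degree_power_eq del: power_Suc mult_Suc_right)
qed

text \<open>A zero coefficient would make the Wronskian vanish identically, so the argument runs
  over the set \<open>J\<close> of indices with nonzero coefficient, whose size \<open>r\<close> is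
  at most \<open>L1\<close>.\<close>

lemma exp_poly_zero_estimate:
  fixes w :: "nat \<Rightarrow> 'a::{field_char_0, field_gcd}"
  assumes a: "\<And>j. j < L1 \<Longrightarrow> degree (a j) < L0"
    and w: "inj_on w {..<S}" and z: "\<And>s j. s < S \<Longrightarrow> z s j \<noteq> 0"
    and van: "\<And>s t. s < S \<Longrightarrow> t < T \<Longrightarrow>
      (\<Sum>j<L1. poly ((twisted_pderiv (of_nat j) ^^ t) (a j)) (w s) * z s j) = 0"
    and large: "L0 * L1 \<le> S * (T - L1)" and S: "S > 0" and T: "L1 < T"
    and j: "j < L1"
  shows "a j = 0"
proof (rule ccontr)
  assume "a j \<noteq> 0"
  define J where "J = {j. j < L1 \<and> a j \<noteq> 0}"
  define r where "r = card J"
  have finJ: "finite J" unfolding J_def by simp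
  have "j \<in> J" using j \<open>a j \<noteq> 0\<close> by (simp add: J_def)
  then have r: "r > 0" unfolding r_def using finJ card_gt_0_iff by blast
  have rL1: "r \<le> L1" unfolding r_def using card_mono[of "{..<L1}" J] by (auto simp: J_def)
  obtain e where e: "bij_betw e {..<r} J"
    using ex_bij_betw_nat_finite[OF finJ] unfolding r_def atLeast0LessThan by blast
  have eJ: "e i \<in> J" if "i < r" for i using bij_betwE[OF e] that by auto
  have L0: "L0 > 0" using a[OF j] by simp
  \<comment> \<open>Of the \<open>T\<close> derivatives, \<open>r\<close> are spent on the rows of
    the Wronskian and \<open>T - r\<close> remain for the order of vanishing. The \<open>Suc\<close>
    makes the result incompatible with \<open>large\<close>.\<close>
  have "S * Suc (T - r) \<le> (L0 - 1) * r"
  proof (rule exp_poly_zero_estimate_aux[OF r])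
    show "inj_on (\<lambda>i. of_nat (e i) :: 'a) {..<r}"
      using e by (auto simp: bij_betw_def inj_on_def)
    show "a (e i) \<noteq> 0" if "i < r" for i using eJ[OF that] by (simp add: J_def)
    show "degree (a (e i)) \<le> L0 - 1" if "i < r" for i
      using eJ[OF that] a[of "e i"] by (simp add: J_def)
    show "z s (e i) \<noteq> 0" if "s < S" for s i using z that by simp
    fix s t assume st: "s < S" "t < T - r + r"
    have "(\<Sum>i<r. poly ((twisted_pderiv (of_nat (e i)) ^^ t) (a (e i))) (w s) * z s (e i))
      = (\<Sum>j\<in>J. poly ((twisted_pderiv (of_nat j) ^^ t) (a j)) (w s) * z s j)"
      by (rule sum.reindex_bij_betw[OF e])
    also have "\<dots> = (\<Sum>j<L1. poly ((twisted_pderiv (of_nat j) ^^ t) (a j)) (w s) * z s j)"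
    proof (rule sum.mono_neutral_left)
      have "(twisted_pderiv c ^^ t) 0 = 0" for c :: 'a
        by (induction t) (simp_all add: twisted_pderiv_def)
      then show "\<forall>j\<in>{..<L1} - J. poly ((twisted_pderiv (of_nat j) ^^ t) (a j)) (w s) * z s j = 0"
        by (auto simp: J_def)
    qed (auto simp: J_def)
    also have "\<dots> = 0" using van[of s t] st rL1 T by simp
    finally show "(\<Sum>i<r. poly ((twisted_pderiv (of_nat (e i)) ^^ t) (a (e i))) (w s) * z s (e i)) = 0" .
  qed (use w in auto)
  also have "\<dots> \<le> L0 * L1" using rL1 by (intro mult_mono) auto
  also have "\<dots> \<le> S * (T - L1)" by (rule large)
  finally have "Suc (T - r) \<le> T - L1" using S by (simp only: mult_le_cancel1)
  then show False using rL1 T by linarith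
qed


subsection \<open>Resultants of integer polynomials\<close>

text \<open>The product of the row sums expands into a sum over all self-maps of the index set,
  among which are the permutations.\<close>

lemma det_abs_le_prod_row_sums:
  fixes A :: "real mat"
  assumes A: "A \<in> carrier_mat n n"
  shows "\<bar>Determinant.det A\<bar> \<le> (\<Prod>i<n. \<Sum>j<n. \<bar>A $$ (i, j)\<bar>)"
proof -
  let ?P = "{p. p permutes {..<n}}"
  let ?f = "\<lambda>p. \<Prod>i<n. \<bar>A $$ (i, p i)\<bar>"
  \<comment> \<open>Permutations are the identity outside \<open>{..<n}\<close>, members of
    \<open>PiE\<close> are undefined there; \<open>restrict\<close> passes from one convention to
    the other.\<close>
  have inj: "inj_on (\<lambda>p. restrict p {..<n}) ?P"
  proof (rule inj_onI)
    fix p p' assume pp: "p \<in> ?P" "p' \<in> ?P" "restrict p {..<n} = restrict p' {..<n}"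
    show "p = p'"
    proof
      fix i show "p i = p' i" for i
        using pp(1,2) fun_cong[OF pp(3), of i] by (cases "i < n") (auto simp: permutes_def)
    qed
  qed
  have sub: "(\<lambda>p. restrict p {..<n}) ` ?P \<subseteq> PiE {..<n} (\<lambda>_. {..<n})"
  proof (clarify, subst restrict_PiE_iff, rule ballI)
    fix p i assume "p permutes {..<n}" "i \<in> {..<n}"
    then show "p i \<in> {..<n}" by (simp only: permutes_in_image)
  qed
  have "\<bar>Determinant.det A\<bar> = \<bar>\<Sum>p\<in>?P. signof p * (\<Prod>i<n. A $$ (i, p i))\<bar>"
    using det_def'[OF A] by (simp add: atLeast0LessThan)
  also have "\<dots> \<le> (\<Sum>p\<in>?P. \<bar>signof p * (\<Prod>i<n. A $$ (i, p i))\<bar>)"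
    by (rule sum_abs)
  also have "\<dots> = (\<Sum>p\<in>?P. ?f (restrict p {..<n}))"
    by (rule sum.cong) (auto simp: abs_mult abs_prod sign_def)
  also have "\<dots> = (\<Sum>p\<in>(\<lambda>p. restrict p {..<n}) ` ?P. ?f p)"
    by (simp add: sum.reindex[OF inj])
  also have "\<dots> \<le> (\<Sum>p\<in>PiE {..<n} (\<lambda>_. {..<n}). ?f p)"
    by (rule sum_mono2[OF _ sub]) (auto intro: prod_nonneg finite_PiE)
  also have "\<dots> = (\<Prod>i<n. \<Sum>j<n. \<bar>A $$ (i, j)\<bar>)"
    by (rule prod_sum_PiE[symmetric]) auto
  finally show ?thesis .
qed

text \<open>The length is preferred to the largest coefficient because it is submultiplicative and
  directly bounds the row sums of a Sylvester matrix.\<close>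

definition poly_length :: "real poly \<Rightarrow> real"
  where "poly_length p = (\<Sum>i\<le>degree p. \<bar>coeff p i\<bar>)"

lemma sum_abs_coeff_le_poly_length:
  assumes "finite I" shows "(\<Sum>i\<in>I. \<bar>coeff p i\<bar>) \<le> poly_length p"
proof -
  have "(\<Sum>i\<in>I. \<bar>coeff p i\<bar>) = (\<Sum>i\<in>I \<inter> {..degree p}. \<bar>coeff p i\<bar>)"
    by (rule sum.mono_neutral_right) (use assms in \<open>auto intro: le_degree\<close>)
  also have "\<dots> \<le> poly_length p"
    unfolding poly_length_def by (rule sum_mono2) auto
  finally show ?thesis .
qed

lemma sum_shifted_coeffs_le:
  assumes "degree p + s \<le> N"
  shows "(\<Sum>j<N. \<bar>coeff (monom 1 s * p) (N - j)\<bar>) \<le> poly_length p"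
proof -
  have inj: "inj_on (\<lambda>j. N - j - s) {j. j < N \<and> s \<le> N - j}"
    by (auto simp: inj_on_def)
  have "(\<Sum>j<N. \<bar>coeff (monom 1 s * p) (N - j)\<bar>)
      = (\<Sum>j\<in>{j. j < N \<and> s \<le> N - j}. \<bar>coeff p (N - j - s)\<bar>)"
    by (rule sum.mono_neutral_cong_right) (auto simp: coeff_monom_mult)
  also have "\<dots> = (\<Sum>i\<in>(\<lambda>j. N - j - s) ` {j. j < N \<and> s \<le> N - j}. \<bar>coeff p i\<bar>)"
    by (subst sum.reindex[OF inj]) (simp only: o_def)
  also have "\<dots> \<le> poly_length p"
    by (rule sum_abs_coeff_le_poly_length) auto
  finally show ?thesis .
qed

text \<open>Column \<open>j\<close> of the Sylvester matrix belongs to the power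
  \<open>N - j\<close>, which runs from \<open>N\<close> down to 1. The absent power 0 is harmless
  since \<open>s > 0\<close> removes the constant term.\<close>

lemma sum_shifted_coeffs_eq_poly:
  fixes p :: "'a::comm_ring_1 poly"
  assumes "degree p + s \<le> N" "s > 0"
  shows "(\<Sum>j<N. coeff (monom 1 s * p) (N - j) * y ^ (N - j)) = y ^ s * poly p y"
proof -
  have deg: "degree (monom 1 s * p) \<le> N"
    using assms(1) degree_mult_le[of "monom 1 s" p] degree_monom_le[of "1::'a" s] by linarith
  have "y ^ s * poly p y = poly (monom 1 s * p) y" by (simp add: poly_monom)
  also have "\<dots> = (\<Sum>i\<le>N. coeff (monom 1 s * p) i * y ^ i)"
    unfolding poly_altdef by (rule sum.mono_neutral_left) (use deg in \<open>auto simp: coeff_eq_0\<close>)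
  also have "\<dots> = (\<Sum>i = 1..N. coeff (monom 1 s * p) i * y ^ i)"
    by (rule sum.mono_neutral_right) (use assms(2) in \<open>auto simp: coeff_monom_mult\<close>)
  also have "\<dots> = (\<Sum>j<N. coeff (monom 1 s * p) (N - j) * y ^ (N - j))"
    by (rule sum.reindex_bij_witness[of _ "\<lambda>j. N - j" "\<lambda>i. N - i"]) auto
  finally show ?thesis ..
qed

text \<open>The Sylvester matrix maps the vector of the powers \<open>y ^ (N - j)\<close> to a
  vector \<open>u\<close> of multiples of \<open>poly F y\<close> and \<open>poly G y\<close>.
  Solving for one entry by Cramer's rule writes the resultant as a combination of these two values
  with cofactors as coefficients.\<close>

lemma resultant_abs_le:
  fixes F G :: "real poly"
  defines "m \<equiv> degree F" and "n \<equiv> degree G"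
  assumes y: "y \<ge> 1" and pos: "m + n > 0"
    and A: "poly_length F \<le> A" "A \<ge> 1" and B: "poly_length G \<le> B" "B \<ge> 1"
  shows "\<bar>resultant F G\<bar> \<le> real (m + n) * y ^ (m + n) * A ^ n * B ^ m * (\<bar>poly F y\<bar> + \<bar>poly G y\<bar>)"
proof -
  define N where "N = m + n"
  let ?M = "sylvester_mat F G"
  have M: "?M \<in> carrier_mat N N" unfolding N_def m_def n_def by (rule sylvester_carrier_mat)
  have N: "N > 0" using pos by (simp add: N_def)
  obtain N' where N': "N = Suc N'" using N by (cases N) auto
  have M': "?M \<in> carrier_mat (Suc N') (Suc N')" using M N' by simp
  have ent: "?M $$ (i, j) = (if i < n then coeff (monom 1 (n - i) * F) (N - j)
      else coeff (monom 1 (N - i) * G) (N - j))" if "i < N" "j < N" for i j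
    using sylvester_index_mat2[of i F G j] that unfolding N_def m_def n_def by simp
  define R where "R i = (if i < n then A else B)" for i
  define u where "u i = (if i < n then y ^ (n - i) * poly F y else y ^ (N - i) * poly G y)" for i
  have row: "(\<Sum>j<N. \<bar>?M $$ (i, j)\<bar>) \<le> R i" if "i < N" for i
  proof (cases "i < n")
    case True
    then have "(\<Sum>j<N. \<bar>?M $$ (i, j)\<bar>) = (\<Sum>j<N. \<bar>coeff (monom 1 (n - i) * F) (N - j)\<bar>)"
      using that by (intro sum.cong) (auto simp: ent)
    also have "\<dots> \<le> poly_length F"
      by (rule sum_shifted_coeffs_le) (use True in \<open>simp add: N_def m_def\<close>)
    finally show ?thesis using True A by (simp add: R_def)
  next
    case False
    then have "(\<Sum>j<N. \<bar>?M $$ (i, j)\<bar>) = (\<Sum>j<N. \<bar>coeff (monom 1 (N - i) * G) (N - j)\<bar>)"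
      using that by (intro sum.cong) (auto simp: ent)
    also have "\<dots> \<le> poly_length G"
      by (rule sum_shifted_coeffs_le) (use False that in \<open>simp add: N_def n_def\<close>)
    finally show ?thesis using False B by (simp add: R_def)
  qed
  have col: "(\<Sum>j<N. ?M $$ (i, j) * y ^ (N - j)) = u i" if "i < N" for i
  proof (cases "i < n")
    case True
    then have "(\<Sum>j<N. ?M $$ (i, j) * y ^ (N - j)) = (\<Sum>j<N. coeff (monom 1 (n - i) * F) (N - j) * y ^ (N - j))"
      using that by (intro sum.cong) (auto simp: ent)
    also have "\<dots> = y ^ (n - i) * poly F y"
      by (rule sum_shifted_coeffs_eq_poly) (use True in \<open>auto simp: N_def m_def\<close>)
    finally show ?thesis using True by (simp add: u_def)
  next
    case False
    then have "(\<Sum>j<N. ?M $$ (i, j) * y ^ (N - j)) = (\<Sum>j<N. coeff (monom 1 (N - i) * G) (N - j) * y ^ (N - j))"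
      using that by (intro sum.cong) (auto simp: ent)
    also have "\<dots> = y ^ (N - i) * poly G y"
      by (rule sum_shifted_coeffs_eq_poly) (use False that in \<open>auto simp: N_def n_def\<close>)
    finally show ?thesis using False by (simp add: u_def)
  qed
  have R1: "R i \<ge> 1" for i using A B by (simp add: R_def)
  have prodR: "(\<Prod>i<N. R i) = A ^ n * B ^ m"
  proof -
    have "(\<Prod>i<N. R i) = (\<Prod>i<n. R i) * (\<Prod>i\<in>{n..<N}. R i)"
      by (subst prod.union_disjoint[symmetric]) (auto simp: N_def intro!: prod.cong)
    then show ?thesis by (simp add: R_def N_def)
  qed
  \<comment> \<open>Deleting a column only shortens the row sums. Deleting row \<open>i\<close>
    drops a bound that is at least 1, so the product over all rows still dominates.\<close>
  have cof: "\<bar>cofactor ?M i N'\<bar> \<le> A ^ n * B ^ m" if i: "i < N" for i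
  proof -
    let ?D = "mat_delete ?M i N'"
    have D: "?D \<in> carrier_mat N' N'" using mat_delete_carrier[OF M', of i N'] by simp
    have "\<bar>cofactor ?M i N'\<bar> = \<bar>Determinant.det ?D\<bar>"
      by (simp add: cofactor_def abs_mult power_abs)
    also have "\<dots> \<le> (\<Prod>a<N'. \<Sum>b<N'. \<bar>?D $$ (a, b)\<bar>)" by (rule det_abs_le_prod_row_sums[OF D])
    also have "\<dots> \<le> (\<Prod>a<N'. R (insert_index i a))"
    proof (rule prod_mono, intro conjI sum_nonneg)
      fix a assume a: "a \<in> {..<N'}"
      have ia: "insert_index i a < N" using a N' by (auto simp: insert_index_def)
      have "(\<Sum>b<N'. \<bar>?D $$ (a, b)\<bar>) = (\<Sum>b<N'. \<bar>?M $$ (insert_index i a, insert_index N' b)\<bar>)"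
        using a i N' by (intro sum.cong refl arg_cong[where f = abs] mat_delete_index[OF M', symmetric]) auto
      also have "\<dots> = (\<Sum>b<N'. \<bar>?M $$ (insert_index i a, b)\<bar>)"
        by (intro sum.cong) auto
      also have "\<dots> \<le> (\<Sum>b<N. \<bar>?M $$ (insert_index i a, b)\<bar>)"
        by (rule sum_mono2) (auto simp: N')
      also have "\<dots> \<le> R (insert_index i a)" by (rule row[OF ia])
      finally show "(\<Sum>b<N'. \<bar>?D $$ (a, b)\<bar>) \<le> R (insert_index i a)" .
    qed auto
    also have "\<dots> = (\<Prod>k\<in>insert_index i ` {..<N'}. R k)"
      by (subst prod.reindex) (auto simp: inj_on_def insert_index_def split: if_splits)
    also have "\<dots> \<le> (\<Prod>k<N. R k)"
      by (rule prod_mono2) (use R1 N' in \<open>auto simp: insert_index_def intro: order_trans[OF zero_le_one]\<close>)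
    finally show ?thesis by (simp add: prodR)
  qed
  \<comment> \<open>The last column \<open>N' = N - 1\<close> belongs to the power
    \<open>y ^ 1\<close>; this is the extra factor \<open>y\<close>, removed at the end by
    \<open>y \<ge> 1\<close>.\<close>
  have "resultant F G * y = (\<Sum>i<N. cofactor ?M i N' * u i)"
  proof -
    have e: "(\<Sum>i<N. cofactor ?M i N' * ?M $$ (i, j)) = (if j = N' then resultant F G else 0)"
      if j: "j < N" for j
    proof -
      have "(adj_mat ?M * ?M) $$ (N', j) = (resultant F G \<cdot>\<^sub>m 1\<^sub>m N) $$ (N', j)"
        using adj_mat(3)[OF M] by (simp add: resultant_def)
      moreover have "(adj_mat ?M * ?M) $$ (N', j) = (\<Sum>i<N. cofactor ?M i N' * ?M $$ (i, j))"
        using M adj_mat(1)[OF M] N' j by (auto simp: scalar_prod_def atLeast0LessThan adj_mat_def intro!: sum.cong)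
      ultimately show ?thesis using N' j by auto
    qed
    have "(\<Sum>i<N. cofactor ?M i N' * u i) = (\<Sum>i<N. \<Sum>j<N. cofactor ?M i N' * ?M $$ (i, j) * y ^ (N - j))"
    proof (rule sum.cong)
      fix i assume "i \<in> {..<N}"
      then have "u i = (\<Sum>j<N. ?M $$ (i, j) * y ^ (N - j))" using col by simp
      then show "cofactor ?M i N' * u i = (\<Sum>j<N. cofactor ?M i N' * ?M $$ (i, j) * y ^ (N - j))"
        by (simp only: sum_distrib_left mult.assoc)
    qed simp
    also have "\<dots> = (\<Sum>j<N. (\<Sum>i<N. cofactor ?M i N' * ?M $$ (i, j)) * y ^ (N - j))"
      by (subst sum.swap) (simp add: sum_distrib_right)
    also have "\<dots> = (\<Sum>j<N. if j = N' then resultant F G * y ^ (N - j) else 0)"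
      by (rule sum.cong) (auto simp: e)
    also have "\<dots> = resultant F G * y" unfolding N' by simp
    finally show ?thesis by simp
  qed
  then have "\<bar>resultant F G * y\<bar> = \<bar>\<Sum>i<N. cofactor ?M i N' * u i\<bar>" by (rule arg_cong)
  moreover have "\<bar>resultant F G * y\<bar> = \<bar>resultant F G\<bar> * y" using y by (simp add: abs_mult)
  ultimately have "\<bar>resultant F G\<bar> * y = \<bar>\<Sum>i<N. cofactor ?M i N' * u i\<bar>" by (simp only:)
  also have "\<dots> \<le> (\<Sum>i<N. \<bar>cofactor ?M i N' * u i\<bar>)" by (rule sum_abs)
  also have "\<dots> \<le> (\<Sum>i<N. (A ^ n * B ^ m) * (y ^ N * (\<bar>poly F y\<bar> + \<bar>poly G y\<bar>)))"
  proof (rule sum_mono)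
    fix i assume i: "i \<in> {..<N}"
    have *: "\<bar>y ^ e * v\<bar> \<le> y ^ N * (\<bar>poly F y\<bar> + \<bar>poly G y\<bar>)"
      if "e \<le> N" "\<bar>v\<bar> \<le> \<bar>poly F y\<bar> + \<bar>poly G y\<bar>" for e v
    proof -
      have "\<bar>y ^ e * v\<bar> = y ^ e * \<bar>v\<bar>" using y by (simp add: abs_mult)
      also have "\<dots> \<le> y ^ N * (\<bar>poly F y\<bar> + \<bar>poly G y\<bar>)"
        by (rule mult_mono) (use that y in \<open>auto intro: power_increasing\<close>)
      finally show ?thesis .
    qed
    have "\<bar>u i\<bar> \<le> y ^ N * (\<bar>poly F y\<bar> + \<bar>poly G y\<bar>)"
    proof -
      have "n - i \<le> N" by (simp add: N_def)
      then show ?thesis by (simp add: u_def *)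
    qed
    then have "\<bar>cofactor ?M i N'\<bar> * \<bar>u i\<bar> \<le> (A ^ n * B ^ m) * (y ^ N * (\<bar>poly F y\<bar> + \<bar>poly G y\<bar>))"
      using cof[of i] i A B by (intro mult_mono) auto
    then show "\<bar>cofactor ?M i N' * u i\<bar> \<le> (A ^ n * B ^ m) * (y ^ N * (\<bar>poly F y\<bar> + \<bar>poly G y\<bar>))"
      by (simp only: abs_mult)
  qed
  also have "\<dots> = real (m + n) * y ^ (m + n) * A ^ n * B ^ m * (\<bar>poly F y\<bar> + \<bar>poly G y\<bar>)"
    by (simp add: N_def mult_ac)
  finally have "\<bar>resultant F G\<bar> * y \<le> \<dots>" .
  moreover have "\<bar>resultant F G\<bar> * 1 \<le> \<bar>resultant F G\<bar> * y" using y by (intro mult_left_mono) auto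
  ultimately show ?thesis by simp
qed

text \<open>The resultant is a nonzero integer, hence at least 1 in absolute value.\<close>

lemma coprime_int_polys_not_both_small:
  fixes f g :: "int poly"
  defines "m \<equiv> degree f" and "n \<equiv> degree g"
  assumes y: "y \<ge> 1" and pos: "m > 0" and gcd: "degree (gcd f g) = 0"
    and A: "poly_length (of_int_poly f) \<le> A" "A \<ge> 1"
    and B: "poly_length (of_int_poly g) \<le> B" "B \<ge> 1"
  shows "1 \<le> real (m + n) * y ^ (m + n) * A ^ n * B ^ m *
    (\<bar>poly (of_int_poly f) y\<bar> + \<bar>poly (of_int_poly g) y\<bar>)"
proof -
  have "resultant f g \<noteq> 0" using gcd by (simp add: resultant_0_gcd)
  moreover have "resultant (of_int_poly f) (of_int_poly g) = (of_int (resultant f g) :: real)"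
    by (rule of_int_hom.resultant_map_poly) auto
  ultimately have "1 \<le> \<bar>resultant (of_int_poly f) (of_int_poly g) :: real\<bar>"
    by simp
  also have "\<dots> \<le> real (m + n) * y ^ (m + n) * A ^ n * B ^ m *
    (\<bar>poly (of_int_poly f) y\<bar> + \<bar>poly (of_int_poly g) y\<bar>)"
  proof -
    have deg: "degree (of_int_poly f :: real poly) = m" "degree (of_int_poly g :: real poly) = n"
      by (simp_all add: m_def n_def)
    show ?thesis
      using resultant_abs_le[OF y _ A B, unfolded deg] pos by (elim meta_mp) linarith
  qed
  finally show ?thesis .
qed

text \<open>Irreducible up to constant factors, so that contents need not be removed.\<close>

definition unsplittable :: "int poly \<Rightarrow> bool"
  where "unsplittable R \<longleftrightarrow> (\<forall>g h. R = g * h \<longrightarrow> degree g = 0 \<or> degree h = 0)"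

lemma degree_gcd_unsplittable:
  assumes R: "unsplittable R" "degree R > 0" and g: "degree (gcd R f) \<noteq> 0"
  obtains c where "R = gcd R f * [:c:]" "c \<noteq> 0"
proof -
  obtain h where h: "R = gcd R f * h" using gcd_dvd1[of R f] by (rule dvdE)
  have "degree h = 0" using R(1)[unfolded unsplittable_def, rule_format, OF h] g by (elim disjE) (rule notE, assumption+)
  then obtain c where c: "h = [:c:]" by (rule degree_eq_zeroE)
  have "c \<noteq> 0"
  proof
    assume "c = 0"
    then have "gcd R f * h = 0" using c by simp
    with h have "R = 0" by (rule trans)
    then show False using R(2) by simp
  qed
  with h[unfolded c] show ?thesis by (rule that)
qed

text \<open>\<open>R\<close> serves as a minimal polynomial of \<theta> without passing to rational
  coefficients. A common complex root kills the resultant, which is an integer, so the integer gcd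
  is not constant and, \<open>R\<close> being unsplittable, has the degree of
  \<open>R\<close>.\<close>

lemma degree_le_if_common_root:
  fixes \<theta> :: complex
  assumes R: "unsplittable R" "degree R > 0" "poly (of_int_poly R) \<theta> = 0"
    and f: "f \<noteq> 0" "poly (of_int_poly f) \<theta> = 0"
  shows "degree R \<le> degree f"
proof -
  have "[:- \<theta>, 1:] dvd gcd (of_int_poly R) (of_int_poly f)"
    using R(3) f(2) by (simp add: poly_eq_0_iff_dvd)
  moreover have "gcd (of_int_poly R) (of_int_poly f) \<noteq> (0 :: complex poly)" using f by simp
  ultimately have "degree [:- \<theta>, 1:] \<le> degree (gcd (of_int_poly R) (of_int_poly f) :: complex poly)"
    by (rule dvd_imp_degree_le)
  then have "degree (gcd (of_int_poly R) (of_int_poly f) :: complex poly) \<noteq> 0" by simp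
  then have "resultant (of_int_poly R) (of_int_poly f :: complex poly) = 0"
    by (simp add: resultant_0_gcd)
  moreover have "resultant (of_int_poly R) (of_int_poly f) = (of_int (resultant R f) :: complex)"
    by (rule of_int_hom.resultant_map_poly) auto
  ultimately have "resultant R f = 0" by simp
  then have "degree (gcd R f) \<noteq> 0" using resultant_0_gcd[of R f] by simp
  then obtain c where c: "R = gcd R f * [:c:]" "c \<noteq> 0"
    by (rule degree_gcd_unsplittable[OF R(1,2)])
  have "degree R = degree (gcd R f * [:c:])" using c(1) by (rule arg_cong)
  also have "\<dots> = degree (gcd R f)" using c(2) f(1) by (simp add: degree_mult_eq)
  also have "\<dots> \<le> degree f" using f(1) by (intro dvd_imp_degree_le) auto
  finally show ?thesis .
qed

text \<open>A nonconstant gcd would agree with \<open>R\<close> up to a constant and hand its root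
  \<theta> on to \<open>f\<close>.\<close>

lemma degree_gcd_eq_0_if_nonroot:
  fixes \<theta> :: complex
  assumes R: "unsplittable R" "degree R > 0" "poly (of_int_poly R) \<theta> = 0"
    and f: "poly (of_int_poly f) \<theta> \<noteq> 0"
  shows "degree (gcd R f) = 0"
proof (rule ccontr)
  assume "degree (gcd R f) \<noteq> 0"
  then obtain c where c: "R = gcd R f * [:c:]" "c \<noteq> 0"
    by (rule degree_gcd_unsplittable[OF R(1,2)])
  have "of_int_poly R = (of_int_poly (gcd R f * [:c:]) :: complex poly)" using c(1) by (rule arg_cong)
  also have "\<dots> = of_int_poly (gcd R f) * [:of_int c:]" by (simp add: of_int_poly_hom.hom_mult of_int_hom.map_poly_pCons_hom del: mult_pCons_right)
  finally have "of_int_poly R = (of_int_poly (gcd R f) * [:of_int c:] :: complex poly)" .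
  then have "poly (of_int_poly (gcd R f)) \<theta> = 0" using R(3) c(2) by simp
  moreover obtain k where "f = gcd R f * k" using gcd_dvd2[of R f] by (rule dvdE)
  then have "of_int_poly f = (of_int_poly (gcd R f * k) :: complex poly)" by (rule arg_cong)
  ultimately show False using f by (simp add: of_int_poly_hom.hom_mult)
qed


subsection \<open>The auxiliary function\<close>

text \<open>Dirichlet's box principle: two vectors with entries in \<open>{0..B}\<close> share all
  cells of the forms, and their difference is \<open>c\<close>. Since \<open>lam\<close> is
  nonnegative, the values fill only the interval from 0 to \<open>B * \<Lambda>\<close>.\<close>

lemma pigeonhole_small_linear_forms:
  fixes lam :: "nat \<Rightarrow> 'u \<Rightarrow> real" and B K N :: nat and \<Lambda> :: real
  assumes U: "finite U" and lam: "\<And>n u. n < N \<Longrightarrow> u \<in> U \<Longrightarrow> 0 \<le> lam n u"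
    and sum: "\<And>n. n < N \<Longrightarrow> (\<Sum>u\<in>U. lam n u) \<le> \<Lambda>" and L: "\<Lambda> > 0" and K: "K > 0"
    and card: "(K + 1) ^ N < (B + 1) ^ card U"
  obtains c :: "'u \<Rightarrow> int" where "\<exists>u\<in>U. c u \<noteq> 0" "\<And>u. u \<in> U \<Longrightarrow> \<bar>c u\<bar> \<le> int B"
    "\<And>n. n < N \<Longrightarrow> \<bar>\<Sum>u\<in>U. of_int (c u) * lam n u\<bar> \<le> B * \<Lambda> / K"
proof -
  have B: "B > 0"
  proof (rule ccontr)
    assume "\<not> B > 0"
    then have "(K + 1) ^ N < 1" using card by simp
    moreover have "(K + 1) ^ N \<ge> 1" by (rule one_le_power) simp
    ultimately show False by simp
  qed
  define X where "X = PiE U (\<lambda>_. {0..B})"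
  define f where "f x n = (\<Sum>u\<in>U. real (x u) * lam n u)" for x n
  \<comment> \<open>The interval is cut into \<open>K\<close> cells, but its right endpoint gets the
    label \<open>K\<close> of its own; this accounts for the \<open>K + 1\<close> labels in
    \<open>card\<close>.\<close>
  define h where "h x = restrict (\<lambda>n. nat \<lfloor>f x n * K / (B * \<Lambda>)\<rfloor>) {..<N}" for x
  have f0: "0 \<le> f x n" if "n < N" for x n
    unfolding f_def using lam that by (intro sum_nonneg mult_nonneg_nonneg) auto
  have f1: "f x n \<le> B * \<Lambda>" if "n < N" "x \<in> X" for x n
  proof -
    have "f x n \<le> (\<Sum>u\<in>U. real B * lam n u)"
      unfolding f_def using that lam by (intro sum_mono mult_right_mono) (auto simp: X_def PiE_iff)
    also have "\<dots> = B * (\<Sum>u\<in>U. lam n u)" by (simp add: sum_distrib_left)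
    also have "\<dots> \<le> B * \<Lambda>" using sum[OF that(1)] by (intro mult_left_mono) auto
    finally show ?thesis .
  qed
  have BL: "B * \<Lambda> > 0" using B L by simp
  have "h ` X \<subseteq> PiE {..<N} (\<lambda>_. {0..K})"
  proof clarify
    fix x assume x: "x \<in> X"
    have "nat \<lfloor>f x n * K / (B * \<Lambda>)\<rfloor> \<le> K" if "n < N" for n
    proof -
      have "f x n * K / (B * \<Lambda>) \<le> (B * \<Lambda>) * K / (B * \<Lambda>)"
        using f1[OF that x] BL by (intro divide_right_mono mult_right_mono) auto
      also have "\<dots> = K" using B L by simp
      finally have "\<lfloor>f x n * K / (B * \<Lambda>)\<rfloor> \<le> \<lfloor>real K\<rfloor>" by (rule floor_mono)
      then show ?thesis by simp
    qed
    then show "h x \<in> PiE {..<N} (\<lambda>_. {0..K})" by (auto simp: h_def)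
  qed
  then have "card (h ` X) \<le> card (PiE {..<N} (\<lambda>_. {0..K}))"
    by (rule card_mono[rotated]) (auto intro: finite_PiE)
  also have "\<dots> = (K + 1) ^ N" by (simp add: card_PiE)
  also have "\<dots> < (B + 1) ^ card U" by (rule card)
  also have "\<dots> = card X" using U by (simp add: X_def card_PiE)
  finally have "\<not> inj_on h X" by (rule pigeonhole)
  then obtain x x' where xx: "x \<in> X" "x' \<in> X" "x \<noteq> x'" "h x = h x'"
    unfolding inj_on_def by blast
  define c where "c u = int (x u) - int (x' u)" for u
  show ?thesis
  proof (rule that)
    show "\<exists>u\<in>U. c u \<noteq> 0"
    proof (rule ccontr)
      assume "\<not> (\<exists>u\<in>U. c u \<noteq> 0)"
      then have "x u = x' u" if "u \<in> U" for u using that by (auto simp: c_def)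
      then have "x = x'" using xx(1,2) unfolding X_def by (intro PiE_ext[of x U]) auto
      then show False using xx(3) by simp
    qed
    show "\<bar>c u\<bar> \<le> int B" if "u \<in> U" for u
      using xx(1,2) that by (auto simp: c_def X_def PiE_iff dest!: bspec[where x = u])
    show "\<bar>\<Sum>u\<in>U. of_int (c u) * lam n u\<bar> \<le> B * \<Lambda> / K" if n: "n < N" for n
    proof -
      let ?a = "f x n * K / (B * \<Lambda>)" and ?b = "f x' n * K / (B * \<Lambda>)"
      have "nat \<lfloor>?a\<rfloor> = nat \<lfloor>?b\<rfloor>"
        using fun_cong[OF xx(4), of n] n by (simp add: h_def)
      moreover have "?a \<ge> 0" "?b \<ge> 0" using f0[OF n] BL by simp_all
      ultimately have "\<lfloor>?a\<rfloor> = \<lfloor>?b\<rfloor>" by (simp add: eq_nat_nat_iff)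
      then have "\<bar>?a - ?b\<bar> \<le> 1" by linarith
      moreover have "?a - ?b = (f x n - f x' n) * (K / (B * \<Lambda>))" by (simp add: diff_divide_distrib left_diff_distrib)
      moreover have "K / (B * \<Lambda>) \<ge> 0" using BL by (intro divide_nonneg_pos) auto
      ultimately have "\<bar>f x n - f x' n\<bar> * (K / (B * \<Lambda>)) \<le> 1"
        by (simp only: abs_mult abs_of_nonneg)
      moreover have "v \<le> D / K" if "v * (K / D) \<le> 1" "D > 0" for v D :: real
        using that K by (simp add: field_simps)
      ultimately have "\<bar>f x n - f x' n\<bar> \<le> B * \<Lambda> / K" using BL by blast
      moreover have "(\<Sum>u\<in>U. of_int (c u) * lam n u) = f x n - f x' n"
        by (simp add: f_def c_def left_diff_distrib sum_subtractf)
      ultimately show ?thesis by simp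
    qed
  qed
qed

text \<open>Each term of the tail is at least \<open>2 ^ M\<close> times smaller than the
  corresponding term of the exponential series at \<open>2 * cmod z\<close>.\<close>

lemma exp_taylor_remainder:
  fixes z :: complex
  shows "cmod (exp z - (\<Sum>m<M. z ^ m / fact m)) \<le> exp (2 * cmod z) / 2 ^ M"
proof -
  have s: "(\<lambda>n. z ^ n / fact n) sums exp z"
    using exp_converges[of z] by (simp add: scaleR_conv_of_real field_simps)
  have s2: "(\<lambda>n. (2 * cmod z) ^ n / fact n) sums exp (2 * cmod z)"
    using exp_converges[of "2 * cmod z"] by (simp add: field_simps)
  let ?g = "\<lambda>n. ((2 * cmod z) ^ (n + M) / fact (n + M)) / 2 ^ M"
  have sg: "summable ?g" "suminf ?g \<le> exp (2 * cmod z) / 2 ^ M"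
  proof -
    have sum: "summable (\<lambda>n. (2 * cmod z) ^ (n + M) / fact (n + M))"
      using s2 by (subst summable_iff_shift) (rule sums_summable)
    then show "summable ?g" by (rule summable_divide)
    have "suminf (\<lambda>n. (2 * cmod z) ^ (n + M) / fact (n + M)) = exp (2 * cmod z) - (\<Sum>n<M. (2 * cmod z) ^ n / fact n)"
      using suminf_minus_initial_segment[OF sums_summable[OF s2], of M] sums_unique[OF s2] by simp
    also have "\<dots> \<le> exp (2 * cmod z)" by (simp add: sum_nonneg)
    finally have "suminf (\<lambda>n. (2 * cmod z) ^ (n + M) / fact (n + M)) / 2 ^ M \<le> exp (2 * cmod z) / 2 ^ M"
      by (rule divide_right_mono) simp
    then show "suminf ?g \<le> exp (2 * cmod z) / 2 ^ M"
      by (simp only: suminf_divide[OF sum])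
  qed
  have le: "cmod (z ^ (n + M) / fact (n + M)) \<le> ?g n" for n
  proof -
    have "(2 * cmod z) ^ (n + M) / 2 ^ M = 2 ^ n * cmod z ^ (n + M)"
      by (simp add: power_mult_distrib power_add field_simps)
    moreover have "1 * cmod z ^ (n + M) \<le> 2 ^ n * cmod z ^ (n + M)"
      by (intro mult_right_mono) auto
    ultimately have "cmod z ^ (n + M) \<le> (2 * cmod z) ^ (n + M) / 2 ^ M" by simp
    then have "cmod z ^ (n + M) / fact (n + M) \<le> ((2 * cmod z) ^ (n + M) / 2 ^ M) / fact (n + M)"
      by (rule divide_right_mono) simp
    then show ?thesis by (simp add: norm_divide norm_power mult.commute)
  qed
  have "exp z - (\<Sum>m<M. z ^ m / fact m) = suminf (\<lambda>n. z ^ (n + M) / fact (n + M))"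
    using suminf_minus_initial_segment[OF sums_summable[OF s], of M] sums_unique[OF s] by simp
  also have "cmod \<dots> \<le> suminf ?g"
    by (rule norm_suminf_le[OF le sg(1)])
  finally show ?thesis using sg(2) by simp
qed

section \<open>The auxiliary function and the integer polynomials given by its derivatives\<close>

text \<open>The polynomial in \<open>w\<close> that multiplies \<open>exp (j * w)\<close>. The
  argument \<open>y\<close> is kept free: it is \<open>Y\<close> in the analytic estimates and a
  root of \<open>R\<close> in the zero estimate.\<close>

definition aux_coeff :: "(nat \<Rightarrow> nat \<Rightarrow> nat \<Rightarrow> int) \<Rightarrow> nat \<Rightarrow> nat \<Rightarrow> complex \<Rightarrow> nat \<Rightarrow> complex poly"
  where "aux_coeff c L0 d y j = (\<Sum>i<L0. monom (\<Sum>k<d. of_int (c i j k) * y ^ k) i)"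

lemma degree_aux_coeff_less:
  assumes "L0 > 0" shows "degree (aux_coeff c L0 d y j) < L0"
proof -
  have "degree (aux_coeff c L0 d y j) \<le> L0 - 1"
    unfolding aux_coeff_def by (rule degree_sum_le) (auto intro: order_trans[OF degree_monom_le])
  then show ?thesis using assms by simp
qed

lemma coeff_aux_coeff:
  "i < L0 \<Longrightarrow> coeff (aux_coeff c L0 d y j) i = (\<Sum>k<d. of_int (c i j k) * y ^ k)"
  by (simp add: aux_coeff_def coeff_sum)

lemma poly_aux_coeff:
  "poly (aux_coeff c L0 d y j) w = (\<Sum>i<L0. \<Sum>k<d. of_int (c i j k) * y ^ k * w ^ i)"
  by (simp add: aux_coeff_def poly_sum poly_monom sum_distrib_right)

lemma exp_poly_has_field_derivative:
  fixes a :: "nat \<Rightarrow> 'a::{real_normed_field,banach} poly"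
  shows "((\<lambda>w. \<Sum>j<L1. poly (a j) w * exp (of_nat j * w)) has_field_derivative
    (\<Sum>j<L1. poly (twisted_pderiv (of_nat j) (a j)) w * exp (of_nat j * w))) (at w)"
  by (intro DERIV_sum)
    (auto simp: twisted_pderiv_def algebra_simps intro!: derivative_eq_intros poly_DERIV)

lemma higher_deriv_exp_poly:
  fixes a :: "nat \<Rightarrow> complex poly"
  shows "(deriv ^^ t) (\<lambda>w. \<Sum>j<L1. poly (a j) w * exp (of_nat j * w))
    = (\<lambda>w. \<Sum>j<L1. poly ((twisted_pderiv (of_nat j) ^^ t) (a j)) w * exp (of_nat j * w))"
proof (induction t)
  case (Suc t)
  show ?case
    unfolding funpow.simps(2) o_apply Suc
    by (intro ext DERIV_imp_deriv exp_poly_has_field_derivative)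
qed simp

lemma twisted_pderiv_funpow_sum:
  assumes "finite I"
  shows "(twisted_pderiv c ^^ t) (\<Sum>i\<in>I. smult (b i) (f i)) = (\<Sum>i\<in>I. smult (b i) ((twisted_pderiv c ^^ t) (f i)))"
proof (induction t)
  case (Suc t)
  show ?case
    unfolding twisted_pderiv_funpow_Suc Suc
    by (simp add: pderiv_sum pderiv_smult smult_sum2 sum.distrib smult_add_right mult.commute)
qed simp

lemma of_int_poly_twisted_pderiv_funpow:
  "of_int_poly ((twisted_pderiv (int j) ^^ t) p) = (twisted_pderiv (of_nat j) ^^ t) (of_int_poly p :: complex poly)"
proof (induction t)
  case (Suc t)
  show ?case
    unfolding twisted_pderiv_funpow_Suc Suc[symmetric]
    by (simp add: of_int_poly_hom.hom_add of_int_hom.map_poly_pderiv of_int_hom.map_poly_hom_smult)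
qed simp

text \<open>The value at \<open>s / q\<close> of the \<open>t\<close>-th derivative of \<open>w ^ i * exp (j * w)\<close>, divided by
  \<open>exp (j * s / q)\<close> and multiplied by \<open>q ^ L0\<close>.\<close>

definition monomial_value :: "nat \<Rightarrow> nat \<Rightarrow> nat \<Rightarrow> nat \<Rightarrow> nat \<Rightarrow> nat \<Rightarrow> int"
  where "monomial_value L0 q s t i j =
    (\<Sum>m\<le>i. coeff ((twisted_pderiv (int j) ^^ t) (monom 1 i)) m * int s ^ m * int q ^ (L0 - m))"

lemma of_int_monomial_value:
  assumes "i < L0" "q > 0"
  shows "of_int (monomial_value L0 q s t i j) =
    of_nat q ^ L0 * poly ((twisted_pderiv (of_nat j) ^^ t) (monom 1 i)) (of_nat s / of_nat q :: complex)"
proof -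
  let ?P = "(twisted_pderiv (int j) ^^ t) (monom 1 i)"
  have P: "degree ?P \<le> i"
    by (rule order_trans[OF degree_twisted_pderiv_funpow_le degree_monom_le])
  have "(twisted_pderiv (of_nat j) ^^ t) (monom 1 i) = (of_int_poly ?P :: complex poly)"
    unfolding of_int_poly_twisted_pderiv_funpow by (simp add: of_int_hom.map_poly_hom_monom)
  moreover have "poly (of_int_poly ?P) w = (\<Sum>m\<le>i. of_int (coeff ?P m) * w ^ m)" for w :: complex
    unfolding poly_altdef by (rule sum.mono_neutral_cong_left) (use P in \<open>auto simp: coeff_eq_0\<close>)
  moreover have "of_nat q ^ L0 * (of_nat s / of_nat q :: complex) ^ m = of_nat s ^ m * of_nat q ^ (L0 - m)"
    if "m \<le> i" for m
    using assms that by (simp add: power_divide power_diff)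
  ultimately show ?thesis
    unfolding monomial_value_def
    by (auto simp: sum_distrib_left mult.assoc mult.left_commute[of "of_nat q ^ L0"] intro!: sum.cong)
qed

lemma twisted_pderiv_coeff_sum_le:
  fixes p :: "int poly"
  assumes "degree p \<le> i"
  shows "(\<Sum>m\<le>i. \<bar>coeff (twisted_pderiv (int j) p) m\<bar>) \<le> int (i + j) * (\<Sum>m\<le>i. \<bar>coeff p m\<bar>)"
proof -
  have "(\<Sum>m\<le>i. \<bar>coeff (twisted_pderiv (int j) p) m\<bar>)
      \<le> (\<Sum>m\<le>i. int (Suc m) * \<bar>coeff p (Suc m)\<bar> + int j * \<bar>coeff p m\<bar>)"
    unfolding twisted_pderiv_def
    by (intro sum_mono) (auto simp: coeff_pderiv abs_mult intro!: order_trans[OF abs_triangle_ineq])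
  also have "\<dots> = (\<Sum>m\<le>i. int (Suc m) * \<bar>coeff p (Suc m)\<bar>) + int j * (\<Sum>m\<le>i. \<bar>coeff p m\<bar>)"
    by (simp add: sum.distrib sum_distrib_left)
  also have "(\<Sum>m\<le>i. int (Suc m) * \<bar>coeff p (Suc m)\<bar>) = (\<Sum>m<i. int (Suc m) * \<bar>coeff p (Suc m)\<bar>)"
    by (rule sum.mono_neutral_right) (use assms in \<open>auto simp: not_less coeff_eq_0\<close>)
  also have "\<dots> \<le> (\<Sum>m<i. int i * \<bar>coeff p (Suc m)\<bar>)"
    by (intro sum_mono mult_right_mono) auto
  also have "\<dots> = int i * (\<Sum>m\<in>Suc ` {..<i}. \<bar>coeff p m\<bar>)"
    by (simp add: sum_distrib_left sum.reindex)
  also have "\<dots> \<le> int i * (\<Sum>m\<le>i. \<bar>coeff p m\<bar>)"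
    by (intro mult_left_mono sum_mono2) auto
  finally show ?thesis by (simp add: distrib_right)
qed

text \<open>Each of the \<open>t\<close> twisted derivatives multiplies the length by at most
  \<open>i + j\<close>, and every product \<open>s ^ m * q ^ (L0 - m)\<close> is at most
  \<open>(q + S) ^ L0\<close>.\<close>

lemma monomial_value_abs_le:
  assumes "i < L0" "j < L1" "s \<le> S" "t \<le> T"
  shows "\<bar>monomial_value L0 q s t i j\<bar> \<le> int ((L0 + L1) ^ T * (q + S) ^ L0)"
proof -
  let ?P = "\<lambda>t. (twisted_pderiv (int j) ^^ t) (monom 1 i)"
  have deg: "degree (?P t) \<le> i" for t
    by (rule order_trans[OF degree_twisted_pderiv_funpow_le degree_monom_le])
  have len: "(\<Sum>m\<le>i. \<bar>coeff (?P t) m\<bar>) \<le> int (i + j) ^ t" for t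
  proof (induction t)
    case 0
    then show ?case by (simp add: if_distrib[of abs] cong: if_cong)
  next
    case (Suc t)
    have "(\<Sum>m\<le>i. \<bar>coeff (?P (Suc t)) m\<bar>) \<le> int (i + j) * (\<Sum>m\<le>i. \<bar>coeff (?P t) m\<bar>)"
      unfolding funpow.simps(2) o_apply by (rule twisted_pderiv_coeff_sum_le[OF deg])
    also have "\<dots> \<le> int (i + j) * int (i + j) ^ t" by (intro mult_left_mono Suc) simp
    finally show ?case by simp
  qed
  have "\<bar>monomial_value L0 q s t i j\<bar> \<le> (\<Sum>m\<le>i. \<bar>coeff (?P t) m\<bar> * int ((q + S) ^ L0))"
    unfolding monomial_value_def
  proof (rule order_trans[OF sum_abs sum_mono])
    fix m assume "m \<in> {..i}"
    then have m: "m \<le> L0" using assms(1) by simp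
    have "s ^ m * q ^ (L0 - m) \<le> (q + S) ^ m * (q + S) ^ (L0 - m)"
      using assms(3) by (intro mult_mono power_mono) auto
    also have "\<dots> = (q + S) ^ L0" using m by (simp flip: power_add)
    finally have "int (s ^ m * q ^ (L0 - m)) \<le> int ((q + S) ^ L0)" by (simp only: of_nat_le_iff)
    then have "\<bar>coeff (?P t) m\<bar> * int (s ^ m * q ^ (L0 - m)) \<le> \<bar>coeff (?P t) m\<bar> * int ((q + S) ^ L0)"
      by (rule mult_left_mono) simp
    then show "\<bar>coeff (?P t) m * int s ^ m * int q ^ (L0 - m)\<bar> \<le> \<bar>coeff (?P t) m\<bar> * int ((q + S) ^ L0)"
      by (simp add: abs_mult mult.assoc)
  qed
  also have "\<dots> = (\<Sum>m\<le>i. \<bar>coeff (?P t) m\<bar>) * int ((q + S) ^ L0)"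
    by (rule sum_distrib_right[symmetric])
  also have "\<dots> \<le> int ((L0 + L1) ^ T) * int ((q + S) ^ L0)"
  proof (rule mult_right_mono)
    have "(\<Sum>m\<le>i. \<bar>coeff (?P t) m\<bar>) \<le> int ((i + j) ^ t)" using len[of t] by simp
    also have "int ((i + j) ^ t) \<le> int ((L0 + L1) ^ t)"
      using assms(1,2) by (intro zle_int[THEN iffD2] power_mono) auto
    also have "\<dots> \<le> int ((L0 + L1) ^ T)"
      using assms by (intro zle_int[THEN iffD2] power_increasing) auto
    finally show "(\<Sum>m\<le>i. \<bar>coeff (?P t) m\<bar>) \<le> int ((L0 + L1) ^ T)" .
  qed simp
  finally show ?thesis by simp
qed

lemma poly_length_nonneg: "poly_length p \<ge> 0"
  by (simp add: poly_length_def sum_nonneg)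

lemma poly_length_add_le: "poly_length (p + r) \<le> poly_length p + poly_length r"
proof -
  have "poly_length (p + r) \<le> (\<Sum>i\<le>degree (p + r). \<bar>coeff p i\<bar> + \<bar>coeff r i\<bar>)"
    unfolding poly_length_def by (rule sum_mono) simp
  also have "\<dots> \<le> poly_length p + poly_length r"
    unfolding sum.distrib by (intro add_mono sum_abs_coeff_le_poly_length) auto
  finally show ?thesis .
qed

lemma poly_length_sum_le: "finite I \<Longrightarrow> poly_length (\<Sum>i\<in>I. f i) \<le> (\<Sum>i\<in>I. poly_length (f i))"
proof (induction I rule: finite_induct)
  case (insert i I)
  then show ?case using poly_length_add_le[of "f i" "sum f I"] by simp
qed (simp add: poly_length_def)

lemma poly_length_monom_le: "poly_length (monom c n) \<le> \<bar>c\<bar>"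
proof -
  have "poly_length (monom c n) \<le> (\<Sum>i\<in>{n}. \<bar>c\<bar>)"
    unfolding poly_length_def
    by (rule order_trans[OF sum_mono[where g = "\<lambda>i. if i = n then \<bar>c\<bar> else 0"]])
      (auto simp: sum.delta')
  then show ?thesis by simp
qed

lemma of_real_poly_of_int_poly:
  "poly (of_int_poly p) (complex_of_real x) = complex_of_real (poly (of_int_poly p) x)"
  by (simp add: poly_altdef)

text \<open>At \<open>Y\<close> this is \<open>q ^ L0\<close> times the \<open>t\<close>-th
  derivative of the auxiliary function at \<open>s / q\<close>. The exponent \<open>j * s\<close>
  comes from \<open>exp (j * s / q) = Y ^ (j * s)\<close>.\<close>

definition aux_poly :: "(nat \<Rightarrow> nat \<Rightarrow> nat \<Rightarrow> int) \<Rightarrow> nat \<Rightarrow> nat \<Rightarrow> nat \<Rightarrow> nat \<Rightarrow> nat \<Rightarrow> nat \<Rightarrow> int poly"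
  where "aux_poly c L0 L1 d q s t =
    (\<Sum>j<L1. \<Sum>i<L0. \<Sum>k<d. monom (c i j k * monomial_value L0 q s t i j) (k + j * s))"

lemma poly_aux_poly:
  assumes "q > 0"
  shows "poly (of_int_poly (aux_poly c L0 L1 d q s t)) y = of_nat q ^ L0 *
    (\<Sum>j<L1. poly ((twisted_pderiv (of_nat j) ^^ t) (aux_coeff c L0 d y j)) (of_nat s / of_nat q) * y ^ (j * s))"
proof -
  have tw: "(twisted_pderiv (of_nat j) ^^ t) (aux_coeff c L0 d y j) =
      (\<Sum>i<L0. smult (\<Sum>k<d. of_int (c i j k) * y ^ k) ((twisted_pderiv (of_nat j) ^^ t) (monom 1 i)))" for j
  proof -
    have "aux_coeff c L0 d y j = (\<Sum>i<L0. smult (\<Sum>k<d. of_int (c i j k) * y ^ k) (monom 1 i))"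
      by (simp add: aux_coeff_def smult_monom)
    then show ?thesis by (simp only: twisted_pderiv_funpow_sum finite_lessThan)
  qed
  have "poly (of_int_poly (aux_poly c L0 L1 d q s t)) y =
      (\<Sum>j<L1. \<Sum>i<L0. \<Sum>k<d. of_int (c i j k) * of_int (monomial_value L0 q s t i j) * y ^ (k + j * s))"
    by (simp add: aux_poly_def of_int_poly_hom.hom_sum of_int_hom.map_poly_hom_monom poly_sum poly_monom)
  also have "\<dots> = (\<Sum>j<L1. \<Sum>i<L0. \<Sum>k<d. of_int (c i j k) *
      (of_nat q ^ L0 * poly ((twisted_pderiv (of_nat j) ^^ t) (monom 1 i)) (of_nat s / of_nat q)) * y ^ (k + j * s))"
    using assms by (intro sum.cong refl) (simp add: of_int_monomial_value)
  also have "\<dots> = of_nat q ^ L0 * (\<Sum>j<L1. (\<Sum>i<L0. \<Sum>k<d. of_int (c i j k) * y ^ k *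
      poly ((twisted_pderiv (of_nat j) ^^ t) (monom 1 i)) (of_nat s / of_nat q)) * y ^ (j * s))"
    by (simp add: sum_distrib_left sum_distrib_right power_add mult_ac)
  finally show ?thesis by (simp add: tw poly_sum sum_distrib_right)
qed

lemma degree_aux_poly_le:
  assumes "s \<le> S"
  shows "degree (aux_poly c L0 L1 d q s t) \<le> d + L1 * S"
  unfolding aux_poly_def
proof (intro degree_sum_le finite_lessThan)
  fix j i k assume "j \<in> {..<L1}" "i \<in> {..<L0}" "k \<in> {..<d}"
  then have "k \<le> d" "j * s \<le> L1 * S" using assms by (auto intro: mult_mono)
  then have "k + j * s \<le> d + L1 * S" by (rule add_mono)
  then show "degree (monom (c i j k * monomial_value L0 q s t i j) (k + j * s)) \<le> d + L1 * S"
    by (rule order_trans[OF degree_monom_le])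
qed

lemma poly_length_aux_poly_le:
  assumes c: "\<And>i j k. i < L0 \<Longrightarrow> j < L1 \<Longrightarrow> k < d \<Longrightarrow> \<bar>c i j k\<bar> \<le> int B"
    and "s \<le> S" "t \<le> T"
  shows "poly_length (of_int_poly (aux_poly c L0 L1 d q s t)) \<le> L0 * L1 * d * B * (L0 + L1) ^ T * (q + S) ^ L0"
proof -
  let ?b = "B * ((L0 + L1) ^ T * (q + S) ^ L0)"
  have "poly_length (of_int_poly (aux_poly c L0 L1 d q s t)) \<le>
      (\<Sum>j<L1. \<Sum>i<L0. \<Sum>k<d. poly_length (monom (of_int (c i j k * monomial_value L0 q s t i j)) (k + j * s)))"
    unfolding aux_poly_def of_int_poly_hom.hom_sum of_int_hom.map_poly_hom_monom
    by (intro order_trans[OF poly_length_sum_le] sum_mono finite_lessThan order_refl)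
  also have "\<dots> \<le> (\<Sum>j<L1. \<Sum>i<L0. \<Sum>k<d. real ?b)"
  proof (intro sum_mono)
    fix j i k assume "j \<in> {..<L1}" "i \<in> {..<L0}" "k \<in> {..<d}"
    then have *: "\<bar>c i j k\<bar> \<le> int B" "\<bar>monomial_value L0 q s t i j\<bar> \<le> int ((L0 + L1) ^ T * (q + S) ^ L0)"
      using c monomial_value_abs_le[of i L0 j L1 s S t T q] assms(2,3) by auto
    have "\<bar>c i j k * monomial_value L0 q s t i j\<bar> \<le> int B * int ((L0 + L1) ^ T * (q + S) ^ L0)"
      unfolding abs_mult by (rule mult_mono[OF *]) auto
    then have "\<bar>c i j k * monomial_value L0 q s t i j\<bar> \<le> int ?b" by (simp only: of_nat_mult)
    then have "real_of_int \<bar>c i j k * monomial_value L0 q s t i j\<bar> \<le> real_of_int (int ?b)"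
      by (simp only: of_int_le_iff)
    then show "poly_length (monom (of_int (c i j k * monomial_value L0 q s t i j)) (k + j * s)) \<le> real ?b"
      by (intro order_trans[OF poly_length_monom_le]) (simp only: of_int_abs of_int_of_nat_eq)
  qed
  also have "\<dots> = L0 * L1 * d * B * (L0 + L1) ^ T * (q + S) ^ L0" by simp
  finally show ?thesis .
qed

text \<open>The forms already contain \<open>\<rho> ^ n\<close>, so on the disc of radius \<rho>
  each of the first \<open>N\<close> Taylor terms is at most \<epsilon>. The rest consists of tails
  of exponential series and gains a power of 2.\<close>

lemma exp_poly_small:
  fixes c :: "nat \<Rightarrow> nat \<Rightarrow> nat \<Rightarrow> int" and Y \<rho> \<epsilon> :: real and w :: complex
  assumes c: "\<And>i j k. i < L0 \<Longrightarrow> j < L1 \<Longrightarrow> k < d \<Longrightarrow> \<bar>c i j k\<bar> \<le> int B"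
    and forms: "\<And>n. n < N \<Longrightarrow> \<bar>\<Sum>(i, j, k)\<in>{..<L0} \<times> {..<L1} \<times> {..<d}. of_int (c i j k) *
      (if i \<le> n then Y ^ k * \<rho> ^ n * real j ^ (n - i) / fact (n - i) else 0)\<bar> \<le> \<epsilon>"
    and N: "L0 \<le> N" and Y: "Y \<ge> 1" and \<rho>: "\<rho> \<ge> 1" and w: "cmod w \<le> \<rho>"
  shows "cmod (\<Sum>j<L1. poly (aux_coeff c L0 d (of_real Y) j) w * exp (of_nat j * w))
    \<le> N * \<epsilon> + L0 * L1 * d * B * Y ^ d * \<rho> ^ L0 * exp (2 * (L1 * \<rho>)) / 2 ^ (N - L0)"
proof -
  let ?U = "{..<L0} \<times> {..<L1} \<times> {..<d}"
  define a where "a i j n = (if i \<le> n then real j ^ (n - i) / fact (n - i) else 0)" for i j n :: nat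
  \<comment> \<open>The series of \<open>exp\<close> is cut at \<open>N - i\<close> because the
    factor \<open>w ^ i\<close> shifts the expansion; after the shift all products are cut at the
    same order \<open>N\<close>.\<close>
  define rem where "rem i j = w ^ i * (exp (of_nat j * w) - (\<Sum>m<N - i. (of_nat j * w) ^ m / fact m))" for i j :: nat
  have split: "w ^ i * exp (of_nat j * w) = (\<Sum>n<N. of_real (a i j n) * w ^ n) + rem i j" for i j
  proof -
    have "(\<Sum>n<N. of_real (a i j n) * w ^ n) = (\<Sum>n\<in>{n. n < N \<and> i \<le> n}. of_nat j ^ (n - i) / fact (n - i) * w ^ n)"
      by (rule sum.mono_neutral_cong_right) (auto simp: a_def)
    also have "\<dots> = (\<Sum>m<N - i. of_nat j ^ m / fact m * w ^ (m + i))"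
      by (rule sum.reindex_bij_witness[of _ "\<lambda>m. m + i" "\<lambda>n. n - i"]) auto
    also have "\<dots> = w ^ i * (\<Sum>m<N - i. (of_nat j * w) ^ m / fact m)"
      by (simp add: sum_distrib_left power_add power_mult_distrib mult_ac)
    finally show ?thesis by (simp add: rem_def right_diff_distrib)
  qed
  have rem: "cmod (rem i j) \<le> \<rho> ^ L0 * (exp (2 * (L1 * \<rho>)) / 2 ^ (N - L0))" if ij: "i < L0" "j < L1" for i j
  proof -
    have "cmod (rem i j) \<le> \<rho> ^ i * (exp (2 * cmod (of_nat j * w)) / 2 ^ (N - i))"
      unfolding rem_def norm_mult norm_power
      using w \<rho> exp_taylor_remainder[of "of_nat j * w" "N - i"]
      by (intro mult_mono power_mono) (auto simp: norm_mult)
    also have "\<dots> \<le> \<rho> ^ L0 * (exp (2 * (L1 * \<rho>)) / 2 ^ (N - L0))"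
    proof (intro mult_mono frac_le)
      show "\<rho> ^ i \<le> \<rho> ^ L0" using \<rho> ij by (intro power_increasing) auto
      show "exp (2 * cmod (of_nat j * w)) \<le> exp (2 * (L1 * \<rho>))"
        using ij w \<rho> by (auto simp: norm_mult intro!: mult_mono)
      show "(2::real) ^ (N - L0) \<le> 2 ^ (N - i)" using ij by (intro power_increasing) auto
    qed (use \<rho> in auto)
    finally show ?thesis .
  qed
  define cf where "cf n = (\<Sum>(i, j, k)\<in>?U. of_int (c i j k) * Y ^ k * a i j n)" for n
  have cf: "\<bar>cf n * \<rho> ^ n\<bar> \<le> \<epsilon>" if "n < N" for n
  proof -
    have "cf n * \<rho> ^ n = (\<Sum>(i, j, k)\<in>?U. of_int (c i j k) *
      (if i \<le> n then Y ^ k * \<rho> ^ n * real j ^ (n - i) / fact (n - i) else 0))"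
      unfolding cf_def sum_distrib_right by (rule sum.cong) (auto simp: a_def)
    then show ?thesis using forms[OF that] by simp
  qed
  have "(\<Sum>j<L1. poly (aux_coeff c L0 d (of_real Y) j) w * exp (of_nat j * w))
      = (\<Sum>i<L0. \<Sum>j<L1. \<Sum>k<d. of_int (c i j k) * of_real Y ^ k * (w ^ i * exp (of_nat j * w)))"
    unfolding poly_aux_coeff by (subst sum.swap) (simp add: sum_distrib_right mult.assoc)
  also have "\<dots> = (\<Sum>(i, j, k)\<in>?U. of_int (c i j k) * of_real Y ^ k * (w ^ i * exp (of_nat j * w)))"
    by (simp add: sum.cartesian_product)
  also have "\<dots> = (\<Sum>(i, j, k)\<in>?U. \<Sum>n<N. of_int (c i j k) * of_real Y ^ k * (of_real (a i j n) * w ^ n))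
      + (\<Sum>(i, j, k)\<in>?U. of_int (c i j k) * of_real Y ^ k * rem i j)"
    unfolding sum.distrib[symmetric] split by (rule sum.cong) (auto simp: distrib_left sum_distrib_left)
  also have "(\<Sum>(i, j, k)\<in>?U. \<Sum>n<N. of_int (c i j k) * of_real Y ^ k * (of_real (a i j n) * w ^ n))
      = (\<Sum>n<N. of_real (cf n) * w ^ n)"
    unfolding cf_def case_prod_unfold of_real_sum sum_distrib_right
    by (subst sum.swap) (simp add: mult.assoc)
  finally have G: "(\<Sum>j<L1. poly (aux_coeff c L0 d (of_real Y) j) w * exp (of_nat j * w))
      = (\<Sum>n<N. of_real (cf n) * w ^ n) + (\<Sum>(i, j, k)\<in>?U. of_int (c i j k) * of_real Y ^ k * rem i j)" .
  have "cmod (\<Sum>n<N. of_real (cf n) * w ^ n) \<le> (\<Sum>n<N. \<epsilon>)"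
  proof (rule order_trans[OF norm_sum sum_mono])
    fix n assume n: "n \<in> {..<N}"
    have "cmod (of_real (cf n) * w ^ n) = \<bar>cf n\<bar> * cmod w ^ n" by (simp add: norm_mult norm_power)
    also have "\<dots> \<le> \<bar>cf n\<bar> * \<rho> ^ n" using w by (intro mult_left_mono power_mono) auto
    also have "\<dots> = \<bar>cf n * \<rho> ^ n\<bar>" using \<rho> by (simp add: abs_mult)
    also have "\<dots> \<le> \<epsilon>" using cf n by simp
    finally show "cmod (of_real (cf n) * w ^ n) \<le> \<epsilon>" .
  qed
  moreover have "cmod (\<Sum>(i, j, k)\<in>?U. of_int (c i j k) * of_real Y ^ k * rem i j)
      \<le> (\<Sum>u\<in>?U. B * Y ^ d * (\<rho> ^ L0 * (exp (2 * (L1 * \<rho>)) / 2 ^ (N - L0))))"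
  proof (rule order_trans[OF norm_sum sum_mono])
    fix u assume "u \<in> ?U"
    then obtain i j k where u: "u = (i, j, k)" "i < L0" "j < L1" "k < d" by auto
    have "real_of_int \<bar>c i j k\<bar> \<le> real_of_int (int B)" using c u by (simp only: of_int_le_iff)
    then have "\<bar>real_of_int (c i j k)\<bar> \<le> B" by simp
    moreover have "Y ^ k \<le> Y ^ d" using Y u by (intro power_increasing) auto
    ultimately have "\<bar>real_of_int (c i j k)\<bar> * Y ^ k * cmod (rem i j) \<le>
        B * Y ^ d * (\<rho> ^ L0 * (exp (2 * (L1 * \<rho>)) / 2 ^ (N - L0)))"
      using rem[OF u(2,3)] Y by (intro mult_mono) auto
    then show "cmod (case u of (i, j, k) \<Rightarrow> of_int (c i j k) * of_real Y ^ k * rem i j) \<le>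
        B * Y ^ d * (\<rho> ^ L0 * (exp (2 * (L1 * \<rho>)) / 2 ^ (N - L0)))"
      using Y by (simp add: u(1) norm_mult norm_power)
  qed
  ultimately show ?thesis
    unfolding G by (intro order_trans[OF norm_triangle_ineq]) (simp add: mult_ac)
qed

text \<open>One integer polynomial is viewed at two places. At \<open>Y\<close> it is a derivative
  of a function that is small on a large disc; at a root \<theta> of \<open>R\<close> it is an
  algebraic sum to which the zero estimate applies.\<close>

lemma auxiliary_polynomial:
  fixes q d L0 L1 S T N B K :: nat and R :: "int poly" and \<rho> P \<Lambda> :: real
  defines "\<rho> \<equiv> S / q + 1"
  defines "P \<equiv> real (L0 * L1 * d)"
  defines "\<Lambda> \<equiv> exp (d / q) * \<rho> ^ L0 * exp (2 * (L1 * \<rho>))"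
  assumes q: "q > 0" and R: "unsplittable R" "degree R = d" "d > 0" "coeff R 0 \<noteq> 0"
    and pos: "L0 > 0" "L1 > 0" "S > 0" "L1 < T" "L0 \<le> N" "K > 0"
    and zeros: "L0 * L1 \<le> S * (T - L1)"
    and card: "(K + 1) ^ N < (B + 1) ^ (L0 * L1 * d)"
  obtains V where "degree (gcd R V) = 0" "degree V \<le> d + L1 * S"
    "poly_length (of_int_poly V) \<le> L0 * L1 * d * B * (L0 + L1) ^ T * (q + S) ^ L0"
    "\<bar>poly (of_int_poly V) (exp (1 / q))\<bar> \<le> q ^ L0 * (fact T * (P * B * \<Lambda> * (N / K + 1 / 2 ^ (N - L0))))"
proof -
  define Y where "Y = exp (1 / real q)"
  let ?U = "{..<L0} \<times> {..<L1} \<times> {..<d}"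
  have Y: "Y \<ge> 1" and \<rho>: "\<rho> \<ge> 1" using q by (simp_all add: Y_def \<rho>_def)
  have Yk: "Y ^ k \<le> exp (d / q)" if "k \<le> d" for k
  proof -
    have "Y ^ k = exp (k * (1 / q))" unfolding Y_def by (rule exp_of_nat_mult[symmetric])
    also have "\<dots> \<le> exp (d / q)" using that q by (simp add: divide_right_mono)
    finally show ?thesis .
  qed
  define lam where "lam n = (\<lambda>(i, j, k). if i \<le> n then Y ^ k * \<rho> ^ n * real j ^ (n - i) / fact (n - i) else 0)"
    for n :: nat
  have lam_le: "lam n (i, j, k) \<le> \<Lambda>" if u: "i < L0" "j < L1" "k < d" for n i j k
  proof (cases "i \<le> n")
    case True
    have "lam n (i, j, k) = Y ^ k * (\<rho> ^ i * ((j * \<rho>) ^ (n - i) / fact (n - i)))"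
      using True by (simp add: lam_def power_mult_distrib mult_ac flip: power_add)
    also have "\<dots> \<le> exp (d / q) * (\<rho> ^ L0 * exp (2 * (L1 * \<rho>)))"
    proof (intro mult_mono Yk)
      show "\<rho> ^ i \<le> \<rho> ^ L0" using \<rho> u by (intro power_increasing) auto
      have "(j * \<rho>) ^ (n - i) / fact (n - i) \<le> (\<Sum>m\<in>{n - i}. (j * \<rho>) ^ m /\<^sub>R fact m)"
        by (simp add: field_simps)
      also have "\<dots> \<le> exp (j * \<rho>)"
        unfolding exp_def using \<rho> by (intro sum_le_suminf summable_exp_generic) auto
      also have "\<dots> \<le> exp (2 * (L1 * \<rho>))"
      proof -
        have "real j * \<rho> \<le> real L1 * \<rho>" using u \<rho> by (intro mult_right_mono) auto
        moreover have "real L1 * \<rho> \<ge> 0" using \<rho> by simp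
        ultimately show ?thesis by simp
      qed
      finally show "(j * \<rho>) ^ (n - i) / fact (n - i) \<le> exp (2 * (L1 * \<rho>))" .
    qed (use u \<rho> in auto)
    finally show ?thesis by (simp add: \<Lambda>_def mult.assoc)
  qed (use \<rho> in \<open>auto simp: lam_def \<Lambda>_def\<close>)
  have \<Lambda>: "\<Lambda> > 0" using \<rho> by (simp add: \<Lambda>_def)
  have P: "P > 0" using pos R(3) by (simp add: P_def)
  have sum_lam: "(\<Sum>u\<in>?U. lam n u) \<le> P * \<Lambda>" for n
  proof -
    have "(\<Sum>u\<in>?U. lam n u) \<le> (\<Sum>u\<in>?U. \<Lambda>)" by (rule sum_mono) (auto intro: lam_le)
    then show ?thesis by (simp add: P_def mult.assoc)
  qed
  have lam0: "0 \<le> lam n u" for n u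
    using Y \<rho> by (auto simp: lam_def split: prod.split)
  have cardU: "(K + 1) ^ N < (B + 1) ^ card ?U" and finU: "finite ?U" and PL: "P * \<Lambda> > 0"
    using card P \<Lambda> by (simp_all add: mult.assoc)
  obtain c0 where c0: "\<exists>u\<in>?U. c0 u \<noteq> 0" "\<And>u. u \<in> ?U \<Longrightarrow> \<bar>c0 u\<bar> \<le> int B"
    "\<And>n. n < N \<Longrightarrow> \<bar>\<Sum>u\<in>?U. of_int (c0 u) * lam n u\<bar> \<le> B * (P * \<Lambda>) / K"
    by (rule pigeonhole_small_linear_forms[OF finU lam0 sum_lam PL pos(6) cardU]) (rule that)
  define c where "c i j k = c0 (i, j, k)" for i j k
  have cB: "\<bar>c i j k\<bar> \<le> int B" if "i < L0" "j < L1" "k < d" for i j k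
    using c0(2) that by (simp add: c_def)
  have small: "cmod (\<Sum>j<L1. poly (aux_coeff c L0 d (of_real Y) j) w * exp (of_nat j * w))
      \<le> P * B * \<Lambda> * (N / K + 1 / 2 ^ (N - L0))" if w: "cmod w \<le> \<rho>" for w
  proof -
    have forms: "\<bar>\<Sum>(i, j, k)\<in>?U. of_int (c i j k) *
      (if i \<le> n then Y ^ k * \<rho> ^ n * real j ^ (n - i) / fact (n - i) else 0)\<bar> \<le> B * (P * \<Lambda>) / K" if n: "n < N" for n
      using c0(3)[OF n] by (simp add: c_def lam_def case_prod_unfold)
    have "cmod (\<Sum>j<L1. poly (aux_coeff c L0 d (of_real Y) j) w * exp (of_nat j * w))
      \<le> N * (B * (P * \<Lambda>) / K) + real L0 * real L1 * real d * real B * Y ^ d * \<rho> ^ L0 * exp (2 * (L1 * \<rho>)) / 2 ^ (N - L0)"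
      by (rule exp_poly_small[OF cB forms pos(5) Y \<rho> w])
    also have "real L0 * real L1 * real d * real B * Y ^ d * \<rho> ^ L0 * exp (2 * (L1 * \<rho>)) / 2 ^ (N - L0) =
        (P * B * (\<rho> ^ L0 * exp (2 * (L1 * \<rho>))) / 2 ^ (N - L0)) * Y ^ d"
      by (simp add: P_def mult_ac)
    also have "\<dots> \<le> (P * B * (\<rho> ^ L0 * exp (2 * (L1 * \<rho>))) / 2 ^ (N - L0)) * exp (d / q)"
      using P \<rho> by (intro mult_left_mono Yk) auto
    also have "N * (B * (P * \<Lambda>) / K) + \<dots> = P * B * \<Lambda> * (N / K + 1 / 2 ^ (N - L0))"
      by (simp add: \<Lambda>_def algebra_simps)
    finally show ?thesis by simp
  qed
  obtain \<theta> where \<theta>: "poly (of_int_poly R) \<theta> = (0 :: complex)"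
  proof -
    have "\<not> constant (poly (of_int_poly R :: complex poly))"
      using R by (simp add: constant_degree)
    then show ?thesis using fundamental_theorem_of_algebra that by blast
  qed
  \<comment> \<open>Otherwise the zero estimate, with \<open>\<theta> ^ (j * s)\<close> as
    multipliers, makes every \<open>aux_coeff\<close> at \<theta> vanish.\<close>
  have "\<exists>s<S. \<exists>t<T. poly (of_int_poly (aux_poly c L0 L1 d q s t)) \<theta> \<noteq> (0::complex)"
  proof (rule ccontr)
    assume neg: "\<not> ?thesis"
    obtain i j k where ijk: "i < L0" "j < L1" "k < d" "c i j k \<noteq> 0"
      using c0(1) by (auto simp: c_def)
    \<comment> \<open>A nonzero polynomial of degree below \<open>d\<close> whose value at \<theta>
      is the \<open>i\<close>-th coefficient of the vanishing \<open>aux_coeff\<close>; a root of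
      \<open>R\<close> admits no such polynomial.\<close>
    define f where "f = (\<Sum>k<d. monom (c i j k) k)"
    have cf: "coeff f k = (if k < d then c i j k else 0)" for k
      by (simp add: f_def coeff_sum)
    then have f0: "f \<noteq> 0" using ijk(3,4) by (metis coeff_0)
    have "degree f \<le> d - 1" by (rule degree_le) (use cf in auto)
    \<comment> \<open>The multipliers of the zero estimate have to be nonzero; this is the purpose
      of \<open>coeff R 0 \<noteq> 0\<close>.\<close>
    have \<theta>0: "\<theta> \<noteq> 0"
    proof
      assume "\<theta> = 0"
      then show False using \<theta> R(4) by (simp add: poly_0_coeff_0)
    qed
    have "aux_coeff c L0 d \<theta> j = 0"
    proof (rule exp_poly_zero_estimate[where w = "\<lambda>s. of_nat s / of_nat q"
          and z = "\<lambda>s j. \<theta> ^ (j * s)", OF _ _ _ _ zeros pos(3,4) ijk(2)])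
      show "inj_on (\<lambda>s. of_nat s / of_nat q :: complex) {..<S}" using q by (auto simp: inj_on_def)
      fix s t assume "s < S" "t < T"
      then have "poly (of_int_poly (aux_poly c L0 L1 d q s t)) \<theta> = (0::complex)" using neg by blast
      then show "(\<Sum>j<L1. poly ((twisted_pderiv (of_nat j) ^^ t) (aux_coeff c L0 d \<theta> j)) (of_nat s / of_nat q) * \<theta> ^ (j * s)) = 0"
        using q by (simp add: poly_aux_poly)
    qed (use \<theta>0 pos in \<open>auto intro: degree_aux_coeff_less\<close>)
    moreover have "coeff (aux_coeff c L0 d \<theta> j) i = poly (of_int_poly f) \<theta>"
      using ijk(1) by (simp add: coeff_aux_coeff f_def of_int_poly_hom.hom_sum of_int_hom.map_poly_hom_monom poly_sum poly_monom)
    ultimately have "poly (of_int_poly f) \<theta> = 0" by simp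
    then have "degree R \<le> degree f"
      using degree_le_if_common_root[OF R(1) _ \<theta> f0] R by simp
    then show False using \<open>degree f \<le> d - 1\<close> R by simp
  qed
  then obtain s t where st: "s < S" "t < T" "poly (of_int_poly (aux_poly c L0 L1 d q s t)) \<theta> \<noteq> (0::complex)"
    by blast
  let ?V = "aux_poly c L0 L1 d q s t"
  let ?G = "\<lambda>w. \<Sum>j<L1. poly (aux_coeff c L0 d (of_real Y) j) w * exp (of_nat j * w)"
  let ?M = "P * B * \<Lambda> * (N / K + 1 / 2 ^ (N - L0))"
  show ?thesis
  proof (rule that)
    show "degree (gcd R ?V) = 0"
      by (rule degree_gcd_eq_0_if_nonroot[OF R(1) _ \<theta> st(3)]) (use R in simp)
    show "degree ?V \<le> d + L1 * S" using st by (intro degree_aux_poly_le) simp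
    show "poly_length (of_int_poly ?V) \<le> L0 * L1 * d * B * (L0 + L1) ^ T * (q + S) ^ L0"
      by (rule poly_length_aux_poly_le) (use cB st in auto)
    have M: "?M \<ge> 0" using P \<Lambda> by simp
    have Yexp: "exp (of_nat j * (of_nat s / of_nat q)) = (of_real Y :: complex) ^ (j * s)" for j
    proof -
      have "exp (of_nat j * (of_nat s / of_nat q)) = (of_real (exp (real (j * s) * (1 / q))) :: complex)"
        by (simp flip: exp_of_real)
      also have "exp (real (j * s) * (1 / q)) = Y ^ (j * s)" unfolding Y_def by (rule exp_of_nat_mult)
      finally show ?thesis by simp
    qed
    have "complex_of_real (poly (of_int_poly ?V) Y) = of_nat q ^ L0 * (deriv ^^ t) ?G (of_nat s / of_nat q)"
      unfolding of_real_poly_of_int_poly[symmetric] poly_aux_poly[OF q] higher_deriv_exp_poly by (simp only: Yexp)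
    then have "cmod (complex_of_real (poly (of_int_poly ?V) Y)) = q ^ L0 * cmod ((deriv ^^ t) ?G (of_nat s / of_nat q))"
      by (simp add: norm_mult norm_power)
    then have "\<bar>poly (of_int_poly ?V) Y\<bar> = q ^ L0 * cmod ((deriv ^^ t) ?G (of_nat s / of_nat q))" by simp
    \<comment> \<open>The radius \<open>\<rho> = S / q + 1\<close> was chosen so that the unit
      circle around every point \<open>s / q\<close> lies in the disc where \<open>?G\<close> is
      small.\<close>
    also have "cmod ((deriv ^^ t) ?G (of_nat s / of_nat q)) \<le> fact t * ?M / 1 ^ t"
    proof (rule Cauchy_inequality)
      fix w assume "cmod (of_nat s / of_nat q - w) = 1"
      moreover have "cmod w \<le> cmod (of_nat s / of_nat q) + cmod (of_nat s / of_nat q - w)"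
        using norm_triangle_ineq4[of "of_nat s / of_nat q" "of_nat s / of_nat q - w"] by simp
      moreover have "real s / real q \<le> real S / real q" using st q by (intro divide_right_mono) auto
      ultimately have "cmod w \<le> \<rho>" by (simp add: \<rho>_def norm_divide)
      then show "cmod (?G w) \<le> ?M" by (rule small)
    qed (auto intro!: holomorphic_intros continuous_intros)
    also have "\<dots> \<le> fact T * ?M"
      using M st by (simp add: mult_right_mono fact_mono)
    finally show "\<bar>poly (of_int_poly ?V) (exp (1 / q))\<bar> \<le> q ^ L0 * (fact T * ?M)"
      by (simp add: Y_def mult_left_mono)
  qed
qed


subsection \<open>Lower bounds for integer polynomials at exp (1 / q)\<close>

lemma exp_le_two_power:
  assumes "x \<le> real n" shows "exp x \<le> 2 ^ (2 * n)"
proof -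
  have "exp x \<le> exp (real n * 1)" using assms by simp
  also have "\<dots> = exp 1 ^ n" by (rule exp_of_nat_mult)
  also have "\<dots> \<le> 4 ^ n" using exp_le by (intro power_mono) auto
  also have "\<dots> = (2 ^ 2) ^ n" by simp
  finally show ?thesis by (simp only: power_mult)
qed

lemma nat_le_two_power_real: "a \<le> 2 ^ n \<Longrightarrow> real a \<le> 2 ^ n"
  using of_nat_mono[of a "2 ^ n", where 'a = real] by simp

lemma power_le_two_power:
  fixes x :: real
  assumes "0 \<le> x" "x \<le> 2 ^ l" "l * m \<le> b"
  shows "x ^ m \<le> 2 ^ b"
proof -
  have "x ^ m \<le> (2 ^ l) ^ m" using assms by (intro power_mono) auto
  also have "\<dots> = 2 ^ (l * m)" by (simp add: power_mult)
  also have "\<dots> \<le> 2 ^ b" using assms by (intro power_increasing) auto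
  finally show ?thesis .
qed

text \<open>In units of \<open>d * b\<close>, the base 2 logarithms of the heights and of the analytic bounds below add up to less
  than 14, whence \<open>N = 14 * d * b\<close> Taylor coefficients; the pigeonhole condition \<open>N * N \<le> b * (L0 * L1 * d)\<close>
  then requires \<open>mu = 14 * 14 * 4 * lam\<close>.\<close>

lemma unsplittable_lower_bound:
  fixes C q d lam mu :: nat and R :: "int poly"
  assumes C: "C \<ge> 1" "C \<le> mu" and q: "q \<ge> 1" and d: "d \<ge> 1" "d \<le> C * q"
    and lam: "lam \<ge> 2" and mu: "mu = 784 * lam" and large: "3 * C ^ 3 * q ^ 4 * mu ^ 4 \<le> 2 ^ lam"
    and R: "unsplittable R" "degree R = d" "coeff R 0 \<noteq> 0" "poly_length (of_int_poly R) \<le> 2 ^ (2 * C * q)"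
  shows "\<bar>poly (of_int_poly R) (exp (1 / q))\<bar> \<ge> 1 / 2 ^ (24 * lam * C * q ^ 2 * mu ^ 3 * d)"
proof -
  define Y where "Y = exp (1 / real q)"
  \<comment> \<open>With \<open>S = L1\<close> points and \<open>T = L0 + L1\<close> derivatives the
    condition \<open>zeros\<close> is an equality. The size of \<open>L1\<close> is dictated by the
    pigeonhole condition. In \<open>L0\<close>, the factors \<open>q * d * mu ^ 2\<close> match
    \<open>2 * C * q\<close> times the degree of \<open>V\<close> per unit of \<open>d\<close>,
    which is dominated by \<open>L1 * L1\<close>; the third \<open>mu\<close> absorbs
    \<open>C\<close>.\<close>
  define L1 where "L1 = d * mu"
  define L0 where "L0 = q * d * mu ^ 3"
  define T where "T = L0 + L1"
  define b where "b = 4 * lam * L0"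
  define N where "N = 14 * d * b"
  define K where "K = (2::nat) ^ N - 1"
  define B where "B = (2::nat) ^ b"
  have mu1: "mu \<ge> 1" using lam mu by simp
  have L0_ge: "d * mu ^ 3 \<le> L0" unfolding L0_def using q by (simp add: mult_le_mono1 mult.assoc)
  have mu13: "mu \<le> mu ^ 3" using power_increasing[of 1 3 mu] mu1 by simp
  have L1L0: "L1 \<le> L0" unfolding L1_def by (rule order_trans[OF mult_le_mono2[OF mu13] L0_ge])
  have L1pos: "L1 > 0" unfolding L1_def using d mu1 by simp
  then have L0pos: "L0 > 0" using L1L0 by simp
  have b8: "8 * L0 \<le> b" unfolding b_def using lam by simp
  have lamb: "4 * lam \<le> b" unfolding b_def using L0pos by simp
  have lamL0: "lam * (4 * L0) = b" unfolding b_def by simp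
  have Cdmu: "C * d * mu ^ 2 \<le> L0"
  proof -
    have "C * d * mu ^ 2 \<le> mu * d * mu ^ 2" using C(2) by (intro mult_le_mono1)
    also have "\<dots> = d * mu ^ 3" by (simp add: power2_eq_square power3_eq_cube)
    finally show ?thesis by (rule order_trans[OF _ L0_ge])
  qed
  have dmu2: "1 \<le> d * mu ^ 2" using d mu1 by simp
  have Cle: "C \<le> L0"
  proof -
    have "C * 1 \<le> C * (d * mu ^ 2)" using dmu2 by (rule mult_le_mono2)
    then show ?thesis using Cdmu unfolding mult.assoc mult_1_right by (rule le_trans)
  qed
  \<comment> \<open>All quantities of polynomial size in the parameters are bounded by
    \<open>2 ^ lam\<close> through this single inequality; \<open>large\<close> is tailored to
    it.\<close>
  have Z: "c * C ^ i * q ^ j * mu ^ k \<le> 2 ^ lam" if "c \<le> 3" "i \<le> 3" "j \<le> 4" "k \<le> 4" for c i j k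
  proof -
    have "c * C ^ i * q ^ j * mu ^ k \<le> 3 * C ^ 3 * q ^ 4 * mu ^ 4"
      using that C q mu1 by (intro mult_le_mono power_increasing) auto
    then show ?thesis using large by simp
  qed
  have dpow: "d ^ i \<le> C ^ i * q ^ i" for i
    using d(2) by (simp add: power_mono flip: power_mult_distrib)
  have big1: "L0 * L1 * d \<le> 2 ^ lam"
  proof -
    have "L0 * L1 * d = d ^ 3 * (q * mu ^ 4)"
      by (simp add: L0_def L1_def power3_eq_cube power4_eq_xxxx)
    also have "\<dots> \<le> (C ^ 3 * q ^ 3) * (q * mu ^ 4)" by (rule mult_le_mono1[OF dpow])
    also have "\<dots> = 1 * C ^ 3 * q ^ 4 * mu ^ 4" by (simp add: power3_eq_cube power4_eq_xxxx)
    also have "\<dots> \<le> 2 ^ lam" by (rule Z) auto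
    finally show ?thesis .
  qed
  have big2: "T \<le> 2 ^ lam"
  proof -
    have "T \<le> 2 * L0" using L1L0 by (simp add: T_def)
    also have "\<dots> \<le> 2 * (q * (C * q) * mu ^ 3)" unfolding L0_def using d(2) by simp
    also have "\<dots> = 2 * C ^ 1 * q ^ 2 * mu ^ 3" by (simp add: power2_eq_square)
    also have "\<dots> \<le> 2 ^ lam" by (rule Z) auto
    finally show ?thesis .
  qed
  have big3: "q + L1 \<le> 2 ^ lam"
  proof -
    have "q + L1 \<le> q + C * q * mu" unfolding L1_def using d(2) by simp
    also have "\<dots> \<le> C * q * mu + C * q * mu" using C(1) mu1 by simp
    also have "\<dots> = 2 * C ^ 1 * q ^ 1 * mu ^ 1" by simp
    also have "\<dots> \<le> 2 ^ lam" by (rule Z) auto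
    finally show ?thesis .
  qed
  have big4: "d + (d + L1 * L1) \<le> 2 ^ lam"
  proof -
    have "L1 * L1 = d ^ 2 * mu ^ 2" by (simp add: L1_def power2_eq_square)
    moreover have "d * 1 \<le> d * (d * mu ^ 2)" using dmu2 by (rule mult_le_mono2)
    then have "d \<le> d ^ 2 * mu ^ 2" by (simp add: power2_eq_square mult.assoc)
    ultimately have "d + (d + L1 * L1) \<le> 3 * (d ^ 2 * mu ^ 2)" by linarith
    also have "\<dots> \<le> 3 * ((C ^ 2 * q ^ 2) * mu ^ 2)" by (intro mult_le_mono2 mult_le_mono1 dpow)
    also have "\<dots> = 3 * C ^ 2 * q ^ 2 * mu ^ 2" by simp
    also have "\<dots> \<le> 2 ^ lam" by (rule Z) auto
    finally show ?thesis .
  qed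
  have big5: "N \<le> 2 ^ lam"
  proof -
    have "N = 56 * lam * (d ^ 2 * q * mu ^ 3)" by (simp add: N_def b_def L0_def power2_eq_square)
    also have "\<dots> \<le> mu * (d ^ 2 * q * mu ^ 3)" by (rule mult_le_mono1) (simp add: mu)
    also have "\<dots> = d ^ 2 * (q * mu ^ 4)" by (simp add: power3_eq_cube power4_eq_xxxx)
    also have "\<dots> \<le> (C ^ 2 * q ^ 2) * (q * mu ^ 4)" by (rule mult_le_mono1[OF dpow])
    also have "\<dots> = 1 * C ^ 2 * q ^ 3 * mu ^ 4" by (simp add: power2_eq_square power3_eq_cube)
    also have "\<dots> \<le> 2 ^ lam" by (rule Z) auto
    finally show ?thesis .
  qed
  have b_le_db: "b \<le> d * b" using d by simp
  have N_eq: "N = 14 * (d * b)" by (simp add: N_def)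
  have N1: "N \<ge> 1" "L0 \<le> N" unfolding N_eq using b_le_db b8 L0pos by linarith+
  have K2: "2 ^ (N - 1) \<le> K" and Kpos: "K > 0"
  proof -
    have "(2::nat) ^ N = 2 * 2 ^ (N - 1)" using N1(1) by (simp flip: power_Suc)
    moreover have "(1::nat) \<le> 2 ^ (N - 1)" by simp
    ultimately show "2 ^ (N - 1) \<le> K" unfolding K_def by linarith
    then show "K > 0" by (meson less_le_trans zero_less_numeral zero_less_power)
  qed
  \<comment> \<open>The exponents \<open>N * N\<close> and \<open>b * (L0 * L1 * d)\<close>
    coincide, so strictness comes only from \<open>B < B + 1\<close>.\<close>
  have card: "(K + 1) ^ N < (B + 1) ^ (L0 * L1 * d)"
  proof -
    have "(K + 1) ^ N = 2 ^ (N * N)" by (simp add: K_def power_mult)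
    also have "\<dots> \<le> 2 ^ (b * (L0 * L1 * d))"
    proof (rule power_increasing)
      have "N * N = b * (d ^ 2 * (784 * lam) * L0)"
        by (simp add: N_def b_def power2_eq_square)
      also have "\<dots> = b * (L0 * L1 * d)" by (simp add: mu L1_def power2_eq_square)
      finally show "N * N \<le> b * (L0 * L1 * d)" by simp
    qed simp
    also have "\<dots> = B ^ (L0 * L1 * d)" by (simp add: B_def power_mult)
    also have "\<dots> < (B + 1) ^ (L0 * L1 * d)"
      using L0pos L1pos d by (intro power_strict_mono) auto
    finally show ?thesis .
  qed
  let ?\<rho> = "real L1 / real q + 1"
  let ?P = "real (L0 * L1 * d)"
  let ?\<Lambda> = "exp (real d / real q) * ?\<rho> ^ L0 * exp (2 * (real L1 * ?\<rho>))"
  obtain V where V: "degree (gcd R V) = 0" "degree V \<le> d + L1 * L1"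
    "poly_length (of_int_poly V) \<le> L0 * L1 * d * B * (L0 + L1) ^ T * (q + L1) ^ L0"
    "\<bar>poly (of_int_poly V) (exp (1 / q))\<bar> \<le> q ^ L0 * (fact T * (?P * B * ?\<Lambda> * (N / K + 1 / 2 ^ (N - L0))))"
    by (rule auxiliary_polynomial[of q R d L0 L1 L1 T N K B])
      (use q R d L0pos L1pos N1 Kpos card in \<open>auto simp: T_def\<close>)
  have \<rho>: "1 \<le> ?\<rho>" "?\<rho> \<le> 2 ^ lam"
  proof -
    show "1 \<le> ?\<rho>" by simp
    have "real L1 / real q \<le> real L1 / 1" using q by (intro divide_left_mono) auto
    then have "?\<rho> \<le> real (q + L1)" using q by simp
    also have "\<dots> \<le> 2 ^ lam" by (rule nat_le_two_power_real[OF big3])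
    finally show "?\<rho> \<le> 2 ^ lam" .
  qed
  have dq: "real d / real q \<le> real C" using d(2) q by (simp add: divide_le_eq flip: of_nat_mult)
  have W: "real (L0 * L1 * d * B * (L0 + L1) ^ T * (q + L1) ^ L0) \<le> 2 ^ (2 * b)"
  proof -
    have "L0 * L1 * d * B * (L0 + L1) ^ T * (q + L1) ^ L0 \<le> 2 ^ lam * 2 ^ b * (2 ^ lam) ^ T * (2 ^ lam) ^ L0"
      using big1 big2 big3 by (intro mult_le_mono power_mono) (auto simp: B_def T_def)
    also have "\<dots> = 2 ^ (lam + b + lam * T + lam * L0)" by (simp add: power_add power_mult)
    also have "\<dots> \<le> 2 ^ (2 * b)"
    proof (rule power_increasing)
      have "lam * 1 \<le> lam * L0" using L0pos by (intro mult_le_mono2) simp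
      moreover have "lam * T \<le> lam * (2 * L0)" using L1L0 by (intro mult_le_mono2) (simp add: T_def)
      ultimately show "lam + b + lam * T + lam * L0 \<le> 2 * b" using lamL0 by linarith
    qed simp
    finally show ?thesis by (rule nat_le_two_power_real)
  qed
  define n where "n = degree V"
  let ?W = "(2::real) ^ (2 * b)"
  let ?A = "(2::real) ^ (2 * C * q)"
  \<comment> \<open>\<open>V\<close> will be shown to contribute at most one half of this, so
    \<open>R\<close> must contribute the other half.\<close>
  have main: "1 \<le> real (d + n) * Y ^ (d + n) * ?A ^ n * ?W ^ d * (\<bar>poly (of_int_poly R) Y\<bar> + \<bar>poly (of_int_poly V) Y\<bar>)"
    unfolding n_def R(2)[symmetric]
    by (rule coprime_int_polys_not_both_small) (use V R W d q in \<open>auto simp: Y_def\<close>)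
  let ?X = "real (d + n) * Y ^ (d + n) * ?A ^ n * ?W ^ d"
  have Y1: "Y \<ge> 1" using q by (simp add: Y_def)
  have X: "?X \<le> 2 ^ (5 * (d * b))"
  proof -
    have "real (d + n) \<le> 2 ^ lam"
      using big4 V(2) by (intro nat_le_two_power_real) (simp add: n_def)
    moreover have "Y ^ (d + n) \<le> 2 ^ b"
    proof -
      have "Y ^ (d + n) = exp (real (d + n) * (1 / q))" unfolding Y_def by (rule exp_of_nat_mult[symmetric])
      also have "\<dots> \<le> 2 ^ (2 * (2 * C + C * d * mu ^ 2))"
      proof (rule exp_le_two_power)
        have "d + n \<le> 2 * d + d * (d * mu ^ 2)"
          using V(2) by (simp add: n_def L1_def power2_eq_square mult_ac)
        also have "\<dots> \<le> 2 * (C * q) + (C * q) * (d * mu ^ 2)"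
          using d(2) by (intro add_mono mult_le_mono1 mult_le_mono2)
        also have "\<dots> = (2 * C + C * d * mu ^ 2) * q" by (simp add: algebra_simps)
        finally have "real (d + n) \<le> real (2 * C + C * d * mu ^ 2) * real q"
          by (simp only: of_nat_le_iff flip: of_nat_mult)
        then show "real (d + n) * (1 / q) \<le> real (2 * C + C * d * mu ^ 2)"
          using q by (simp add: divide_le_eq)
      qed
      also have "\<dots> \<le> 2 ^ b" using Cdmu Cle b8 by (intro power_increasing) auto
      finally show ?thesis .
    qed
    moreover have "?A ^ n \<le> 2 ^ (d * b)"
    proof (rule power_le_two_power)
      have "2 * C * q * n \<le> 2 * C * q * (d + d * (d * mu ^ 2))"
        using V(2) by (intro mult_le_mono2) (simp add: n_def L1_def power2_eq_square mult_ac)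
      also have "\<dots> \<le> 2 * C * q * (2 * (d * (d * mu ^ 2)))"
      proof -
        have "d * 1 \<le> d * (d * mu ^ 2)" using dmu2 by (rule mult_le_mono2)
        then show ?thesis by (intro mult_le_mono2) linarith
      qed
      also have "\<dots> = 4 * q * d * (C * d * mu ^ 2)" by simp
      also have "\<dots> \<le> 4 * q * d * (d * mu ^ 3)"
      proof (intro mult_le_mono2)
        have "C * d * mu ^ 2 \<le> mu * d * mu ^ 2" using C(2) by (intro mult_le_mono1)
        then show "C * d * mu ^ 2 \<le> d * mu ^ 3" by (simp add: power2_eq_square power3_eq_cube mult_ac)
      qed
      also have "\<dots> = d * (4 * L0)" by (simp add: L0_def)
      also have "\<dots> \<le> d * b" using b8 by (intro mult_le_mono2) linarith
      finally show "2 * C * q * n \<le> d * b" .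
    qed auto
    moreover have "?W ^ d \<le> 2 ^ (2 * (d * b))" by (simp flip: power_mult add: mult_ac)
    ultimately have "?X \<le> 2 ^ lam * 2 ^ b * 2 ^ (d * b) * 2 ^ (2 * (d * b))"
      using Y1 by (intro mult_mono) auto
    also have "\<dots> = 2 ^ (lam + b + d * b + 2 * (d * b))" by (simp only: power_add)
    also have "\<dots> \<le> 2 ^ (5 * (d * b))"
    proof (rule power_increasing)
      show "lam + b + d * b + 2 * (d * b) \<le> 5 * (d * b)" using b_le_db lamb by linarith
    qed simp
    finally show ?thesis .
  qed
  have Vsmall: "\<bar>poly (of_int_poly V) Y\<bar> \<le> 2 ^ (8 * b + 1) / 2 ^ N"
  proof -
    have "real q ^ L0 \<le> 2 ^ b"
    proof (rule power_le_two_power)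
      show "real q \<le> 2 ^ lam" using big3 by (intro nat_le_two_power_real) simp
    qed (use lamL0 in auto)
    then have 1: "real (q ^ L0) \<le> 2 ^ b" by simp
    have 2: "fact T \<le> (2::real) ^ b"
    proof -
      have "fact T \<le> real (T ^ T)" by (rule fact_le_power)
      also have "\<dots> = real T ^ T" by simp
      also have "\<dots> \<le> 2 ^ b"
      proof (rule power_le_two_power)
        show "real T \<le> 2 ^ lam" by (rule nat_le_two_power_real[OF big2])
        have "lam * T \<le> lam * (4 * L0)" using L1L0 by (intro mult_le_mono2) (simp add: T_def)
        then show "lam * T \<le> b" using lamL0 by simp
      qed simp
      finally show ?thesis .
    qed
    have 3: "?P \<le> 2 ^ b"
    proof -
      have "?P \<le> 2 ^ lam" by (rule nat_le_two_power_real[OF big1])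
      also have "\<dots> \<le> 2 ^ b" using lamb by (intro power_increasing) auto
      finally show ?thesis .
    qed
    have 4: "exp (real d / real q) \<le> 2 ^ b"
    proof -
      have "exp (real d / real q) \<le> 2 ^ (2 * C)" by (rule exp_le_two_power[OF dq])
      also have "\<dots> \<le> 2 ^ b" using Cle b8 by (intro power_increasing) auto
      finally show ?thesis .
    qed
    have 5: "?\<rho> ^ L0 \<le> 2 ^ b"
      by (rule power_le_two_power[OF _ \<rho>(2)]) (use lamL0 in auto)
    have 6: "exp (2 * (real L1 * ?\<rho>)) \<le> 2 ^ b"
    proof -
      have "exp (2 * (real L1 * ?\<rho>)) \<le> 2 ^ (2 * (2 * (L1 * (C * mu + 1))))"
      proof (rule exp_le_two_power)
        have "?\<rho> \<le> real (C * mu + 1)"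
        proof -
          have "real L1 / real q = (real d / real q) * real mu" by (simp add: L1_def)
          also have "\<dots> \<le> real C * real mu" by (rule mult_right_mono[OF dq]) simp
          finally show ?thesis by simp
        qed
        then have "real L1 * ?\<rho> \<le> real L1 * real (C * mu + 1)" by (rule mult_left_mono) simp
        moreover have "real (2 * (L1 * (C * mu + 1))) = 2 * (real L1 * real (C * mu + 1))"
          by (simp only: of_nat_mult of_nat_numeral)
        ultimately show "2 * (real L1 * ?\<rho>) \<le> real (2 * (L1 * (C * mu + 1)))" by linarith
      qed
      also have "\<dots> \<le> 2 ^ b"
      proof (rule power_increasing)
        have "L1 * (C * mu + 1) \<le> L1 * (C * mu + C * mu)"
          using C(1) mu1 by (intro mult_le_mono2 add_mono) auto
        also have "\<dots> = 2 * (C * d * mu ^ 2)" by (simp add: L1_def power2_eq_square)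
        finally have "L1 * (C * mu + 1) \<le> 2 * (C * d * mu ^ 2)" .
        then show "2 * (2 * (L1 * (C * mu + 1))) \<le> b" using Cdmu b8 by linarith
      qed simp
      finally show ?thesis .
    qed
    have 7: "real B \<le> 2 ^ b" by (simp add: B_def)
    have L: "?\<Lambda> \<le> 2 ^ b * 2 ^ b * 2 ^ b"
      using 4 5 6 \<rho>(1) by (intro mult_mono) auto
    have NK: "N / K + 1 / 2 ^ (N - L0) \<le> 2 ^ (b + 1) / 2 ^ N"
    proof -
      have "real N / real K \<le> 2 ^ lam / 2 ^ (N - 1)"
      proof (rule frac_le)
        show "real N \<le> 2 ^ lam" by (rule nat_le_two_power_real[OF big5])
        show "2 ^ (N - 1) \<le> real K"
          using of_nat_mono[OF K2, where 'a = real] by simp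
      qed auto
      also have "\<dots> = 2 ^ (lam + 1) / 2 ^ N" using N1(1) by (simp add: power_diff)
      also have "\<dots> \<le> 2 ^ b / 2 ^ N" using lamb lam by (intro divide_right_mono power_increasing) auto
      finally have "real N / real K \<le> 2 ^ b / 2 ^ N" .
      moreover have "1 / 2 ^ (N - L0) = (2::real) ^ L0 / 2 ^ N" using N1(2) by (simp add: power_diff)
      moreover have "(2::real) ^ L0 / 2 ^ N \<le> 2 ^ b / 2 ^ N" using b8 by (intro divide_right_mono power_increasing) auto
      ultimately show ?thesis by simp
    qed
    have "\<bar>poly (of_int_poly V) Y\<bar> \<le> q ^ L0 * (fact T * (?P * B * ?\<Lambda> * (N / K + 1 / 2 ^ (N - L0))))"
      using V(4) by (simp only: Y_def)
    also have "\<dots> \<le> 2 ^ b * (2 ^ b * (2 ^ b * 2 ^ b * (2 ^ b * 2 ^ b * 2 ^ b) * (2 ^ (b + 1) / 2 ^ N)))"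
      by (rule mult_mono[OF 1 mult_mono[OF 2 mult_mono[OF mult_mono[OF mult_mono[OF 3 7] L] NK]]]) auto
    also have "\<dots> = 2 ^ (b + (b + (b + b + (b + b + b) + (b + 1)))) / 2 ^ N"
      by (simp only: power_add times_divide_eq_right)
    also have "b + (b + (b + b + (b + b + b) + (b + 1))) = 8 * b + 1" by simp
    finally show ?thesis .
  qed
  \<comment> \<open>The resultant factor takes 5 units of \<open>d * b\<close> and the bound on
    \<open>V\<close> takes 8; the last unit in \<open>N\<close> pays for the additive
    constants.\<close>
  have "?X * \<bar>poly (of_int_poly V) Y\<bar> \<le> 2 ^ (5 * (d * b)) * (2 ^ (8 * b + 1) / 2 ^ N)"
    by (rule mult_mono[OF X Vsmall]) auto
  also have "\<dots> = 2 ^ (5 * (d * b) + (8 * b + 1)) / 2 ^ N" by (simp add: power_add)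
  also have "\<dots> \<le> 2 ^ (N - 1) / 2 ^ N"
  proof (intro divide_right_mono power_increasing)
    show "5 * (d * b) + (8 * b + 1) \<le> N - 1" unfolding N_eq using b_le_db lamb lam by linarith
  qed auto
  also have "\<dots> = 1 / 2" using N1(1) by (simp add: power_diff)
  finally have "1 / 2 \<le> ?X * \<bar>poly (of_int_poly R) Y\<bar>" using main by (simp only: distrib_left)
  also have "\<dots> \<le> 2 ^ (5 * (d * b)) * \<bar>poly (of_int_poly R) Y\<bar>" by (rule mult_right_mono[OF X]) simp
  finally have "1 / 2 ^ (5 * (d * b) + 1) \<le> \<bar>poly (of_int_poly R) Y\<bar>" by (simp add: field_simps)
  \<comment> \<open>One of the two factors \<open>d\<close> in \<open>d * b\<close> is replaced by
    \<open>C * q\<close>. The exponent becomes linear in the degree, so that bounds of factors can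
    be multiplied.\<close>
  moreover have "(1::real) / 2 ^ (24 * lam * C * q ^ 2 * mu ^ 3 * d) \<le> 1 / 2 ^ (5 * (d * b) + 1)"
  proof (intro divide_left_mono power_increasing)
    have "5 * (d * b) + 1 \<le> 6 * (d * b)" using b_le_db lamb lam by linarith
    also have "\<dots> = 24 * lam * q * mu ^ 3 * d * d" by (simp add: b_def L0_def)
    also have "\<dots> \<le> 24 * lam * q * mu ^ 3 * d * (C * q)" by (rule mult_le_mono2[OF d(2)])
    also have "\<dots> = 24 * lam * C * q ^ 2 * mu ^ 3 * d" by (simp add: power2_eq_square)
    finally show "5 * (d * b) + 1 \<le> 24 * lam * C * q ^ 2 * mu ^ 3 * d" .
  qed auto
  ultimately show ?thesis unfolding Y_def by linarith
qed

section \<open>From irreducible factors to arbitrary polynomials\<close>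

text \<open>The Mahler measure does not grow on passing to a factor. Landau's inequality bounds it
  by the length of \<open>R\<close>, and Mignotte's bound returns from it to the coefficients of
  \<open>g\<close>.\<close>

lemma poly_length_factor_le:
  fixes R g :: "int poly"
  assumes R: "R \<noteq> 0" and g: "g dvd R"
  shows "poly_length (of_int_poly g) \<le> 2 ^ degree R * poly_length (of_int_poly R)"
proof -
  have mR: "mahler_measure R \<le> poly_length (of_int_poly R)"
  proof -
    let ?l = "coeffs R"
    have sq: "real_of_int (\<Sum>a\<leftarrow>l. a * a) \<le> (\<Sum>a\<leftarrow>l. \<bar>real_of_int a\<bar>) ^ 2" for l :: "int list"
    proof (induction l)
      case (Cons a l)
      have "0 \<le> (\<Sum>a\<leftarrow>l. \<bar>real_of_int a\<bar>)" by (rule sum_list_nonneg) auto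
      then have "0 \<le> 2 * \<bar>real_of_int a\<bar> * (\<Sum>a\<leftarrow>l. \<bar>real_of_int a\<bar>)" by simp
      then show ?case using Cons by (simp add: power2_sum) (simp add: power2_eq_square)
    qed simp
    have nn: "0 \<le> (\<Sum>a\<leftarrow>?l. \<bar>real_of_int a\<bar>)" by (rule sum_list_nonneg) auto
    have "mahler_measure R \<le> sqrt (real_of_int (\<Sum>a\<leftarrow>?l. a * a))" by (rule Landau_inequality_mahler_measure)
    also have "\<dots> \<le> sqrt ((\<Sum>a\<leftarrow>?l. \<bar>real_of_int a\<bar>) ^ 2)" by (rule real_sqrt_le_mono[OF sq])
    also have "\<dots> = (\<Sum>a\<leftarrow>?l. \<bar>real_of_int a\<bar>)" using nn by simp
    also have "\<dots> = poly_length (of_int_poly R)"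
      using R by (simp add: poly_length_def coeffs_def sum_list_distinct_conv_sum_set comp_def)
        (simp add: atLeast0LessThan flip: lessThan_Suc_atMost)
    finally show ?thesis .
  qed
  have "poly_length (of_int_poly g) = (\<Sum>k\<le>degree g. of_int \<bar>coeff g k\<bar>)"
    by (simp add: poly_length_def)
  also have "\<dots> \<le> (\<Sum>k\<le>degree g. real (degree g choose k) * mahler_measure g)"
    by (intro sum_mono Mignotte_bound)
  also have "\<dots> = (\<Sum>k\<le>degree g. real (degree g choose k)) * mahler_measure g" by (rule sum_distrib_right[symmetric])
  also have "(\<Sum>k\<le>degree g. real (degree g choose k)) = 2 ^ degree g"
    using choose_row_sum[of "degree g"] by (simp flip: of_nat_sum)
  also have "2 ^ degree g * mahler_measure g \<le> 2 ^ degree R * mahler_measure R"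
    using mahler_measure_dvd[OF R g] mahler_measure_ge_0 dvd_imp_degree_le[OF g R]
    by (intro mult_mono power_increasing) auto
  also have "\<dots> \<le> 2 ^ degree R * poly_length (of_int_poly R)" by (rule mult_left_mono[OF mR]) simp
  finally show ?thesis .
qed

text \<open>Induction on the degree, splitting \<open>g\<close> as long as possible. The statement
  is about all divisors of one fixed \<open>R\<close>, because the length of each piece is then
  compared with \<open>R\<close> directly and no losses accumulate.\<close>

lemma factor_lower_bound:
  fixes C q lam mu :: nat and R g :: "int poly"
  assumes C: "C \<ge> 1" "C \<le> mu" and q: "q \<ge> 1"
    and lam: "lam \<ge> 2" and mu: "mu = 784 * lam" and large: "3 * C ^ 3 * q ^ 4 * mu ^ 4 \<le> 2 ^ lam"
    and R: "R \<noteq> 0" "degree R \<le> C * q" "poly_length (of_int_poly R) \<le> 2 ^ (C * q)"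
    and g: "g dvd R"
  shows "\<bar>poly (of_int_poly g) (exp (1 / q))\<bar> \<ge> 1 / 2 ^ (24 * lam * C * q ^ 2 * mu ^ 3 * degree g)"
  using g
proof (induction "degree g" arbitrary: g rule: less_induct)
  case less
  have g0: "g \<noteq> 0" using less.prems R(1) by auto
  let ?Y = "exp (1 / real q)" and ?k = "24 * lam * C * q ^ 2 * mu ^ 3"
  have triv: "(1::real) / 2 ^ e \<le> 1" for e :: nat by (simp add: divide_le_eq)
  have const: "1 \<le> \<bar>poly (of_int_poly h) (?Y)\<bar>" if "degree h = 0" "h \<noteq> 0" for h
  proof -
    from that(1) obtain c where c: "h = [:c:]" by (rule degree_eq_zeroE)
    with that(2) have "1 \<le> \<bar>c\<bar>" by simp
    then show ?thesis by (simp add: c flip: of_int_abs)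
  qed
  consider "degree g = 0" | "degree g > 0" "\<not> unsplittable g"
    | "degree g > 0" "unsplittable g" "coeff g 0 = 0" | "degree g > 0" "unsplittable g" "coeff g 0 \<noteq> 0" by auto
  then show ?case
  proof cases
    case 1
    show ?thesis by (rule order_trans[OF triv const[OF 1 g0]])
  next
    case 2
    then obtain g1 g2 where g12: "g = g1 * g2" "degree g1 \<noteq> 0" "degree g2 \<noteq> 0"
      unfolding unsplittable_def by auto
    have deg: "degree g = degree g1 + degree g2" using g12(1) g0 by (simp add: degree_mult_eq)
    have dvd: "g1 dvd R" "g2 dvd R" using less.prems g12(1) by (auto dest: dvd_mult_left dvd_mult_right)
    have "1 / 2 ^ (?k * degree g1) * (1 / 2 ^ (?k * degree g2)) \<le>
        \<bar>poly (of_int_poly g1) ?Y\<bar> * \<bar>poly (of_int_poly g2) ?Y\<bar>"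
      using less.hyps[of g1] less.hyps[of g2] deg g12 dvd by (intro mult_mono) auto
    also have "1 / 2 ^ (?k * degree g1) * (1 / 2 ^ (?k * degree g2)) = 1 / (2::real) ^ (?k * degree g)"
      by (simp add: deg distrib_left power_add)
    also have "\<bar>poly (of_int_poly g1) ?Y\<bar> * \<bar>poly (of_int_poly g2) ?Y\<bar> = \<bar>poly (of_int_poly g) ?Y\<bar>"
      by (simp add: g12(1) of_int_poly_hom.hom_mult abs_mult)
    finally show ?thesis .
  next
    \<comment> \<open>Here \<open>g\<close> is a constant times the indeterminate, and
      \<open>exp (1 / q)\<close> is at least 1.\<close>
    case 3
    then have "[:0, 1:] dvd g"
      using poly_eq_0_iff_dvd[of g 0] by (simp add: poly_0_coeff_0)
    then obtain h where h: "g = [:0, 1:] * h" by (rule dvdE)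
    have "degree h = 0" using 3(2)[unfolded unsplittable_def, rule_format, OF h] by simp
    moreover have "h \<noteq> 0" using h g0 by auto
    ultimately have "1 \<le> \<bar>poly (of_int_poly h) ?Y\<bar>" by (rule const)
    moreover have "1 \<le> ?Y" by simp
    ultimately have "1 * 1 \<le> ?Y * \<bar>poly (of_int_poly h) ?Y\<bar>" by (intro mult_mono) auto
    also have "\<dots> = \<bar>poly (of_int_poly g) ?Y\<bar>"
      unfolding h of_int_poly_hom.hom_mult by (simp add: abs_mult)
    finally have "1 \<le> \<bar>poly (of_int_poly g) ?Y\<bar>" by simp
    then show ?thesis by (rule order_trans[OF triv])
  next
    case 4
    have "degree g \<le> C * q" using dvd_imp_degree_le[OF less.prems R(1)] R(2) by simp
    \<comment> \<open>The exponent doubles because the factor \<open>2 ^ degree R\<close> is itself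
      at most \<open>2 ^ (C * q)\<close>.\<close>
    moreover have "poly_length (of_int_poly g) \<le> 2 ^ (2 * C * q)"
    proof -
      have "poly_length (of_int_poly g) \<le> 2 ^ degree R * poly_length (of_int_poly R)"
        by (rule poly_length_factor_le[OF R(1) less.prems])
      also have "\<dots> \<le> 2 ^ (C * q) * 2 ^ (C * q)"
        using R poly_length_nonneg by (intro mult_mono power_increasing) auto
      also have "\<dots> = 2 ^ (2 * C * q)" by (simp flip: power_add)
      finally show ?thesis .
    qed
    ultimately show ?thesis
      using unsplittable_lower_bound[OF C q _ _ lam mu large 4(2) refl 4(3)] 4(1) by simp
  qed
qed

lemma eventually_log_power_le:
  fixes K :: real
  assumes "K > 0"
  shows "eventually (\<lambda>q::real. K * (8 * log 2 q + 9) ^ 4 \<le> q) at_top"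
    "eventually (\<lambda>q::real. K \<le> 8 * log 2 q + 8) at_top"
  using assms by real_asymp+

text \<open>With \<open>lam\<close> of size \<open>log q\<close> and \<open>degree R = O(q)\<close>
  the exponent is \<open>O(q ^ 3 * log q ^ 4)\<close>, which is eventually below
  \<open>q ^ 4 / 2\<close>. The other half of \<open>q ^ 4\<close> is left to absorb denominators
  and Lipschitz constants.\<close>

theorem exp_inverse_poly_lower_bound:
  fixes C :: nat
  obtains Q :: nat where "Q \<ge> 1" "\<And>(q::nat) R :: int poly. q \<ge> Q \<Longrightarrow> R \<noteq> 0 \<Longrightarrow> degree R \<le> C * q \<Longrightarrow>
    poly_length (of_int_poly R) \<le> 2 ^ (C * q) \<Longrightarrow>
    exp (- (real q ^ 4) / 2) \<le> \<bar>poly (of_int_poly R) (exp (1 / q))\<bar>"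
proof -
  define C1 where "C1 = max C 1"
  define K where "K = 3 * real C1 ^ 3 * 784 ^ 4"
  have C1: "real C1 \<ge> 1" by (simp add: C1_def)
  have K: "K > 0" using C1 by (simp add: K_def)
  have "eventually (\<lambda>q::real. K * (8 * log 2 q + 9) ^ 4 \<le> q \<and> real C1 \<le> 8 * log 2 q + 8) at_top"
    by (rule eventually_conj[OF eventually_log_power_le(1)[OF K] eventually_log_power_le(2)]) (use C1 in simp)
  then obtain Q0 :: real where Q0: "\<And>q. q \<ge> Q0 \<Longrightarrow> K * (8 * log 2 q + 9) ^ 4 \<le> q \<and> real C1 \<le> 8 * log 2 q + 8"
    unfolding eventually_at_top_linorder by blast
  show ?thesis
  proof (rule that)
    fix q :: nat and R :: "int poly"
    assume q: "q \<ge> nat \<lceil>max Q0 2\<rceil>" and R: "R \<noteq> 0" "degree R \<le> C * q" "poly_length (of_int_poly R) \<le> 2 ^ (C * q)"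
    define l where "l = 8 * log 2 (real q) + 9"
    \<comment> \<open>This makes \<open>2 ^ lam\<close> at least \<open>q ^ 8\<close>, whereas
      \<open>large\<close> needs \<open>q ^ 4\<close> times constants and powers of logarithms. The
      real number \<open>l\<close> bounds \<open>lam\<close> from above, the 9 allowing for the
      rounding.\<close>
    define lam where "lam = nat \<lceil>8 * log 2 (real q)\<rceil> + 8"
    define mu where "mu = 784 * lam"
    have q': "real q \<ge> Q0" "q \<ge> 2" using q by linarith+
    have log0: "log 2 (real q) \<ge> 0" using q' by simp
    have lam_l: "real lam \<le> l" "l - 1 \<le> real lam" "8 * log 2 (real q) \<le> real lam"
      unfolding lam_def l_def using log0 by linarith+
    have l9: "l \<ge> 9" using log0 by (simp add: l_def)
    have par0: "K * l ^ 4 \<le> real q" "real C1 \<le> l - 1"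
      using Q0[OF q'(1)] by (simp_all add: l_def)
    have par1: "real C1 \<le> 784 * (l - 1)" using par0(2) l9 by simp
    have par2: "3 * real C1 ^ 3 * real q ^ 4 * (784 * l) ^ 4 \<le> real q ^ 8"
    proof -
      have "3 * real C1 ^ 3 * real q ^ 4 * (784 * l) ^ 4 = (K * l ^ 4) * real q ^ 4"
        by (simp add: K_def power_mult_distrib)
      also have "\<dots> \<le> real q * real q ^ 4" by (rule mult_right_mono[OF par0(1)]) simp
      also have "\<dots> = real q ^ 5" by (simp flip: power_Suc)
      also have "\<dots> \<le> real q ^ 8" using q'(2) by (intro power_increasing) auto
      finally show ?thesis .
    qed
    have par3: "24 * l * real C1 * real q ^ 2 * (784 * l) ^ 3 * (real C1 * real q) * ln 2 \<le> real q ^ 4 / 2"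
    proof -
      have "24 * l * real C1 * real q ^ 2 * (784 * l) ^ 3 * (real C1 * real q) * ln 2
          \<le> 24 * l * real C1 * real q ^ 2 * (784 * l) ^ 3 * (real C1 * real q) * 1"
        using l9 ln_2_less_1 by (intro mult_left_mono) auto
      also have "\<dots> = (24 * real C1 ^ 2 * 784 ^ 3 * l ^ 4) * real q ^ 3"
        by (simp add: power_mult_distrib power2_eq_square power3_eq_cube power4_eq_xxxx)
      also have "\<dots> \<le> (K * l ^ 4 / 2) * real q ^ 3"
      proof (rule mult_right_mono)
        have "real C1 ^ 2 \<le> real C1 ^ 3" using C1 by (intro power_increasing) auto
        moreover have "0 \<le> real C1 ^ 3" by simp
        ultimately have "real C1 ^ 2 \<le> 49 * real C1 ^ 3" by linarith
        then have "24 * real C1 ^ 2 * 784 ^ 3 \<le> K / 2" by (simp add: K_def)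
        then have "24 * real C1 ^ 2 * 784 ^ 3 * l ^ 4 \<le> K / 2 * l ^ 4" by (rule mult_right_mono) simp
        then show "24 * real C1 ^ 2 * 784 ^ 3 * l ^ 4 \<le> K * l ^ 4 / 2" by simp
      qed simp
      also have "\<dots> \<le> (real q / 2) * real q ^ 3" using par0(1) by (intro mult_right_mono) auto
      also have "\<dots> = real q ^ 4 / 2" by (simp add: power3_eq_cube power4_eq_xxxx)
      finally show ?thesis .
    qed
    have mul: "real mu \<le> 784 * l" using lam_l by (simp add: mu_def)
    have "real C1 \<le> real mu" using par1 lam_l by (simp add: mu_def)
    then have Cmu: "C1 \<le> mu" by simp
    have "real (3 * C1 ^ 3 * q ^ 4 * mu ^ 4) = 3 * real C1 ^ 3 * real q ^ 4 * real mu ^ 4" by simp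
    also have "\<dots> \<le> 3 * real C1 ^ 3 * real q ^ 4 * (784 * l) ^ 4"
      using mul by (intro mult_left_mono power_mono) auto
    also have "\<dots> \<le> real q ^ 8" by (rule par2)
    also have "\<dots> = 2 powr (8 * log 2 (real q))"
      using q' by (simp add: powr_powr[symmetric] mult.commute[of 8] powr_realpow)
    also have "\<dots> \<le> 2 powr real lam" using lam_l(3) by simp
    also have "\<dots> = real (2 ^ lam)" by (simp add: powr_realpow)
    finally have large: "3 * C1 ^ 3 * q ^ 4 * mu ^ 4 \<le> 2 ^ lam" by (simp only: of_nat_le_iff)
    have le: "C * q \<le> C1 * q" unfolding C1_def by (rule mult_le_mono1) simp
    have lb: "\<bar>poly (of_int_poly R) (exp (1 / q))\<bar> \<ge> 1 / 2 ^ (24 * lam * C1 * q ^ 2 * mu ^ 3 * degree R)"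
    proof (rule factor_lower_bound[OF _ Cmu _ _ mu_def large R(1) _ _ dvd_refl])
      show "degree R \<le> C1 * q" using R(2) le by (rule le_trans)
      show "poly_length (of_int_poly R) \<le> 2 ^ (C1 * q)"
        by (rule order_trans[OF R(3) power_increasing[OF le]]) simp
    qed (use q' in \<open>auto simp: C1_def lam_def\<close>)
    have "real (24 * lam * C1 * q ^ 2 * mu ^ 3 * degree R) \<le> 24 * l * real C1 * real q ^ 2 * (784 * l) ^ 3 * (real C1 * real q)"
    proof -
      have "real (degree R) \<le> real (C1 * q)" using R(2) le by linarith
      then have deg: "real (degree R) \<le> real C1 * real q" by simp
      have "24 * real lam * real C1 * real q ^ 2 * real mu ^ 3 * real (degree R)
          \<le> 24 * l * real C1 * real q ^ 2 * (784 * l) ^ 3 * (real C1 * real q)"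
        by (rule mult_mono[OF mult_mono[OF _ power_mono[OF mul]] deg]) (use lam_l l9 in \<open>auto intro!: mult_right_mono\<close>)
      then show ?thesis by simp
    qed
    then have "real (24 * lam * C1 * q ^ 2 * mu ^ 3 * degree R) * ln 2 \<le> real q ^ 4 / 2"
      by (intro order_trans[OF mult_right_mono par3]) auto
    then have "exp (- (real q ^ 4) / 2) \<le> exp (- (real (24 * lam * C1 * q ^ 2 * mu ^ 3 * degree R) * ln 2))"
      by simp
    also have "\<dots> = 1 / 2 ^ (24 * lam * C1 * q ^ 2 * mu ^ 3 * degree R)"
      by (simp only: exp_minus exp_of_nat_mult) (simp add: divide_inverse)
    finally show "exp (- (real q ^ 4) / 2) \<le> \<bar>poly (of_int_poly R) (exp (1 / q))\<bar>" using lb by linarith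
  next
    show "1 \<le> nat \<lceil>max Q0 2\<rceil>" by linarith
  qed
qed


subsection \<open>Exponential polynomials in several variables\<close>

text \<open>Functions rather than formal polynomials: the partial derivative, the Lipschitz bound
  and the values at rational points are each obtained by one induction over these rules.\<close>

inductive_set exp_polys :: "nat set \<Rightarrow> ((nat \<Rightarrow> real) \<Rightarrow> real) set" for I
  where
    const: "(\<lambda>_. of_int c) \<in> exp_polys I"
  | var: "i \<in> I \<Longrightarrow> (\<lambda>t. t i) \<in> exp_polys I"
  | exp: "i \<in> I \<Longrightarrow> (\<lambda>t. exp (t i)) \<in> exp_polys I"
  | add: "F \<in> exp_polys I \<Longrightarrow> G \<in> exp_polys I \<Longrightarrow> (\<lambda>t. F t + G t) \<in> exp_polys I"
  | mult: "F \<in> exp_polys I \<Longrightarrow> G \<in> exp_polys I \<Longrightarrow> (\<lambda>t. F t * G t) \<in> exp_polys I"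

lemma exp_polys_power: "F \<in> exp_polys I \<Longrightarrow> (\<lambda>t. F t ^ k) \<in> exp_polys I"
proof (induction k)
  case 0
  then show ?case using exp_polys.const[of 1] by simp
next
  case (Suc k)
  then show ?case using exp_polys.mult[of F I "\<lambda>t. F t ^ k"] by simp
qed

lemma exp_polys_sum:
  assumes "finite A" "\<And>a. a \<in> A \<Longrightarrow> F a \<in> exp_polys I"
  shows "(\<lambda>t. \<Sum>a\<in>A. F a t) \<in> exp_polys I"
  using assms
proof (induction A rule: finite_induct)
  case empty
  then show ?case using exp_polys.const[of 0] by simp
next
  case (insert a A)
  then show ?case using exp_polys.add[of "F a" I "\<lambda>t. \<Sum>a\<in>A. F a t"] by simp
qed

lemma exp_polys_prod:
  assumes "finite A" "\<And>a. a \<in> A \<Longrightarrow> F a \<in> exp_polys I"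
  shows "(\<lambda>t. \<Prod>a\<in>A. F a t) \<in> exp_polys I"
  using assms
proof (induction A rule: finite_induct)
  case empty
  then show ?case using exp_polys.const[of 1] by simp
next
  case (insert a A)
  then show ?case using exp_polys.mult[of "F a" I "\<lambda>t. \<Prod>a\<in>A. F a t"] by simp
qed

lemma exp_polys_partial_derivative:
  assumes "F \<in> exp_polys I" "v \<in> I"
  obtains F' where "F' \<in> exp_polys I"
    "\<And>t s. ((\<lambda>s. F (t(v := s))) has_real_derivative F' (t(v := s))) (at s)"
proof -
  have "\<exists>F'\<in>exp_polys I. \<forall>t s. ((\<lambda>s. F (t(v := s))) has_real_derivative F' (t(v := s))) (at s)"
    using assms(1)
  proof (induction rule: exp_polys.induct)
    case (const c)
    show ?case by (rule bexI[OF _ exp_polys.const[of 0]]) auto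
  next
    case (var i)
    show ?case
    proof (cases "i = v")
      case True
      then show ?thesis by (intro bexI[OF _ exp_polys.const[of 1]]) auto
    next
      case False
      then show ?thesis by (intro bexI[OF _ exp_polys.const[of 0]]) auto
    qed
  next
    case (exp i)
    show ?case
    proof (cases "i = v")
      case True
      then show ?thesis
        by (intro bexI[OF _ exp_polys.exp[OF exp]]) (auto intro!: derivative_eq_intros)
    next
      case False
      then show ?thesis by (intro bexI[OF _ exp_polys.const[of 0]]) auto
    qed
  next
    case (add F G)
    from add.IH(1) obtain F' where F': "F' \<in> exp_polys I"
      "\<And>t s. ((\<lambda>s. F (t(v := s))) has_real_derivative F' (t(v := s))) (at s)" by blast
    from add.IH(2) obtain G' where G': "G' \<in> exp_polys I"
      "\<And>t s. ((\<lambda>s. G (t(v := s))) has_real_derivative G' (t(v := s))) (at s)" by blast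
    show ?case
      by (rule bexI[OF _ exp_polys.add[OF F'(1) G'(1)]]) (intro allI DERIV_add F' G')
  next
    case (mult F G)
    from mult.IH(1) obtain F' where F': "F' \<in> exp_polys I"
      "\<And>t s. ((\<lambda>s. F (t(v := s))) has_real_derivative F' (t(v := s))) (at s)" by blast
    from mult.IH(2) obtain G' where G': "G' \<in> exp_polys I"
      "\<And>t s. ((\<lambda>s. G (t(v := s))) has_real_derivative G' (t(v := s))) (at s)" by blast
    show ?case
      by (rule bexI[OF _ exp_polys.add[OF exp_polys.mult[OF F'(1) mult(2)] exp_polys.mult[OF G'(1) mult(1)]]])
        (intro allI DERIV_mult F' G')
  qed
  then show ?thesis using that by blast
qed

lemma exp_polys_lipschitz:
  assumes "F \<in> exp_polys I" "finite I"
  obtains L where "L \<ge> 0"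
    "\<And>t u. \<forall>i\<in>I. \<bar>t i\<bar> \<le> X \<and> \<bar>u i\<bar> \<le> X \<Longrightarrow> \<bar>F t - F u\<bar> \<le> L * (\<Sum>i\<in>I. \<bar>t i - u i\<bar>)"
proof -
  define Q where "Q t u \<longleftrightarrow> (\<forall>i\<in>I. \<bar>t i\<bar> \<le> X \<and> \<bar>u i\<bar> \<le> X)" for t u :: "nat \<Rightarrow> real"
  define D where "D t u = (\<Sum>i\<in>I. \<bar>t i - u i\<bar>)" for t u :: "nat \<Rightarrow> real"
  have D0: "D t u \<ge> 0" for t u by (simp add: D_def sum_nonneg)
  have Di: "\<bar>t i - u i\<bar> \<le> D t u" if "i \<in> I" for t u i
    unfolding D_def using assms(2) that by (intro member_le_sum) auto
  \<comment> \<open>The induction also carries a bound on \<open>F\<close> itself, without which the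
    product case would not go through.\<close>
  have "\<exists>L\<ge>0. \<forall>t u. Q t u \<longrightarrow> \<bar>F t\<bar> \<le> L \<and> \<bar>F t - F u\<bar> \<le> L * D t u"
    using assms(1)
  proof (induction rule: exp_polys.induct)
    case (const c)
    show ?case by (rule exI[of _ "\<bar>of_int c\<bar>"]) (auto simp: D0)
  next
    case (var i)
    have "\<bar>t i\<bar> \<le> max 1 X \<and> \<bar>t i - u i\<bar> \<le> max 1 X * D t u" if "Q t u" for t u
    proof
      show "\<bar>t i\<bar> \<le> max 1 X" using that var by (auto simp: Q_def)
      have "\<bar>t i - u i\<bar> \<le> 1 * D t u" using Di[OF var] by simp
      also have "\<dots> \<le> max 1 X * D t u" using D0 by (intro mult_right_mono) auto
      finally show "\<bar>t i - u i\<bar> \<le> max 1 X * D t u" .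
    qed
    then show ?case by (intro exI[of _ "max 1 X"]) auto
  next
    case (exp i)
    have lip: "\<bar>exp a - exp b\<bar> \<le> exp X * \<bar>a - b\<bar>" if "\<bar>a\<bar> \<le> X" "\<bar>b\<bar> \<le> X" for a b :: real
    proof -
      have *: "exp a - exp b \<le> exp X * (a - b)" if "b \<le> a" "a \<le> X" for a b :: real
      proof -
        have "1 - exp (b - a) \<le> a - b" using exp_ge_add_one_self[of "b - a"] by linarith
        then have "exp a * (1 - exp (b - a)) \<le> exp a * (a - b)" by (rule mult_left_mono) simp
        also have "\<dots> \<le> exp X * (a - b)" using that by (intro mult_right_mono) auto
        also have "exp a * (1 - exp (b - a)) = exp a - exp b" by (simp add: exp_diff field_simps)
        finally show ?thesis .
      qed
      show ?thesis
      proof (cases "b \<le> a")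
        case True
        then show ?thesis using *[of b a] that by simp
      next
        case False
        then show ?thesis using *[of a b] that by simp
      qed
    qed
    have "\<bar>exp (t i)\<bar> \<le> exp X \<and> \<bar>exp (t i) - exp (u i)\<bar> \<le> exp X * D t u" if "Q t u" for t u
    proof
      have b: "\<bar>t i\<bar> \<le> X" "\<bar>u i\<bar> \<le> X" using that exp by (auto simp: Q_def)
      then show "\<bar>exp (t i)\<bar> \<le> exp X" by simp
      have "\<bar>exp (t i) - exp (u i)\<bar> \<le> exp X * \<bar>t i - u i\<bar>" by (rule lip[OF b])
      also have "\<dots> \<le> exp X * D t u" by (intro mult_left_mono Di exp) auto
      finally show "\<bar>exp (t i) - exp (u i)\<bar> \<le> exp X * D t u" .
    qed
    then show ?case by (intro exI[of _ "exp X"]) auto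
  next
    case (add F G)
    from add.IH(1) obtain L where L: "L \<ge> 0"
      "\<And>t u. Q t u \<Longrightarrow> \<bar>F t\<bar> \<le> L \<and> \<bar>F t - F u\<bar> \<le> L * D t u" by blast
    from add.IH(2) obtain M where M: "M \<ge> 0"
      "\<And>t u. Q t u \<Longrightarrow> \<bar>G t\<bar> \<le> M \<and> \<bar>G t - G u\<bar> \<le> M * D t u" by blast
    note LM = L(1) M(1) L(2) M(2)
    have "\<bar>F t + G t\<bar> \<le> L + M \<and> \<bar>F t + G t - (F u + G u)\<bar> \<le> (L + M) * D t u" if "Q t u" for t u
      using LM(3,4)[OF that] unfolding distrib_right by linarith
    then show ?case using LM(1,2) by (intro exI[of _ "L + M"]) auto
  next
    case (mult F G)
    from mult.IH(1) obtain L where L: "L \<ge> 0"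
      "\<And>t u. Q t u \<Longrightarrow> \<bar>F t\<bar> \<le> L \<and> \<bar>F t - F u\<bar> \<le> L * D t u" by blast
    from mult.IH(2) obtain M where M: "M \<ge> 0"
      "\<And>t u. Q t u \<Longrightarrow> \<bar>G t\<bar> \<le> M \<and> \<bar>G t - G u\<bar> \<le> M * D t u" by blast
    note LM = L(1) M(1) L(2) M(2)
    have "\<bar>F t * G t\<bar> \<le> 2 * L * M \<and> \<bar>F t * G t - F u * G u\<bar> \<le> 2 * L * M * D t u" if Q: "Q t u" for t u
    proof
      have Q': "Q u t" using Q by (auto simp: Q_def)
      have "\<bar>F t * G t\<bar> \<le> L * M"
        unfolding abs_mult using LM(3,4)[OF Q] LM(1) by (intro mult_mono) auto
      then show "\<bar>F t * G t\<bar> \<le> 2 * L * M" using mult_nonneg_nonneg[OF LM(1,2)] by linarith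
      have "F t * G t - F u * G u = F t * (G t - G u) + (F t - F u) * G u" by (simp add: algebra_simps)
      then have "\<bar>F t * G t - F u * G u\<bar> \<le> \<bar>F t * (G t - G u)\<bar> + \<bar>(F t - F u) * G u\<bar>"
        by (simp only: abs_triangle_ineq)
      also have "\<dots> = \<bar>F t\<bar> * \<bar>G t - G u\<bar> + \<bar>F t - F u\<bar> * \<bar>G u\<bar>" by (simp only: abs_mult)
      also have "\<dots> \<le> L * (M * D t u) + (L * D t u) * M"
        using LM(3,4)[OF Q] LM(4)[OF Q'] LM(1,2) D0 by (intro add_mono mult_mono) auto
      finally show "\<bar>F t * G t - F u * G u\<bar> \<le> 2 * L * M * D t u" by (simp add: mult_ac)
    qed
    then show ?case using LM(1,2) by (intro exI[of _ "2 * L * M"]) auto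
  qed
  then obtain L where "L \<ge> 0" "\<And>t u. Q t u \<Longrightarrow> \<bar>F t - F u\<bar> \<le> L * D t u" by blast
  then show ?thesis using that unfolding Q_def D_def by blast
qed

lemma poly_length_pCons: "poly_length (pCons a p) = \<bar>a\<bar> + poly_length p"
proof (cases "p = 0")
  case False
  then have "degree (pCons a p) = Suc (degree p)" by simp
  then show ?thesis by (simp add: poly_length_def sum.atMost_Suc_shift del: sum.atMost_Suc)
qed (simp add: poly_length_def)

lemma poly_length_smult: "poly_length (smult a p) = \<bar>a\<bar> * poly_length p"
  by (cases "a = 0") (simp_all add: poly_length_def abs_mult sum_distrib_left)

lemma poly_length_mult_le: "poly_length (p * r) \<le> poly_length p * poly_length r"
proof (induction p)
  case (pCons a p)
  have "poly_length (pCons a p * r) \<le> poly_length (smult a r) + poly_length (pCons 0 (p * r))"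
    by (simp add: poly_length_add_le)
  also have "\<dots> \<le> \<bar>a\<bar> * poly_length r + poly_length p * poly_length r"
    using pCons by (simp add: poly_length_smult poly_length_pCons)
  finally show ?case by (simp add: poly_length_pCons distrib_right)
qed (simp add: poly_length_def)

text \<open>The factor \<open>exp (1 / q) ^ (e * q)\<close> clears the negative powers of \<open>exp (1 / q)\<close>.\<close>

lemma exp_polys_rational_values:
  assumes "F \<in> exp_polys I"
  obtains a e H :: nat where "\<And>(q::nat) p. q \<ge> 1 \<Longrightarrow> \<forall>i\<in>I. \<bar>p i\<bar> \<le> int (X * q) \<Longrightarrow>
    \<exists>R. degree R \<le> H * q \<and> poly_length (of_int_poly R) \<le> 2 ^ (H * q) \<and>
      poly (of_int_poly R) (exp (1 / q)) = real q ^ a * exp (1 / q) ^ (e * q) * F (\<lambda>i. of_int (p i) / q)"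
proof -
  define Q where "Q a e H F q p \<longleftrightarrow> (\<exists>R. degree R \<le> H * q \<and> poly_length (of_int_poly R) \<le> 2 ^ (H * q) \<and>
      poly (of_int_poly R) (exp (1 / q)) = real q ^ a * exp (1 / q) ^ (e * q) * F (\<lambda>i. of_int (p i) / q))"
    for a e H q :: nat and F :: "(nat \<Rightarrow> real) \<Rightarrow> real" and p :: "nat \<Rightarrow> int"
  define ok where "ok q p \<longleftrightarrow> q \<ge> 1 \<and> (\<forall>i\<in>I. \<bar>p i\<bar> \<le> int (X * q))" for q :: nat and p :: "nat \<Rightarrow> int"
  have q2: "real q ^ a \<le> 2 ^ (a * q)" for q a :: nat
  proof -
    have "real q ^ a \<le> (2 ^ q) ^ a" by (intro power_mono) (use of_nat_less_two_power[of q] in \<open>auto simp: less_imp_le\<close>)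
    then show ?thesis by (simp add: power_mult[symmetric] mult.commute)
  qed
  have "\<exists>a e H. \<forall>q p. ok q p \<longrightarrow> Q a e H F q p"
    using assms
  proof (induction rule: exp_polys.induct)
    case (const c)
    have "Q 0 0 (nat \<bar>c\<bar>) (\<lambda>_. of_int c) q p" if "ok q p" for q p
      unfolding Q_def
    proof (intro exI[of _ "[:c:]"] conjI)
      have "\<bar>real_of_int c\<bar> = real (nat \<bar>c\<bar>)" by simp
      also have "\<dots> \<le> real (nat \<bar>c\<bar> * q)" using that by (simp add: ok_def mult_le_cancel_left1)
      also have "\<dots> \<le> 2 ^ (nat \<bar>c\<bar> * q)" by (rule less_imp_le[OF of_nat_less_two_power])
      finally show "poly_length (of_int_poly [:c:]) \<le> 2 ^ (nat \<bar>c\<bar> * q)"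
        by (simp add: poly_length_def)
    qed (auto simp: of_int_hom.map_poly_pCons_hom)
    then show ?case by blast
  next
    case (var i)
    have "Q 1 0 (X + 1) (\<lambda>t. t i) q p" if "ok q p" for q p
      unfolding Q_def
    proof (intro exI[of _ "[:p i:]"] conjI)
      have "\<bar>p i\<bar> \<le> int (X * q)" using that var by (auto simp: ok_def)
      then have "real_of_int \<bar>p i\<bar> \<le> real_of_int (int (X * q))" by (simp only: of_int_le_iff)
      then have "\<bar>real_of_int (p i)\<bar> \<le> real (X * q)" by (simp only: of_int_abs of_int_of_nat_eq)
      also have "\<dots> \<le> real ((X + 1) * q)" by simp
      also have "\<dots> \<le> 2 ^ ((X + 1) * q)" by (rule less_imp_le[OF of_nat_less_two_power])
      finally show "poly_length (of_int_poly [:p i:]) \<le> 2 ^ ((X + 1) * q)"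
        by (simp add: poly_length_def)
    qed (use that in \<open>auto simp: ok_def of_int_hom.map_poly_pCons_hom\<close>)
    then show ?case by blast
  next
    case (exp i)
    have "Q 0 X (2 * X) (\<lambda>t. exp (t i)) q p" if ok: "ok q p" for q p
    proof -
      \<comment> \<open>Adding \<open>X * q\<close> makes the exponent \<open>p i\<close> of
        \<open>exp (1 / q)\<close> nonnegative.\<close>
      let ?r = "nat (p i + int (X * q))"
      have p: "\<bar>p i\<bar> \<le> int (X * q)" and q: "q \<ge> 1" using ok exp by (auto simp: ok_def)
      have r: "int ?r = p i + int (X * q)" using p by simp
      show ?thesis
        unfolding Q_def
      proof (intro exI[of _ "monom 1 ?r"] conjI)
        have "int (2 * X * q) = 2 * int (X * q)" by simp
        then have "?r \<le> 2 * X * q" using p r by linarith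
        then show "degree (monom (1::int) ?r) \<le> 2 * X * q" by (rule order_trans[OF degree_monom_le])
        have "poly_length (monom 1 ?r) \<le> 1" using poly_length_monom_le[of 1 ?r] by simp
        also have "\<dots> \<le> 2 ^ (2 * X * q)" by simp
        finally show "poly_length (of_int_poly (monom 1 ?r)) \<le> 2 ^ (2 * X * q)"
          by (simp add: of_int_hom.map_poly_hom_monom)
        have "poly (of_int_poly (monom 1 ?r)) (exp (1 / q)) = exp (real ?r * (1 / q))"
          by (simp only: of_int_hom.map_poly_hom_monom poly_monom exp_of_nat_mult of_int_1 mult_1)
        also have "real ?r = of_int (p i) + real (X * q)"
          using r by (metis of_int_add of_int_of_nat_eq)
        also have "exp ((of_int (p i) + real (X * q)) * (1 / q)) = exp (real (X * q) * (1 / q)) * exp (of_int (p i) / q)"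
          by (simp add: distrib_right add_divide_distrib flip: exp_add)
        also have "exp (real (X * q) * (1 / q)) = exp (1 / q) ^ (X * q)" by (rule exp_of_nat_mult)
        finally show "poly (of_int_poly (monom 1 ?r)) (exp (1 / q)) =
          real q ^ 0 * exp (1 / q) ^ (X * q) * exp (of_int (p i) / q)" by simp
      qed
    qed
    then show ?case by blast
  next
    case (add F G)
    from add.IH(1) obtain a e H where IH1: "\<And>q p. ok q p \<Longrightarrow> Q a e H F q p" by blast
    from add.IH(2) obtain a' e' H' where IH2: "\<And>q p. ok q p \<Longrightarrow> Q a' e' H' G q p" by blast
    \<comment> \<open>Each summand is multiplied by the clearing factor of the other one. The final
      1 pays for the factor 2 when two lengths are added.\<close>
    let ?H = "H + H' + a + a' + e + e' + 1"
    have "Q (a + a') (e + e') ?H (\<lambda>t. F t + G t) q p" if ok: "ok q p" for q p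
    proof -
      obtain R where R: "degree R \<le> H * q" "poly_length (of_int_poly R) \<le> 2 ^ (H * q)"
        "poly (of_int_poly R) (exp (1 / q)) = real q ^ a * exp (1 / q) ^ (e * q) * F (\<lambda>i. of_int (p i) / q)"
        using IH1[OF ok] unfolding Q_def by blast
      obtain R' where R': "degree R' \<le> H' * q" "poly_length (of_int_poly R') \<le> 2 ^ (H' * q)"
        "poly (of_int_poly R') (exp (1 / q)) = real q ^ a' * exp (1 / q) ^ (e' * q) * G (\<lambda>i. of_int (p i) / q)"
        using IH2[OF ok] unfolding Q_def by blast
      let ?A = "monom (int q ^ a') (e' * q) * R" and ?B = "monom (int q ^ a) (e * q) * R'"
      have len: "poly_length (of_int_poly (monom (int q ^ b) k * P)) \<le> 2 ^ (b * q) * 2 ^ h"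
        if "poly_length (of_int_poly P) \<le> 2 ^ h" for b k h P
      proof -
        have "poly_length (of_int_poly (monom (int q ^ b) k * P)) \<le>
            poly_length (monom (real q ^ b) k) * poly_length (of_int_poly P)"
          using poly_length_mult_le by (simp add: of_int_poly_hom.hom_mult of_int_hom.map_poly_hom_monom)
        also have "\<dots> \<le> 2 ^ (b * q) * 2 ^ h"
          using that q2[of q b] poly_length_monom_le[of "real q ^ b" k] poly_length_nonneg
          by (intro mult_mono) (auto intro: order_trans)
        finally show ?thesis .
      qed
      have deg: "degree (monom (int q ^ b) k * P) \<le> k + h" if "degree P \<le> h" for b k h P
        using degree_mult_le[of "monom (int q ^ b) k" P] degree_monom_le[of "int q ^ b" k] that by linarith
      have "degree (?A + ?B) \<le> ?H * q"
        using deg[OF R(1), of a' "e' * q"] deg[OF R'(1), of a "e * q"]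
        by (intro degree_add_le) (auto simp: algebra_simps)
      moreover have "poly_length (of_int_poly (?A + ?B)) \<le> 2 ^ (?H * q)"
      proof -
        have "poly_length (of_int_poly (?A + ?B)) \<le> poly_length (of_int_poly ?A) + poly_length (of_int_poly ?B)"
          unfolding of_int_poly_hom.hom_add by (rule poly_length_add_le)
        also have "\<dots> \<le> 2 ^ (a' * q) * 2 ^ (H * q) + 2 ^ (a * q) * 2 ^ (H' * q)"
          by (intro add_mono len R R')
        also have "\<dots> \<le> 2 ^ (?H * q - 1) + 2 ^ (?H * q - 1)"
          unfolding power_add[symmetric] using ok
          by (intro add_mono power_increasing) (auto simp: ok_def algebra_simps)
        also have "\<dots> = 2 ^ (?H * q)"
        proof -
          have "?H * q \<noteq> 0" using ok by (simp add: ok_def)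
          then obtain k where k: "?H * q = Suc k" using not0_implies_Suc by blast
          show ?thesis unfolding k by simp
        qed
        finally show ?thesis .
      qed
      moreover have "poly (of_int_poly (?A + ?B)) (exp (1 / q)) =
        real q ^ (a + a') * exp (1 / q) ^ ((e + e') * q) * (F (\<lambda>i. of_int (p i) / q) + G (\<lambda>i. of_int (p i) / q))"
        unfolding of_int_poly_hom.hom_add of_int_poly_hom.hom_mult of_int_hom.map_poly_hom_monom poly_add poly_mult poly_monom R(3) R'(3)
        by (simp add: power_add distrib_left distrib_right mult_ac)
      ultimately show ?thesis unfolding Q_def by blast
    qed
    then show ?case by blast
  next
    case (mult F G)
    from mult.IH(1) obtain a e H where IH1: "\<And>q p. ok q p \<Longrightarrow> Q a e H F q p" by blast
    from mult.IH(2) obtain a' e' H' where IH2: "\<And>q p. ok q p \<Longrightarrow> Q a' e' H' G q p" by blast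
    have "Q (a + a') (e + e') (H + H') (\<lambda>t. F t * G t) q p" if ok: "ok q p" for q p
    proof -
      obtain R where R: "degree R \<le> H * q" "poly_length (of_int_poly R) \<le> 2 ^ (H * q)"
        "poly (of_int_poly R) (exp (1 / q)) = real q ^ a * exp (1 / q) ^ (e * q) * F (\<lambda>i. of_int (p i) / q)"
        using IH1[OF ok] unfolding Q_def by blast
      obtain R' where R': "degree R' \<le> H' * q" "poly_length (of_int_poly R') \<le> 2 ^ (H' * q)"
        "poly (of_int_poly R') (exp (1 / q)) = real q ^ a' * exp (1 / q) ^ (e' * q) * G (\<lambda>i. of_int (p i) / q)"
        using IH2[OF ok] unfolding Q_def by blast
      have "degree (R * R') \<le> (H + H') * q"
        using degree_mult_le[of R R'] R(1) R'(1) by (simp add: distrib_right)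
      moreover have "poly_length (of_int_poly (R * R')) \<le> 2 ^ ((H + H') * q)"
      proof -
        have "poly_length (of_int_poly (R * R')) \<le> poly_length (of_int_poly R) * poly_length (of_int_poly R')"
          unfolding of_int_poly_hom.hom_mult by (rule poly_length_mult_le)
        also have "\<dots> \<le> 2 ^ (H * q) * 2 ^ (H' * q)"
          using R R' poly_length_nonneg by (intro mult_mono) auto
        finally show ?thesis by (simp add: distrib_right power_add)
      qed
      moreover have "poly (of_int_poly (R * R')) (exp (1 / q)) =
        real q ^ (a + a') * exp (1 / q) ^ ((e + e') * q) * (F (\<lambda>i. of_int (p i) / q) * G (\<lambda>i. of_int (p i) / q))"
        unfolding of_int_poly_hom.hom_mult poly_mult R(3) R'(3) by (simp only: power_add distrib_right) (simp only: mult_ac)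
      ultimately show ?thesis unfolding Q_def by blast
    qed
    then show ?case by blast
  qed
  then show ?thesis using that unfolding Q_def ok_def by blast
qed


subsection \<open>Independence of the coordinates and their exponentials\<close>

lemma eventually_const_power_less_exp:
  fixes M :: real
  obtains Q :: nat where "\<And>q::nat. q \<ge> Q \<Longrightarrow> M * real q ^ a < exp (real q ^ 4 / 2)"
proof -
  have "((\<lambda>x::real. x ^ a / exp x) \<longlongrightarrow> 0) at_top" by (rule tendsto_power_div_exp_0)
  then have "((\<lambda>q::nat. real q ^ a / exp (real q)) \<longlongrightarrow> 0) sequentially"
    by (rule filterlim_compose) (rule filterlim_real_sequentially)
  moreover have "0 < 1 / (\<bar>M\<bar> + 1)" by simp
  ultimately have "eventually (\<lambda>q::nat. real q ^ a / exp (real q) < 1 / (\<bar>M\<bar> + 1)) sequentially"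
    by (rule order_tendstoD(2))
  then obtain Q where Q: "\<And>q::nat. q \<ge> Q \<Longrightarrow> real q ^ a / exp (real q) < 1 / (\<bar>M\<bar> + 1)"
    unfolding eventually_sequentially by blast
  show ?thesis
  proof (rule that)
    fix q :: nat assume q: "q \<ge> max Q 2"
    have "real q ^ a * (\<bar>M\<bar> + 1) < exp (real q)"
      using Q[of q] q by (simp add: field_simps)
    moreover have "M * real q ^ a \<le> real q ^ a * (\<bar>M\<bar> + 1)"
      by (subst mult.commute) (intro mult_left_mono, auto)
    moreover have "exp (real q) \<le> exp (real q ^ 4 / 2)"
    proof -
      have "real q * 2 ^ 1 \<le> real q * real q ^ 3"
        using q by (intro mult_left_mono order_trans[OF power_increasing[of 1 3 "2::real"] power_mono]) auto
      then show ?thesis by (simp add: power3_eq_cube power4_eq_xxxx)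
    qed
    ultimately show "M * real q ^ a < exp (real q ^ 4 / 2)" by linarith
  qed
qed

text \<open>\<open>nz\<close> keeps the denominators of the difference quotients nonzero, and the
  factor \<open>k\<close> in \<open>dom\<close> makes the influence of the other coordinates
  \<open>O(1 / k)\<close> relative to coordinate \<open>v\<close>.\<close>

lemma partial_derivative_vanishes:
  fixes x :: "nat \<Rightarrow> real" and q :: "nat \<Rightarrow> nat" and p :: "nat \<Rightarrow> nat \<Rightarrow> int"
  assumes I: "finite I" "v \<in> I" and F: "F \<in> exp_polys I" "F x = 0"
    and q: "\<And>k. k \<ge> 1 \<Longrightarrow> q k \<ge> k"
    and nz: "\<And>k. k \<ge> 1 \<Longrightarrow> real (q k) * x v \<noteq> of_int (p k v)"
    and small: "\<And>k i. k \<ge> 1 \<Longrightarrow> i \<in> I \<Longrightarrow> \<bar>real (q k) * x i - of_int (p k i)\<bar> \<le> exp (- (real (q k) ^ 4))"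
    and dom: "\<And>k i. k \<ge> 1 \<Longrightarrow> i \<in> I \<Longrightarrow> i \<noteq> v \<Longrightarrow>
      real k * \<bar>real (q k) * x i - of_int (p k i)\<bar> \<le> \<bar>real (q k) * x v - of_int (p k v)\<bar>"
    and D: "((\<lambda>s. F (x(v := s))) has_real_derivative D) (at (x v))"
  shows "D = 0"
proof -
  define y where "y k i = of_int (p k i) / real (q k)" for k i
  define X where "X = nat \<lceil>\<Sum>i\<in>I. \<bar>x i\<bar>\<rceil> + 1"
  have qpos: "real (q k) \<ge> 1" if "k \<ge> 1" for k using q[OF that] that by simp
  have delta: "\<bar>x i - y k i\<bar> = \<bar>real (q k) * x i - of_int (p k i)\<bar> / real (q k)" if "k \<ge> 1" for k i
  proof -
    have "x i - y k i = (real (q k) * x i - of_int (p k i)) / real (q k)"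
      using qpos[OF that] by (simp add: y_def field_simps)
    then show ?thesis by simp
  qed
  have delta_small: "\<bar>x i - y k i\<bar> \<le> exp (- (real (q k) ^ 4))" if "k \<ge> 1" "i \<in> I" for k i
  proof -
    have "\<bar>x i - y k i\<bar> \<le> \<bar>real (q k) * x i - of_int (p k i)\<bar> / 1"
      unfolding delta[OF that(1)] using qpos[OF that(1)] by (intro divide_left_mono) auto
    then show ?thesis using small[OF that] by simp
  qed
  have delta_dom: "\<bar>x i - y k i\<bar> \<le> \<bar>x v - y k v\<bar> / real k" if "k \<ge> 1" "i \<in> I" "i \<noteq> v" for k i
    using dom[OF that] that(1) qpos[OF that(1)] unfolding delta[OF that(1)] by (simp add: field_simps)
  have yv: "y k v \<noteq> x v" if "k \<ge> 1" for k
    using nz[OF that] qpos[OF that] by (auto simp: y_def field_simps)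
  have xX: "\<bar>x i\<bar> + 1 \<le> real X" if "i \<in> I" for i
  proof -
    have "\<bar>x i\<bar> \<le> (\<Sum>i\<in>I. \<bar>x i\<bar>)" using I(1) that by (intro member_le_sum) auto
    then show ?thesis unfolding X_def by linarith
  qed
  have yX: "\<bar>y k i\<bar> \<le> real X" if "k \<ge> 1" "i \<in> I" for k i
  proof -
    have "exp (- (real (q k) ^ 4)) \<le> 1" by simp
    then show ?thesis using delta_small[OF that] xX[OF that(2)] by linarith
  qed
  have pX: "\<bar>p k i\<bar> \<le> int (X * q k)" if "k \<ge> 1" "i \<in> I" for k i
  proof -
    have "\<bar>y k i\<bar> * real (q k) = real_of_int \<bar>p k i\<bar>" using qpos[OF that(1)] by (simp add: y_def)
    moreover have "\<bar>y k i\<bar> * real (q k) \<le> real X * real (q k)" by (intro mult_right_mono yX that) simp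
    ultimately have "real_of_int \<bar>p k i\<bar> \<le> real_of_int (int (X * q k))" by simp
    then show ?thesis by (simp only: of_int_le_iff)
  qed
  obtain L where L: "L \<ge> 0"
    "\<And>t u. \<forall>i\<in>I. \<bar>t i\<bar> \<le> real X \<and> \<bar>u i\<bar> \<le> real X \<Longrightarrow> \<bar>F t - F u\<bar> \<le> L * (\<Sum>i\<in>I. \<bar>t i - u i\<bar>)"
    by (rule exp_polys_lipschitz[OF F(1) I(1), where X = "real X"]) (rule that)
  have "eventually (\<lambda>k. F (y k) = 0) sequentially"
  proof -
    obtain a e H where aeH: "\<And>(q::nat) p. q \<ge> 1 \<Longrightarrow> \<forall>i\<in>I. \<bar>p i\<bar> \<le> int (X * q) \<Longrightarrow>
      \<exists>R. degree R \<le> H * q \<and> poly_length (of_int_poly R) \<le> 2 ^ (H * q) \<and>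
      poly (of_int_poly R) (exp (1 / q)) = real q ^ a * exp (1 / q) ^ (e * q) * F (\<lambda>i. of_int (p i) / q)"
      by (rule exp_polys_rational_values[OF F(1), where X = X]) (rule that)
    obtain Q where Q: "\<And>(q::nat) R :: int poly. q \<ge> Q \<Longrightarrow> R \<noteq> 0 \<Longrightarrow> degree R \<le> H * q \<Longrightarrow>
      poly_length (of_int_poly R) \<le> 2 ^ (H * q) \<Longrightarrow>
      exp (- (real q ^ 4) / 2) \<le> \<bar>poly (of_int_poly R) (exp (1 / q))\<bar>"
      by (rule exp_inverse_poly_lower_bound) (rule that)
    define M where "M = exp (real e) * (L * real (card I))"
    obtain Q' where Q': "\<And>q::nat. q \<ge> Q' \<Longrightarrow> M * real q ^ a < exp (real q ^ 4 / 2)"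
      by (rule eventually_const_power_less_exp) (rule that)
    have "F (y k) = 0" if k: "k \<ge> max 1 (max Q Q')" for k
    proof -
      have k1: "k \<ge> 1" and kQ: "q k \<ge> Q" "q k \<ge> Q'" "q k \<ge> 1" using k q[of k] by auto
      obtain R where R: "degree R \<le> H * q k" "poly_length (of_int_poly R) \<le> 2 ^ (H * q k)"
        "poly (of_int_poly R) (exp (1 / q k)) = real (q k) ^ a * exp (1 / q k) ^ (e * q k) * F (y k)"
        using aeH[OF kQ(3), of "p k"] pX[OF k1] unfolding y_def by blast
      have ex: "exp (1 / real (q k)) ^ (e * q k) = exp (real e)"
      proof -
        have "exp (1 / real (q k)) ^ (e * q k) = exp (real (e * q k) * (1 / real (q k)))" by (rule exp_of_nat_mult[symmetric])
        also have "real (e * q k) * (1 / real (q k)) = real e" using kQ(3) by simp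
        finally show ?thesis .
      qed
      show ?thesis
      \<comment> \<open>\<open>R = 0\<close> gives \<open>F (y k) = 0\<close> because the clearing
        factors are positive. A nonzero \<open>R\<close> would contradict the Lipschitz bound
        combined with the lower bound.\<close>
      proof (cases "R = 0")
        case True
        then show ?thesis using R(3) kQ(3) by simp
      next
        case False
        have "\<bar>F (y k)\<bar> = \<bar>F x - F (y k)\<bar>" using F(2) by simp
        also have "\<dots> \<le> L * (\<Sum>i\<in>I. \<bar>x i - y k i\<bar>)"
          by (rule L(2)) (use yX[OF k1] xX in fastforce)
        also have "\<dots> \<le> L * (\<Sum>i\<in>I. exp (- (real (q k) ^ 4)))"
          by (intro mult_left_mono[OF _ L(1)] sum_mono delta_small k1)
        finally have Fy: "\<bar>F (y k)\<bar> \<le> L * real (card I) * exp (- (real (q k) ^ 4))" by simp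
        have "exp (- (real (q k) ^ 4) / 2) \<le> \<bar>poly (of_int_poly R) (exp (1 / q k))\<bar>"
          by (rule Q[OF kQ(1) False R(1,2)])
        also have "\<dots> = real (q k) ^ a * exp (real e) * \<bar>F (y k)\<bar>"
          unfolding R(3) ex by (simp add: abs_mult)
        also have "\<dots> \<le> real (q k) ^ a * exp (real e) * (L * real (card I) * exp (- (real (q k) ^ 4)))"
          by (intro mult_left_mono Fy) simp
        also have "\<dots> = M * real (q k) ^ a * exp (- (real (q k) ^ 4))" by (simp add: M_def)
        also have "\<dots> < exp (real (q k) ^ 4 / 2) * exp (- (real (q k) ^ 4))"
          by (intro mult_strict_right_mono Q' kQ) simp
        also have "\<dots> = exp (- (real (q k) ^ 4) / 2)" by (simp flip: exp_add)
        finally show ?thesis by simp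
      qed
    qed
    then show ?thesis unfolding eventually_sequentially by blast
  qed
  then obtain k0 where k0: "\<And>k. k \<ge> k0 \<Longrightarrow> F (y k) = 0" unfolding eventually_sequentially by blast
  let ?g = "\<lambda>s. (F (x(v := s)) - F (x(v := x v))) / (s - x v)"
  have inv0: "((\<lambda>k. c / real k) \<longlongrightarrow> 0) sequentially" for c :: real
    by (rule tendsto_divide_0[OF tendsto_const filterlim_at_top_imp_at_infinity[OF filterlim_real_sequentially]])
  have ev1: "eventually (\<lambda>k. k \<ge> max 1 k0) sequentially" by (rule eventually_ge_at_top)
  have "((\<lambda>k. y k v - x v) \<longlongrightarrow> 0) sequentially"
  proof (rule Lim_null_comparison[OF _ inv0[of 1]])
    show "eventually (\<lambda>k. norm (y k v - x v) \<le> 1 / real k) sequentially"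
      using ev1
    proof eventually_elim
      case (elim k)
      then have k1: "k \<ge> 1" by simp
      have "norm (y k v - x v) \<le> exp (- (real (q k) ^ 4))"
        using delta_small[OF k1 I(2)] by (simp add: abs_minus_commute)
      also have "\<dots> = 1 / exp (real (q k) ^ 4)" by (simp add: exp_minus divide_inverse)
      also have "\<dots> \<le> 1 / real k"
      proof (rule divide_left_mono)
        have "real k \<le> real (q k) ^ 1" using q[OF k1] by simp
        also have "\<dots> \<le> real (q k) ^ 4" using qpos[OF k1] by (intro power_increasing) auto
        also have "\<dots> \<le> exp (real (q k) ^ 4)" using exp_ge_add_one_self[of "real (q k) ^ 4"] by linarith
        finally show "real k \<le> exp (real (q k) ^ 4)" .
      qed (use k1 in auto)
      finally show ?case .
    qed
  qed
  then have "((\<lambda>k. y k v) \<longlongrightarrow> x v) sequentially" by (simp add: LIM_zero_iff)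
  moreover have "eventually (\<lambda>k. y k v \<noteq> x v) sequentially"
    using ev1 by eventually_elim (use yv in auto)
  ultimately have "filterlim (\<lambda>k. y k v) (at (x v)) sequentially" by (rule filterlim_atI)
  moreover have "(?g \<longlongrightarrow> D) (at (x v))" using D by (simp add: has_field_derivative_iff)
  ultimately have lim1: "((\<lambda>k. ?g (y k v)) \<longlongrightarrow> D) sequentially" by (rule filterlim_compose[rotated])
  have lim2: "((\<lambda>k. ?g (y k v)) \<longlongrightarrow> 0) sequentially"
  proof (rule Lim_null_comparison[OF _ inv0[of "L * real (card I)"]])
    show "eventually (\<lambda>k. norm (?g (y k v)) \<le> L * real (card I) / real k) sequentially"
      using ev1
    proof eventually_elim
      case (elim k)
      then have k1: "k \<ge> 1" and Fy: "F (y k) = 0" using k0 by auto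
      \<comment> \<open>The quotient involves \<open>?u\<close>, where only coordinate
        \<open>v\<close> has moved, while \<open>F\<close> vanishes at \<open>y k\<close>. The two
        points agree at \<open>v\<close>, so \<open>dom\<close> controls their distance.\<close>
      let ?u = "x(v := y k v)"
      have "\<bar>F ?u - F (y k)\<bar> \<le> L * (\<Sum>i\<in>I. \<bar>?u i - y k i\<bar>)"
        by (rule L(2)) (use yX[OF k1] xX in fastforce)
      also have "\<dots> \<le> L * (\<Sum>i\<in>I. \<bar>x v - y k v\<bar> / real k)"
        using delta_dom[OF k1] by (intro mult_left_mono[OF _ L(1)] sum_mono) auto
      also have "\<dots> = (L * real (card I) / real k) * \<bar>y k v - x v\<bar>" by (simp add: abs_minus_commute)
      finally have "\<bar>F ?u\<bar> \<le> (L * real (card I) / real k) * \<bar>y k v - x v\<bar>" using Fy by simp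
      then have "\<bar>F ?u\<bar> / \<bar>y k v - x v\<bar> \<le> L * real (card I) / real k"
        using yv[OF k1] by (simp add: divide_le_eq)
      then show ?case using F(2) by simp
    qed
  qed
  show ?thesis by (rule LIMSEQ_unique[OF lim1 lim2])
qed

text \<open>The zero estimate at a single point, with as many derivatives as the degrees
  demand.\<close>

lemma exp_poly_derivs_vanish_imp_zero:
  fixes a :: "nat \<Rightarrow> real poly"
  assumes "\<And>t. (\<Sum>j<L1. poly ((twisted_pderiv (of_nat j) ^^ t) (a j)) x * exp (of_nat j * x)) = 0" "j < L1"
  shows "a j = 0"
proof -
  define L0 where "L0 = Suc (\<Sum>j<L1. degree (a j))"
  show ?thesis
  proof (rule exp_poly_zero_estimate[where w = "\<lambda>_. x" and z = "\<lambda>_ j. exp (of_nat j * x)"])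
    show "degree (a j) < L0" if "j < L1" for j
      using member_le_sum[of j "{..<L1}" "\<lambda>j. degree (a j)"] that by (simp add: L0_def)
    show "L0 * L1 \<le> 1 * (L0 * L1 + L1 + 1 - L1)" "L1 < L0 * L1 + L1 + 1" by auto
    show "inj_on (\<lambda>_::nat. x) {..<1}" by (simp add: inj_on_def)
  qed (use assms in auto)
qed

text \<open>Coordinates are removed in increasing order because coordinate \<open>l\<close>
  dominates the error among \<open>l, ..., n\<close>. Exponent vectors are functions on all
  naturals, so \<open>inj\<close> asks that they differ inside the remaining range.\<close>

lemma exp_monomials_independent:
  fixes x :: "nat \<Rightarrow> real" and q :: "nat \<Rightarrow> nat" and p :: "nat \<Rightarrow> nat \<Rightarrow> int"
    and K :: "(nat \<Rightarrow> nat \<times> nat) set" and c :: "(nat \<Rightarrow> nat \<times> nat) \<Rightarrow> int"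
  assumes q: "\<And>k. k \<ge> 1 \<Longrightarrow> q k \<ge> k"
    and nz: "\<And>k i. k \<ge> 1 \<Longrightarrow> i \<in> {1..n} \<Longrightarrow> real (q k) * x i \<noteq> of_int (p k i)"
    and small: "\<And>k i. k \<ge> 1 \<Longrightarrow> i \<in> {1..n} \<Longrightarrow> \<bar>real (q k) * x i - of_int (p k i)\<bar> \<le> exp (- (real (q k) ^ 4))"
    and dom: "\<And>k i j. k \<ge> 1 \<Longrightarrow> 1 \<le> i \<Longrightarrow> i < j \<Longrightarrow> j \<le> n \<Longrightarrow>
      real k * \<bar>real (q k) * x j - of_int (p k j)\<bar> \<le> \<bar>real (q k) * x i - of_int (p k i)\<bar>"
    and l: "1 \<le> l" and K: "finite K"
    and inj: "\<And>\<alpha> \<beta>. \<alpha> \<in> K \<Longrightarrow> \<beta> \<in> K \<Longrightarrow> (\<And>i. i \<in> {l..n} \<Longrightarrow> \<alpha> i = \<beta> i) \<Longrightarrow> \<alpha> = \<beta>"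
    and rel: "(\<Sum>\<alpha>\<in>K. of_int (c \<alpha>) * (\<Prod>i\<in>{l..n}. x i ^ fst (\<alpha> i) * exp (x i) ^ snd (\<alpha> i))) = 0"
    and \<alpha>: "\<alpha> \<in> K"
  shows "c \<alpha> = 0"
  using l K inj rel \<alpha>
proof (induction "Suc n - l" arbitrary: l K \<alpha>)
  case 0
  then have e: "{l..n} = {}" by simp
  \<comment> \<open>With no coordinate left, \<open>inj\<close> identifies all exponent vectors and
    the relation reads \<open>c \<alpha> = 0\<close>.\<close>
  have "K = {\<alpha>}" using 0(4)[OF _ 0(6)] 0(6) e by blast
  then show ?case using 0(5) e by simp
next
  case (Suc m)
  let ?I = "{l..n}"
  have ln: "l \<le> n" using Suc.hyps(2) by simp
  have I: "?I = insert l {Suc l..n}" using ln by auto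
  have lI: "l \<in> ?I" "finite ?I" using ln by auto
  define mon where "mon \<beta> t = (\<Prod>i\<in>?I. t i ^ fst (\<beta> i) * exp (t i) ^ snd (\<beta> i))"
    for \<beta> :: "nat \<Rightarrow> nat \<times> nat" and t :: "nat \<Rightarrow> real"
  define mon' where "mon' \<beta> = (\<Prod>i\<in>{Suc l..n}. x i ^ fst (\<beta> i) * exp (x i) ^ snd (\<beta> i))"
    for \<beta> :: "nat \<Rightarrow> nat \<times> nat"
  have mon: "mon \<beta> (x(l := s)) = s ^ fst (\<beta> l) * exp (of_nat (snd (\<beta> l)) * s) * mon' \<beta>" for \<beta> s
    unfolding mon_def mon'_def I by (simp add: exp_of_nat_mult)
  define F where "F t = (\<Sum>\<beta>\<in>K. of_int (c \<beta>) * mon \<beta> t)" for t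
  have Fin: "F \<in> exp_polys ?I"
    unfolding F_def mon_def
    by (intro exp_polys_sum exp_polys_prod exp_polys.mult exp_polys.const exp_polys_power exp_polys.var exp_polys.exp Suc.prems(2) lI)
  have Fx: "F x = 0" using Suc.prems(4) by (simp add: F_def mon_def)
  define L1 where "L1 = Suc (\<Sum>\<beta>\<in>K. snd (\<beta> l))"
  have L1: "snd (\<beta> l) < L1" if "\<beta> \<in> K" for \<beta>
    using member_le_sum[of \<beta> K "\<lambda>\<beta>. snd (\<beta> l)"] Suc.prems(2) that by (simp add: L1_def)
  \<comment> \<open>The coefficient of \<open>exp (j * s)\<close> when \<open>F\<close> is read as a
    function of coordinate \<open>l\<close> alone, the others being fixed at
    \<open>x\<close>.\<close>
  define a where "a j = (\<Sum>\<beta>\<in>K. if snd (\<beta> l) = j then monom (of_int (c \<beta>) * mon' \<beta>) (fst (\<beta> l)) else 0)"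
    for j :: nat
  have F_eq: "F (x(l := s)) = (\<Sum>j<L1. poly (a j) s * exp (of_nat j * s))" for s
  proof -
    have "(\<Sum>j<L1. poly (a j) s * exp (of_nat j * s)) =
        (\<Sum>j<L1. \<Sum>\<beta>\<in>K. if snd (\<beta> l) = j then of_int (c \<beta>) * mon' \<beta> * s ^ fst (\<beta> l) * exp (of_nat j * s) else 0)"
      unfolding a_def poly_sum sum_distrib_right by (intro sum.cong refl) (simp add: poly_monom)
    also have "\<dots> = (\<Sum>\<beta>\<in>K. of_int (c \<beta>) * mon' \<beta> * s ^ fst (\<beta> l) * exp (of_nat (snd (\<beta> l)) * s))"
      by (subst sum.swap) (intro sum.cong refl, simp add: sum.delta L1)
    finally show ?thesis by (simp add: F_def mon mult_ac)
  qed
  \<comment> \<open>Membership in \<open>exp_polys\<close> concerns all coordinates and is part of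
    the induction, since the next derivative is shown to vanish by approximating all of
    them.\<close>
  have derivs: "\<exists>G\<in>exp_polys ?I. G x = 0 \<and>
      (\<forall>s. G (x(l := s)) = (\<Sum>j<L1. poly ((twisted_pderiv (of_nat j) ^^ t) (a j)) s * exp (of_nat j * s)))" for t
  proof (induction t)
    case 0
    show ?case by (intro bexI[OF _ Fin] conjI allI Fx) (simp only: F_eq funpow_0)
  next
    case (Suc t)
    then obtain G where G: "G \<in> exp_polys ?I" "G x = 0"
      "\<And>s. G (x(l := s)) = (\<Sum>j<L1. poly ((twisted_pderiv (of_nat j) ^^ t) (a j)) s * exp (of_nat j * s))"
      by blast
    obtain G' where G': "G' \<in> exp_polys ?I"
      "\<And>t s. ((\<lambda>s. G (t(l := s))) has_real_derivative G' (t(l := s))) (at s)"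
      by (rule exp_polys_partial_derivative[OF G(1) lI(1)]) (rule that)
    have "G' x = 0"
    proof (rule partial_derivative_vanishes[OF lI(2,1) G(1,2), where q = q and p = p])
      show "k \<le> q k" if "k \<ge> 1" for k using q[OF that] .
      show "real (q k) * x l \<noteq> of_int (p k l)" if "k \<ge> 1" for k
        using nz[OF that, of l] ln \<open>1 \<le> l\<close> by simp
      show "\<bar>real (q k) * x i - of_int (p k i)\<bar> \<le> exp (- (real (q k) ^ 4))" if "k \<ge> 1" "i \<in> ?I" for k i
        using small[OF that(1), of i] that(2) \<open>1 \<le> l\<close> by simp
      show "real k * \<bar>real (q k) * x i - of_int (p k i)\<bar> \<le> \<bar>real (q k) * x l - of_int (p k l)\<bar>"
        if "k \<ge> 1" "i \<in> ?I" "i \<noteq> l" for k i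
        using dom[OF that(1) \<open>1 \<le> l\<close>, of i] that(2,3) by simp
      show "((\<lambda>s. G (x(l := s))) has_real_derivative G' x) (at (x l))"
        using G'(2)[of x "x l"] by simp
    qed
    moreover have "G' (x(l := s)) = (\<Sum>j<L1. poly ((twisted_pderiv (of_nat j) ^^ Suc t) (a j)) s * exp (of_nat j * s))" for s
    proof (rule DERIV_unique[OF G'(2)])
      show "((\<lambda>s. G (x(l := s))) has_real_derivative
          (\<Sum>j<L1. poly ((twisted_pderiv (of_nat j) ^^ Suc t) (a j)) s * exp (of_nat j * s))) (at s)"
        unfolding G(3) funpow.simps(2) o_apply by (rule exp_poly_has_field_derivative)
    qed
    ultimately show ?case using G'(1) by blast
  qed
  have a0: "a j = 0" if "j < L1" for j
  proof (rule exp_poly_derivs_vanish_imp_zero[OF _ that])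
    fix t
    obtain G where "G x = 0"
      "\<And>s. G (x(l := s)) = (\<Sum>j<L1. poly ((twisted_pderiv (of_nat j) ^^ t) (a j)) s * exp (of_nat j * s))"
      using derivs[of t] by blast
    then show "(\<Sum>j<L1. poly ((twisted_pderiv (of_nat j) ^^ t) (a j)) (x l) * exp (of_nat j * x l)) = 0"
      by (metis fun_upd_triv)
  qed
  \<comment> \<open>The monomials that agree with \<alpha> at coordinate \<open>l\<close>: together
    they form one coefficient of one \<open>a j\<close>, which vanishes and thus is a relation in
    the remaining coordinates.\<close>
  define K' where "K' = {\<beta> \<in> K. \<beta> l = \<alpha> l}"
  show ?case
  proof (rule Suc.hyps(1)[of "Suc l" K'])
    show "m = Suc n - Suc l" "1 \<le> Suc l" using Suc.hyps(2) by auto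
    show "finite K'" "\<alpha> \<in> K'" using Suc.prems by (auto simp: K'_def)
    fix \<beta> \<gamma> assume "\<beta> \<in> K'" "\<gamma> \<in> K'" "\<And>i. i \<in> {Suc l..n} \<Longrightarrow> \<beta> i = \<gamma> i"
    then show "\<beta> = \<gamma>" unfolding K'_def by (intro Suc.prems(3)) (auto simp: I)
  next
    have "0 = coeff (a (snd (\<alpha> l))) (fst (\<alpha> l))" using a0[OF L1[OF Suc.prems(5)]] by simp
    also have "\<dots> = (\<Sum>\<beta>\<in>K. if \<beta> l = \<alpha> l then of_int (c \<beta>) * mon' \<beta> else 0)"
      unfolding a_def coeff_sum by (intro sum.cong refl) (auto simp: prod_eq_iff)
    also have "\<dots> = (\<Sum>\<beta>\<in>K'. of_int (c \<beta>) * mon' \<beta>)"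
      unfolding K'_def using Suc.prems(2) by (simp add: sum.inter_filter)
    finally show "(\<Sum>\<beta>\<in>K'. of_int (c \<beta>) * (\<Prod>i\<in>{Suc l..n}. x i ^ fst (\<beta> i) * exp (x i) ^ snd (\<beta> i))) = 0"
      by (simp add: mon'_def)
  qed
qed

section \<open>Passage from rational polynomials to integer relations, and the final
  assembly\<close>

lemma rat_common_denominator:
  assumes "finite A"
  obtains N :: int where "N > 0" "\<And>r :: rat. r \<in> A \<Longrightarrow> \<exists>k::int. of_int N * r = of_int k"
proof -
  have "\<exists>N>0. \<forall>r\<in>A. \<exists>k::int. of_int N * r = of_int k"
    using assms
  proof (induction A rule: finite_induct)
    case empty
    show ?case by (rule exI[of _ 1]) simp
  next
    case (insert r A)
    then obtain N where N: "N > 0" "\<forall>r\<in>A. \<exists>k::int. of_int N * r = of_int k" by blast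
    obtain a b where r: "r = Rat.Fract a b" "b > 0" by (cases r)
    have 1: "of_int (N * b) * r = of_int (N * a)"
      using r by (simp add: Fract_of_int_quotient)
    have 2: "\<exists>k::int. of_int (N * b) * r' = of_int k" if "r' \<in> A" for r'
    proof -
      from N(2) that obtain k :: int where k: "of_int N * r' = of_int k" by blast
      have "of_int (N * b) * r' = of_int b * (of_int N * r')" by simp
      also have "\<dots> = of_int (b * k)" by (simp add: k)
      finally show ?thesis by blast
    qed
    show ?case
    proof (rule exI[of _ "N * b"], intro conjI ballI)
      show "N * b > 0" using N(1) r(2) by simp
      fix r' assume "r' \<in> insert r A"
      then show "\<exists>k::int. of_int (N * b) * r' = of_int k" using 1 2 by blast
    qed
  qed
  then show ?thesis using that by blast
qed

lemma strong_schanuel_if_exp_monomials_independent: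
  fixes x :: "nat \<Rightarrow> real"
  assumes indep: "\<And>(K :: (nat \<Rightarrow> nat \<times> nat) set) (c :: (nat \<Rightarrow> nat \<times> nat) \<Rightarrow> int) \<alpha>. finite K \<Longrightarrow>
    (\<And>\<alpha> \<beta>. \<alpha> \<in> K \<Longrightarrow> \<beta> \<in> K \<Longrightarrow> (\<And>i. i \<in> {1..n} \<Longrightarrow> \<alpha> i = \<beta> i) \<Longrightarrow> \<alpha> = \<beta>) \<Longrightarrow>
    (\<Sum>\<alpha>\<in>K. of_int (c \<alpha>) * (\<Prod>i\<in>{1..n}. x i ^ fst (\<alpha> i) * exp (x i) ^ snd (\<alpha> i))) = 0 \<Longrightarrow>
    \<alpha> \<in> K \<Longrightarrow> c \<alpha> = 0"
  shows "strong_schanuel_property n (\<lambda>i. complex_of_real (x i))"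
  unfolding strong_schanuel_property_def algebraically_independent_over_rat_def
proof (intro allI impI notI, elim conjE)
  fix P :: "(nat + nat) rat_mpoly"
  let ?J = "{1..n} <+> {1..n}"
  let ?z = "case_sum (\<lambda>i. complex_of_real (x i)) (\<lambda>i. exp (complex_of_real (x i)))"
  assume P: "P \<noteq> 0" and ind: "indeterminates P \<subseteq> ?J" and ev: "eval_mpoly ?z P = 0"
  let ?S = "Poly_Mapping.keys P"
  \<comment> \<open>A monomial in the disjoint sum of indices becomes a function that lists, for
    each \<open>i\<close>, the exponents of \<open>x i\<close> and of
    \<open>exp (x i)\<close>.\<close>
  define ex where "ex m = (\<lambda>i::nat. (Poly_Mapping.lookup m (Inl i :: nat + nat), Poly_Mapping.lookup m (Inr i :: nat + nat)))"
    for m :: "nat + nat \<Rightarrow>\<^sub>0 nat"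
  have outside: "Poly_Mapping.lookup m v = 0" if "m \<in> ?S" "v \<notin> ?J" for m v
    using ind that unfolding indeterminates_def by (force simp: in_keys_iff)
  have agree: "m = m'" if m: "m \<in> ?S" "m' \<in> ?S" "\<And>i. i \<in> {1..n} \<Longrightarrow> ex m i = ex m' i" for m m'
  proof (rule poly_mapping_eqI)
    fix v :: "nat + nat"
    show "Poly_Mapping.lookup m v = Poly_Mapping.lookup m' v"
    proof (cases "v \<in> ?J")
      case True
      then show ?thesis using m(3) by (auto simp: ex_def elim!: PlusE)
    next
      case False
      then show ?thesis using outside m by simp
    qed
  qed
  then have inj: "inj_on ex ?S" by (auto intro!: inj_onI)
  obtain N :: int where N: "N > 0"
    "\<And>r :: rat. r \<in> Poly_Mapping.lookup P ` ?S \<Longrightarrow> \<exists>k::int. of_int N * r = of_int k"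
    by (rule rat_common_denominator[of "Poly_Mapping.lookup P ` ?S"]) auto
  have "\<forall>m\<in>?S. \<exists>k::int. of_int N * Poly_Mapping.lookup P m = of_int k" using N(2) by blast
  then obtain d where d: "\<And>m. m \<in> ?S \<Longrightarrow> of_int N * Poly_Mapping.lookup P m = of_int (d m)"
    by (auto dest!: bchoice)
  define c where "c \<alpha> = d (inv_into ?S ex \<alpha>)" for \<alpha>
  have c: "c (ex m) = d m" if "m \<in> ?S" for m using inj that by (simp add: c_def)
  have mon: "(\<Prod>v\<in>Poly_Mapping.keys m. ?z v ^ Poly_Mapping.lookup m v) =
      complex_of_real (\<Prod>i\<in>{1..n}. x i ^ fst (ex m i) * exp (x i) ^ snd (ex m i))" if m: "m \<in> ?S" for m
  proof -
    have "(\<Prod>v\<in>Poly_Mapping.keys m. ?z v ^ Poly_Mapping.lookup m v) = (\<Prod>v\<in>?J. ?z v ^ Poly_Mapping.lookup m v)"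
    proof (rule prod.mono_neutral_left)
      show "Poly_Mapping.keys m \<subseteq> ?J" using ind m unfolding indeterminates_def by blast
    qed (auto simp: in_keys_iff)
    also have "\<dots> = (\<Prod>i\<in>{1..n}. ?z (Inl i) ^ Poly_Mapping.lookup m (Inl i)) *
        (\<Prod>i\<in>{1..n}. ?z (Inr i) ^ Poly_Mapping.lookup m (Inr i))"
      by (simp add: prod.Plus)
    also have "\<dots> = complex_of_real (\<Prod>i\<in>{1..n}. x i ^ fst (ex m i) * exp (x i) ^ snd (ex m i))"
      by (simp add: ex_def prod.distrib exp_of_real)
    finally show ?thesis .
  qed
  have "complex_of_real (\<Sum>\<alpha>\<in>ex ` ?S. of_int (c \<alpha>) * (\<Prod>i\<in>{1..n}. x i ^ fst (\<alpha> i) * exp (x i) ^ snd (\<alpha> i)))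
      = of_int N * eval_mpoly ?z P"
  proof -
    have dm: "complex_of_int (d m) = of_int N * of_rat (Poly_Mapping.lookup P m)" if "m \<in> ?S" for m
      using arg_cong[OF d[OF that], of "of_rat :: rat \<Rightarrow> complex"] by (simp add: of_rat_mult)
    have "complex_of_real (\<Sum>\<alpha>\<in>ex ` ?S. of_int (c \<alpha>) * (\<Prod>i\<in>{1..n}. x i ^ fst (\<alpha> i) * exp (x i) ^ snd (\<alpha> i)))
        = (\<Sum>m\<in>?S. of_int (d m) * complex_of_real (\<Prod>i\<in>{1..n}. x i ^ fst (ex m i) * exp (x i) ^ snd (ex m i)))"
      by (subst sum.reindex[OF inj]) (simp add: c)
    also have "\<dots> = (\<Sum>m\<in>?S. of_int N * (of_rat (Poly_Mapping.lookup P m) *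
        (\<Prod>v\<in>Poly_Mapping.keys m. ?z v ^ Poly_Mapping.lookup m v)))"
      by (intro sum.cong refl) (simp only: dm mon mult.assoc)
    finally show ?thesis unfolding eval_mpoly_def by (simp only: sum_distrib_left)
  qed
  then have zero: "(\<Sum>\<alpha>\<in>ex ` ?S. of_int (c \<alpha>) * (\<Prod>i\<in>{1..n}. x i ^ fst (\<alpha> i) * exp (x i) ^ snd (\<alpha> i))) = 0"
    unfolding ev mult_zero_right by (simp only: of_real_eq_0_iff)
  obtain m where m: "m \<in> ?S" using P by (metis all_not_in_conv keys_eq_empty)
  have "c (ex m) = 0"
  proof (rule indep[OF _ _ zero])
    show "\<alpha> = \<beta>" if "\<alpha> \<in> ex ` ?S" "\<beta> \<in> ex ` ?S" "\<And>i. i \<in> {1..n} \<Longrightarrow> \<alpha> i = \<beta> i" for \<alpha> \<beta>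
      using that agree by blast
  qed (use m in auto)
  then have "of_int N * Poly_Mapping.lookup P m = 0" using c[OF m] d[OF m] by simp
  then show False using N(1) m by (simp add: in_keys_iff)
qed

text \<open>For \<open>n = 1\<close> the chain carries no power of \<open>k\<close>, and a constant
  sequence \<open>q\<close> satisfies it for some rational \<open>x 1\<close>;
  \<open>nondegenerate\<close> excludes this. For larger \<open>n\<close> the powers of
  \<open>k\<close> already force \<open>q\<close> to take infinitely many values.\<close>

theorem theorem3p1:
  fixes \<psi> :: "nat \<Rightarrow> real" and n :: nat and x :: "nat \<Rightarrow> real" and q :: "nat \<Rightarrow> nat"
  assumes psi_pos: "\<And>m. m > 0 \<Longrightarrow> \<psi> m > 0"
    and psi_decreasing: "antimono_on {0<..} \<psi>"
    and psi_less: "\<And>m. m > 0 \<Longrightarrow> \<psi> m < exp (- (real m ^ 4))"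
    and n_pos: "n \<ge> 1"
    and q_pos: "\<And>k. k \<ge> 1 \<Longrightarrow> q k > 0"
    and chain_pos: "\<And>k. k \<ge> 1 \<Longrightarrow>
      0 < real k ^ (n - 1) * nearest_int_dist (real (q k) * x n)"
    and chain_step: "\<And>k i. k \<ge> 1 \<Longrightarrow> 1 \<le> i \<Longrightarrow> i < n \<Longrightarrow>
      real k ^ i * nearest_int_dist (real (q k) * x (i + 1))
        \<le> real k ^ (i - 1) * nearest_int_dist (real (q k) * x i)"
    and chain_psi: "\<And>k. k \<ge> 1 \<Longrightarrow> nearest_int_dist (real (q k) * x 1) \<le> \<psi> (q k)"
    and nondegenerate: "n = 1 \<Longrightarrow> infinite (q ` {1..})"
  shows "strong_schanuel_property n (\<lambda>i. complex_of_real (x i))"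
proof -
  define eps where "eps k i = nearest_int_dist (real (q k) * x i)" for k i
  have eps0: "eps k i \<ge> 0" for k i by (simp add: eps_def infdist_nonneg)
  \<comment> \<open>Common powers of \<open>k\<close> cancel between neighbours of the chain. The
    single factor \<open>k\<close> that remains gives the domination by the earlier
    coordinate.\<close>
  have step: "real k * eps k (Suc i) \<le> eps k i" if k: "k \<ge> 1" and i: "1 \<le> i" "i < n" for k i
  proof -
    have "real k ^ i = real k ^ (i - 1) * real k" using i(1) by (cases i) auto
    then have "real k ^ (i - 1) * (real k * eps k (Suc i)) \<le> real k ^ (i - 1) * eps k i"
      using chain_step[OF k i] by (simp add: eps_def mult.assoc)
    then show ?thesis using k by simp
  qed
  have mono: "eps k j \<le> eps k i" if k: "k \<ge> 1" and ij: "1 \<le> i" "i \<le> j" "j \<le> n" for k i j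
    using ij(2,3)
  proof (induction j rule: dec_induct)
    case (step j)
    have "1 * eps k (Suc j) \<le> real k * eps k (Suc j)" using k eps0 by (intro mult_right_mono) auto
    also have "\<dots> \<le> eps k j" using step \<open>1 \<le> i\<close> by (intro \<open>\<And>k i. 1 \<le> k \<Longrightarrow> 1 \<le> i \<Longrightarrow> i < n \<Longrightarrow> real k * eps k (Suc i) \<le> eps k i\<close> k) auto
    finally show ?case using step by simp
  qed simp
  have dom: "real k * eps k j \<le> eps k i" if k: "k \<ge> 1" and ij: "1 \<le> i" "i < j" "j \<le> n" for k i j
  proof -
    have "real k * eps k j \<le> real k * eps k (Suc i)" using mono[of k "Suc i" j] k ij by (intro mult_left_mono) auto
    also have "\<dots> \<le> eps k i" using step k ij by simp
    finally show ?thesis .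
  qed
  have pos: "eps k i > 0" if k: "k \<ge> 1" and i: "1 \<le> i" "i \<le> n" for k i
  proof -
    have "eps k n > 0" using chain_pos[OF k] k eps0[of k n] by (simp add: eps_def zero_less_mult_iff)
    then show ?thesis using mono[OF k i(1,2)] by simp
  qed
  have small: "eps k i \<le> exp (- (real (q k) ^ 4))" if k: "k \<ge> 1" and i: "1 \<le> i" "i \<le> n" for k i
  proof -
    have "eps k i \<le> eps k 1" using mono[OF k _ i] by simp
    also have "\<dots> \<le> \<psi> (q k)" unfolding eps_def by (rule chain_psi[OF k])
    also have "\<dots> \<le> exp (- (real (q k) ^ 4))" using psi_less[OF q_pos[OF k]] by simp
    finally show ?thesis .
  qed
  have "\<exists>p::int. \<bar>real (q k) * x i - of_int p\<bar> = eps k i" for k i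
  proof -
    obtain z where "z \<in> (\<int> :: real set)" "infdist (real (q k) * x i) \<int> = dist (real (q k) * x i) z"
    proof (rule infdist_attains_inf[of "\<int> :: real set" "real (q k) * x i"])
      show "(\<int> :: real set) \<noteq> {}" using Ints_0 by blast
    qed (simp, rule that)
    then show ?thesis by (auto simp: eps_def dist_real_def elim!: Ints_cases)
  qed
  then obtain p :: "nat \<Rightarrow> nat \<Rightarrow> int" where p: "\<And>k i. \<bar>real (q k) * x i - of_int (p k i)\<bar> = eps k i"
    by metis
  \<comment> \<open>For \<open>n \<ge> 2\<close> the ratios \<open>eps k 2 / eps k 1 \<le> 1 / k\<close> take infinitely many positive values,
    and each of them is determined by \<open>q k\<close>.\<close>
  have inf: "infinite (q ` {M..})" for M
  proof (cases "n = 1")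
    case True
    have "{1..} \<subseteq> {1..<M} \<union> {M..}" by auto
    then have "q ` {1..} \<subseteq> q ` {1..<M} \<union> q ` {M..}" by blast
    then show ?thesis using nondegenerate[OF True] by (meson finite_UnI finite_atLeastLessThan finite_imageI finite_subset)
  next
    case False
    then have n2: "n \<ge> 2" using n_pos by simp
    show ?thesis
    proof
      assume fin: "finite (q ` {M..})"
      define rat where "rat b = nearest_int_dist (real b * x 2) / nearest_int_dist (real b * x 1)" for b :: nat
      have rat: "rat (q k) > 0" "rat (q k) \<le> 1 / real k" if "k \<ge> 1" for k
      proof -
        have e: "eps k 1 > 0" "eps k 2 > 0" using pos[OF that] n2 by auto
        then show "rat (q k) > 0" by (simp add: rat_def eps_def)
        have "real k * eps k 2 \<le> eps k 1" using dom[OF that, of 1 2] n2 by simp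
        then have "eps k 2 / eps k 1 \<le> 1 / real k" using e that by (simp add: field_simps)
        then show "rat (q k) \<le> 1 / real k" by (simp add: rat_def eps_def)
      qed
      let ?A = "rat ` q ` {max 1 M..}"
      have finA: "finite ?A" using fin by (rule finite_imageI[OF finite_subset, rotated]) auto
      have neA: "?A \<noteq> {}" by auto
      have "Min ?A \<in> ?A" by (rule Min_in[OF finA neA])
      then have "Min ?A > 0" using rat(1) by auto
      then obtain k where k: "k > 0" "1 / real k < Min ?A" 
        using reals_Archimedean2 by (metis nat_approx_posE zero_less_Suc)
      define k' where "k' = max k (max 1 M)"
      have "Min ?A \<le> rat (q k')" by (rule Min_le[OF finA]) (simp add: k'_def)
      also have "\<dots> \<le> 1 / real k'" by (rule rat(2)) (simp add: k'_def)
      also have "\<dots> \<le> 1 / real k" using k(1) by (intro divide_left_mono) (auto simp: k'_def)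
      finally show False using k(2) by simp
    qed
  qed
  \<comment> \<open>\<open>q\<close> need not be monotone, so indices are selected again. Both
    inequalities are needed: \<open>q (r k) \<ge> k\<close> for the size of the denominators, and
    \<open>r k \<ge> k\<close> to keep the factor \<open>k\<close> in the domination.\<close>
  have "\<exists>r\<ge>k. q r \<ge> k" for k
  proof -
    have "\<not> q ` {k..} \<subseteq> {..<k}" using inf[of k] finite_subset by blast
    then show ?thesis by (auto simp: not_less)
  qed
  then obtain r where r: "\<And>k. r k \<ge> k" "\<And>k. q (r k) \<ge> k" by metis
  show ?thesis
  proof (rule strong_schanuel_if_exp_monomials_independent)
    fix K :: "(nat \<Rightarrow> nat \<times> nat) set" and c :: "(nat \<Rightarrow> nat \<times> nat) \<Rightarrow> int" and \<alpha>
    assume K: "finite K" "\<And>\<alpha> \<beta>. \<alpha> \<in> K \<Longrightarrow> \<beta> \<in> K \<Longrightarrow> (\<And>i. i \<in> {1..n} \<Longrightarrow> \<alpha> i = \<beta> i) \<Longrightarrow> \<alpha> = \<beta>"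
      "(\<Sum>\<alpha>\<in>K. of_int (c \<alpha>) * (\<Prod>i\<in>{1..n}. x i ^ fst (\<alpha> i) * exp (x i) ^ snd (\<alpha> i))) = 0"
      "\<alpha> \<in> K"
    show "c \<alpha> = 0"
    proof (rule exp_monomials_independent[where q = "\<lambda>k. q (r k)" and p = "\<lambda>k. p (r k)" and x = x and n = n and l = 1 and K = K])
      fix k :: nat assume k: "k \<ge> 1"
      then have rk: "r k \<ge> 1" using r(1)[of k] by simp
      show "k \<le> q (r k)" by (rule r(2))
      show "real (q (r k)) * x i \<noteq> of_int (p (r k) i)" if "i \<in> {1..n}" for i
        using p[of "r k" i] pos[OF rk, of i] that by auto
      show "\<bar>real (q (r k)) * x i - of_int (p (r k) i)\<bar> \<le> exp (- (real (q (r k)) ^ 4))" if "i \<in> {1..n}" for i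
        unfolding p using small[OF rk, of i] that by simp
      fix i j :: nat assume ij: "1 \<le> i" "i < j" "j \<le> n"
      have "real k * eps (r k) j \<le> real (r k) * eps (r k) j"
        using r(1)[of k] eps0 by (intro mult_right_mono) auto
      also have "\<dots> \<le> eps (r k) i" by (rule dom[OF rk ij])
      finally show "real k * \<bar>real (q (r k)) * x j - of_int (p (r k) j)\<bar> \<le> \<bar>real (q (r k)) * x i - of_int (p (r k) i)\<bar>"
        by (simp only: p)
    next
      show "\<And>\<alpha> \<beta>. \<alpha> \<in> K \<Longrightarrow> \<beta> \<in> K \<Longrightarrow> (\<And>i. i \<in> {1..n} \<Longrightarrow> \<alpha> i = \<beta> i) \<Longrightarrow> \<alpha> = \<beta>"
        by (rule K(2))
    qed (use K in auto)
  qed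
qed

end
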